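(* Let $B=\{\xi\in\mathbb{R}^{n}:|\xi|\le R\}$ be a ball with $0<R<\infty$ and let $\mathcal{C}=\{\xi\in\mathbb{R}^{n}:r_1\le|\xi|\le r_2\}$ be an annulus with $0<r_1<r_2<\infty$. Then a constant $C>1$ exists such that for any nonnegative integer $k$, any couple $(\overrightarrow{p},\overrightarrow{q})$ with $1\le\overrightarrow{p}\le\overrightarrow{q}\le\infty$, any $\lambda\in(0,\infty)$, and any function $u$ in $L^{\overrightarrow{p}}(\mathbb{R}^{n})$, there hold $$\sup_{|\alpha|=k}\|\partial^{\alpha}u\|_{L^{\overrightarrow{q}}(\mathbb{R}^{n})}\le C\,\lambda^{k+\sum_{i=1}^{n}\left(\frac1{p_i}-\frac1{q_i}\right)}\|u\|_{L^{\overrightarrow{p}}(\mathbb{R}^{n})}\quad\text{with }\operatorname{supp}\widehat{u}\subset\lambda B,$$ $$C^{-1}\lambda^{k}\|u\|_{L^{\overrightarrow{p}}(\mathbb{R}^{n})}\le\sup_{|\alpha|=k}\|\partial^{\alpha}u\|_{L^{\overrightarrow{p}}(\mathbb{R}^{n})}\le C\,\lambda^{k}\|u\|_{L^{\overrightarrow{p}}(\mathbb{R}^{n})}\quad\text{with }\operatorname{supp}\widehat{u}\subset\lambda\mathcal{C},$$ where $\lambda B=\{\xi\in\mathbb{R}^n:|\xi|\le\lambda R\}$ and $\lambda\mathcal{C}=\{\xi\in\mathbb{R}^n:\lambda r_1\le|\xi|\le\lambda r_2\}$.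
   Context: Here $\overrightarrow{p}=(p_1,\dots,p_n)$ and $\overrightarrow{q}=(q_1,\dots,q_n)$ are vectors in $[1,\infty]^n$; inequalities between vectors, or between a vector and a number, are understood componentwise, so $1\le\overrightarrow{p}\le\overrightarrow{q}\le\infty$ means $1\le p_i\le q_i\le\infty$ for all $i$, and $1/\infty=0$. For $\overrightarrow{q}\in[1,\infty]^n$, the anisotropic (mixed) Lebesgue space $L^{\overrightarrow{q}}(\mathbb{R}^n)$ consists of the functions $f$ with finite norm $$\|f\|_{L^{\overrightarrow{q}}(\mathbb{R}^n)}=\Big\|\cdots\big\|\|f\|_{L^{q_1}_{x_1}(\mathbb{R})}\big\|_{L^{q_2}_{x_2}(\mathbb{R})}\cdots\Big\|_{L^{q_n}_{x_n}(\mathbb{R})}$$ (innermost norm in $x_1$). $\alpha$ denotes a multi-index, and $\widehat{u}$ is the Fourier transform of the tempered distribution $u$, normalized so that $\widehat{\partial^{\alpha}u}(\xi)=(i\xi)^{\alpha}\widehat{u}(\xi)$.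
   Formalization: The constant C is replaced by C^{k+1} (and C^{-1} by C^{-(k+1)}), since with C independent of k the inequalities fail: for u=exp(i a x_1), p=q=∞, λ=1, a in [r_1,r_2], a≠1, one has sup of the k-th derivatives equal to a^k. *)

theory Defs
  imports "HOL-Probability.Essential_Supremum"
begin

section \<open>Mixed Lebesgue norms\<close>

text \<open>
  The space \<open>R\<^sup>n\<close> is rendered as \<open>real ^ 'n\<close> with \<open>'n :: {finite, linorder}\<close>; the linear order on
  the index type fixes the enumeration \<open>x\<^sub>1, \<dots>, x\<^sub>n\<close> of the coordinates, which matters because a mixed
  norm depends on the order in which the one-dimensional norms are taken.
\<close>

text \<open>Only used with \<open>a > 0\<close>.\<close>
definition ennpowr :: "ennreal \<Rightarrow> real \<Rightarrow> ennreal" where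
  "ennpowr x a = (if x = \<infinity> then \<infinity> else ennreal (enn2real x powr a))"

definition recip :: "ennreal \<Rightarrow> real" where
  "recip p = enn2real (1 / p)"

definition Lp_norm_1d :: "ennreal \<Rightarrow> (real \<Rightarrow> ennreal) \<Rightarrow> ennreal" where
  "Lp_norm_1d p g =
     (if p = \<infinity> then esssup lborel g
      else ennpowr (\<integral>\<^sup>+ t. ennpowr (g t) (enn2real p) \<partial>lborel) (recip p))"

definition upd_coord :: "real ^ 'n::finite \<Rightarrow> 'n \<Rightarrow> real \<Rightarrow> real ^ 'n" where
  "upd_coord x i t = (\<chi> j. if j = i then t else x $ j)"

text \<open>
  The norm in the first listed coordinate is innermost.  After all coordinates have been
  processed the result no longer depends on the point, so it is evaluated at the origin.
\<close>
primrec iterated_norm ::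
  "('n::finite \<Rightarrow> ennreal) \<Rightarrow> 'n list \<Rightarrow> (real ^ 'n \<Rightarrow> ennreal) \<Rightarrow> ennreal" where
  "iterated_norm p [] F = F 0"
| "iterated_norm p (i # is) F =
     iterated_norm p is (\<lambda>x. Lp_norm_1d (p i) (\<lambda>t. F (upd_coord x i t)))"

definition mixed_norm ::
  "('n::{finite,linorder} \<Rightarrow> ennreal) \<Rightarrow> (real ^ 'n::_ \<Rightarrow> complex) \<Rightarrow> ennreal" where
  "mixed_norm p f =
     iterated_norm p (sorted_list_of_set UNIV) (\<lambda>x. ennreal (norm (f x)))"

text \<open>
  Elements are functions rather than almost-everywhere classes.  Borel (not merely Lebesgue)
  measurability makes all sections measurable, and every class has a Borel representative.
\<close>
definition mixed_Lebesgue ::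
  "('n::{finite,linorder} \<Rightarrow> ennreal) \<Rightarrow> (real ^ 'n::_ \<Rightarrow> complex) set" where
  "mixed_Lebesgue p = {f. f \<in> borel_measurable borel \<and> mixed_norm p f < \<infinity>}"

section \<open>Multi-index derivatives, Schwartz functions and test functions\<close>

definition partial :: "'n::finite \<Rightarrow> (real ^ 'n \<Rightarrow> complex) \<Rightarrow> real ^ 'n \<Rightarrow> complex" where
  "partial i f x = vector_derivative (\<lambda>t. f (x + t *\<^sub>R axis i 1)) (at 0)"

text \<open>Total differentiability of all iterated partial derivatives is equivalent to \<open>C\<^sup>\<infinity>\<close>.\<close>
definition smooth :: "(real ^ 'n::finite \<Rightarrow> complex) \<Rightarrow> bool" where
  "smooth f \<longleftrightarrow> (\<forall>is x. foldr partial is f differentiable (at x))"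

definition multi_order :: "('n::finite \<Rightarrow> nat) \<Rightarrow> nat" where
  "multi_order \<alpha> = (\<Sum>i\<in>UNIV. \<alpha> i)"

definition multi_deriv ::
  "('n::{finite,linorder} \<Rightarrow> nat) \<Rightarrow> (real ^ 'n::_ \<Rightarrow> complex) \<Rightarrow> real ^ 'n::_ \<Rightarrow> complex" where
  "multi_deriv \<alpha> f = foldr (\<lambda>i. partial i ^^ \<alpha> i) (sorted_list_of_set UNIV) f"

definition schwartz :: "(real ^ 'n::{finite,linorder} \<Rightarrow> complex) set" where
  "schwartz = {\<phi>. smooth \<phi> \<and>
     (\<forall>\<alpha> m. bounded (range (\<lambda>x. (1 + norm x) ^ m *\<^sub>R multi_deriv \<alpha> \<phi> x)))}"

definition test_functions :: "(real ^ 'n::finite) set \<Rightarrow> (real ^ 'n \<Rightarrow> complex) set" where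
  "test_functions U =
     {\<phi>. smooth \<phi> \<and> compact (closure {x. \<phi> x \<noteq> 0}) \<and> closure {x. \<phi> x \<noteq> 0} \<subseteq> U}"

section \<open>Tempered distributions\<close>

text \<open>
  A tempered distribution is represented by its action on Schwartz functions; values outside
  \<^term>\<open>schwartz\<close> are irrelevant.  Continuity is not recorded, as all distributions
  considered are obtained from functions in mixed Lebesgue spaces.
\<close>
type_synonym 'n distr = "(real ^ 'n \<Rightarrow> complex) \<Rightarrow> complex"

definition distr_of :: "(real ^ 'n::finite \<Rightarrow> complex) \<Rightarrow> 'n distr" where
  "distr_of f = (\<lambda>\<phi>. \<integral>x. f x * \<phi> x \<partial>lborel)"

definition distr_deriv ::
  "('n::{finite,linorder} \<Rightarrow> nat) \<Rightarrow> 'n distr \<Rightarrow> 'n distr" where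
  "distr_deriv \<alpha> T = (\<lambda>\<phi>. (-1) ^ multi_order \<alpha> * T (multi_deriv \<alpha> \<phi>))"

definition fourier :: "(real ^ 'n::finite \<Rightarrow> complex) \<Rightarrow> real ^ 'n \<Rightarrow> complex" where
  "fourier \<phi> \<xi> = (\<integral>x. exp (- \<i> * of_real (x \<bullet> \<xi>)) * \<phi> x \<partial>lborel)"

definition distr_fourier :: "'n::finite distr \<Rightarrow> 'n distr" where
  "distr_fourier T = (\<lambda>\<phi>. T (fourier \<phi>))"

definition distr_supp :: "'n::finite distr \<Rightarrow> (real ^ 'n) set" where
  "distr_supp T = {\<xi>. \<forall>U. open U \<and> \<xi> \<in> U \<longrightarrow> (\<exists>\<phi>\<in>test_functions U. T \<phi> \<noteq> 0)}"

definition represents :: "(real ^ 'n::{finite,linorder} \<Rightarrow> complex) \<Rightarrow> 'n distr \<Rightarrow> bool" where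
  "represents f T \<longleftrightarrow> f \<in> borel_measurable borel \<and>
     (\<forall>\<phi>\<in>schwartz. integrable lborel (\<lambda>x. f x * \<phi> x) \<and> T \<phi> = distr_of f \<phi>)"

text \<open>
  Representing functions agree almost everywhere, hence have the same mixed norm; the infimum
  selects this common value, and is \<open>\<infinity>\<close> if the distribution is not a function.
\<close>
definition distr_mixed_norm ::
  "('n::{finite,linorder} \<Rightarrow> ennreal) \<Rightarrow> 'n distr \<Rightarrow> ennreal" where
  "distr_mixed_norm p T = (INF f\<in>{f. represents f T}. mixed_norm p f)"

end

theory Submission
  imports Defs "HOL-Probability.Probability"
begin

text \<open>
  A function whose spectrum lies in a ball is reproduced by convolution with a smooth, rapidly
  decaying kernel.  Its derivatives are convolutions with kernels of the same kind, and on an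
  annulus the function itself is a sum of such convolutions of its first derivatives.  Every
  inequality is therefore a bound for a single convolution in mixed norms.

  In detail, let \<open>m\<close> be a test function that equals 1 near the ball \<open>B\<close>, and let \<open>\<Phi>\<close> be its inverse
  Fourier transform.  If the spectrum of \<open>u\<close> lies in \<open>l B\<close>, multiplication by \<open>m (\<xi> / l)\<close> does not
  change the Fourier transform of \<open>u\<close>, so that \<open>u\<close> is its convolution with \<open>l\<^sup>n \<Phi> (l x)\<close>
  (\<open>spectrum_reproduce\<close>).  Derivatives fall on the kernel (\<open>spectrum_weak_partial\<close>), and each of them
  brings out a factor \<open>l\<close>.  On an annulus \<open>\<xi>\<close> does not vanish; the functions \<open>- \<i> \<xi>\<^sub>j / |\<xi>|\<^sup>2\<close>, cut off
  smoothly, are multipliers that recover \<open>u\<close> from its first derivatives (\<open>spectrum_reconstruct\<close>), and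
  rescaling them brings out a factor \<open>1 / l\<close>.  Derivatives of order \<open>k\<close> are reached by \<open>k\<close> such steps;
  this is possible because differentiation does not enlarge the spectrum, and it is the reason
  why the constants are powers \<open>C\<^bsup>k + 1\<^esup>\<close>.

  For the bound in mixed norms, the rapid decay of \<open>\<Phi>\<close> gives \<open>l\<^sup>n |\<Phi> (l x)| \<le> A (\<Prod>i. h (x\<^sub>i))\<close>, where \<open>h\<close> is
  a probability density on the line with \<open>h \<le> l\<close>.  Convolution with the product is an iterated
  convolution in one variable at a time.  Minkowski's integral inequality moves the norm in
  \<open>x\<^sub>i\<close> past the convolutions in the other variables, which leaves Young's inequality on the line;
  there the \<open>i\<close>-th coordinate contributes the factor \<open>l\<^bsup>1/p\<^sub>i - 1/q\<^sub>i\<^esup>\<close> (\<open>smear_young\<close>,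
  \<open>iterated_norm_conv_iter\<close>).

  The Fourier analysis takes place in the class of functions \<open>f\<close> with
  \<open>\<integral> |f x| (1 + |x|)\<^bsup>-2n\<^esup> dx < \<infinity>\<close>, which contains all the mixed Lebesgue spaces (\<open>mixed_Lebesgue_slow\<close>).
  Such a function is determined almost everywhere by its integrals against Fourier transforms of
  test functions \<open>\<theta>\<close> (\<open>slow_eq_AE\<close>).  In these integrals a convolution turns into multiplication of
  \<open>\<theta>\<close> by a multiplier (\<open>convolve_fourier_multiplier\<close>), and a condition on the spectrum says that they
  vanish for suitable \<open>\<theta>\<close> (\<open>spectrum_vanish\<close>).
\<close>

section \<open>Partial derivatives and smooth functions\<close>

lemma has_derivative_imp_partial:
  fixes f :: "real ^ 'n::finite \<Rightarrow> complex"
  assumes "(f has_derivative f') (at x)"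
  shows "((\<lambda>t. f (x + t *\<^sub>R axis i 1)) has_vector_derivative f' (axis i 1)) (at 0)"
    "partial i f x = f' (axis i 1)"
proof -
  interpret bounded_linear f' using assms by (rule has_derivative_bounded_linear)
  have "((f \<circ> (\<lambda>t. x + t *\<^sub>R axis i 1)) has_derivative f' \<circ> (\<lambda>t::real. t *\<^sub>R axis i 1)) (at 0)"
    by (rule diff_chain_at) (auto intro!: derivative_eq_intros assms)
  then show *: "((\<lambda>t. f (x + t *\<^sub>R axis i 1)) has_vector_derivative f' (axis i 1)) (at 0)"
    by (simp add: has_vector_derivative_def o_def scaleR)
  then show "partial i f x = f' (axis i 1)"
    unfolding partial_def by (rule vector_derivative_at)
qed

lemma has_vector_derivative_partial:
  fixes f :: "real ^ 'n::finite \<Rightarrow> complex"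
  assumes "f differentiable (at (x + s *\<^sub>R axis i 1))"
  shows "((\<lambda>t. f (x + t *\<^sub>R axis i 1)) has_vector_derivative partial i f (x + s *\<^sub>R axis i 1)) (at s)"
proof -
  obtain f' where f': "(f has_derivative f') (at (x + s *\<^sub>R axis i 1))"
    using assms by (auto simp: differentiable_def)
  interpret bounded_linear f' using f' by (rule has_derivative_bounded_linear)
  have "((f \<circ> (\<lambda>t. x + t *\<^sub>R axis i 1)) has_derivative f' \<circ> (\<lambda>t::real. t *\<^sub>R axis i 1)) (at s)"
    by (rule diff_chain_at) (auto intro!: derivative_eq_intros f')
  then show ?thesis
    by (simp add: has_vector_derivative_def o_def scaleR has_derivative_imp_partial(2)[OF f'])
qed

text \<open>
  Smoothness quantifies over all finite sequences of partial derivatives, so it is a coinductive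
  notion.  The smoothness proofs below exhibit a class of functions to which this rule applies.
\<close>
lemma smooth_coinduct:
  assumes "f \<in> X"
    and diff: "\<And>g x. g \<in> X \<Longrightarrow> g differentiable (at x)"
    and part: "\<And>g i. g \<in> X \<Longrightarrow> partial i g \<in> X"
  shows "smooth f"
proof -
  have "foldr partial is f \<in> X" for "is"
    by (induction "is") (auto simp: assms(1) part)
  then show ?thesis by (auto simp: smooth_def diff)
qed

lemma smooth_differentiable: "smooth f \<Longrightarrow> f differentiable (at x)"
  unfolding smooth_def by (metis foldr.simps(1) id_apply)

lemma smooth_partial: "smooth f \<Longrightarrow> smooth (partial i f)"
  unfolding smooth_def
proof (intro allI)
  fix "is" x assume *: "\<forall>is x. foldr partial is f differentiable at x"
  have "foldr partial is (partial i f) = foldr partial (is @ [i]) f" by simp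
  with * show "foldr partial is (partial i f) differentiable at x" by metis
qed

text \<open>
  By the product rule an algebra is closed under differentiation as soon as the derivatives of its
  generators belong to it; the generators themselves need not be closed under differentiation.
\<close>
inductive_set generated_algebra :: "(real ^ 'n::finite \<Rightarrow> complex) set \<Rightarrow> (real ^ 'n \<Rightarrow> complex) set"
  for B where
  base: "f \<in> B \<Longrightarrow> f \<in> generated_algebra B"
| add: "f \<in> generated_algebra B \<Longrightarrow> g \<in> generated_algebra B \<Longrightarrow> (\<lambda>x. f x + g x) \<in> generated_algebra B"
| mult: "f \<in> generated_algebra B \<Longrightarrow> g \<in> generated_algebra B \<Longrightarrow> (\<lambda>x. f x * g x) \<in> generated_algebra B"

lemma partial_add:
  assumes "f differentiable (at x)" "g differentiable (at x)"
  shows "partial i (\<lambda>x. f x + g x) x = partial i f x + partial i g x"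
proof -
  obtain f' g' where *: "(f has_derivative f') (at x)" "(g has_derivative g') (at x)"
    using assms by (auto simp: differentiable_def)
  show ?thesis
    using has_derivative_imp_partial(2)[OF has_derivative_add[OF *]] 
    by (simp add: has_derivative_imp_partial(2)[OF *(1)] has_derivative_imp_partial(2)[OF *(2)])
qed

lemma partial_mult:
  assumes "f differentiable (at x)" "g differentiable (at x)"
  shows "partial i (\<lambda>x. f x * g x) x = f x * partial i g x + partial i f x * g x"
proof -
  obtain f' g' where *: "(f has_derivative f') (at x)" "(g has_derivative g') (at x)"
    using assms by (auto simp: differentiable_def)
  show ?thesis
    using has_derivative_imp_partial(2)[OF has_derivative_mult[OF *]] 
    by (simp add: has_derivative_imp_partial(2)[OF *(1)] has_derivative_imp_partial(2)[OF *(2)])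
qed

lemma smooth_generated_algebra:
  assumes "f \<in> generated_algebra B"
    and diff: "\<And>g x. g \<in> B \<Longrightarrow> g differentiable (at x)"
    and part: "\<And>g i. g \<in> B \<Longrightarrow> partial i g \<in> generated_algebra B"
  shows "smooth f"
proof -
  have d: "g differentiable (at x)" if "g \<in> generated_algebra B" for g x
    using that by induction (auto intro: diff)
  have p: "partial i g \<in> generated_algebra B" if "g \<in> generated_algebra B" for g i
    using that
  proof induction
    case (add f g)
    have "partial i (\<lambda>x. f x + g x) = (\<lambda>x. partial i f x + partial i g x)"
      by (rule ext, rule partial_add) (auto intro: d add)
    then show ?case by (auto intro: generated_algebra.add add)
  next
    case (mult f g)
    have "partial i (\<lambda>x. f x * g x) = (\<lambda>x. f x * partial i g x + partial i f x * g x)"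
      by (rule ext, rule partial_mult) (auto intro: d mult)
    then show ?case by (auto intro!: generated_algebra.add generated_algebra.mult mult)
  qed (rule part)
  show ?thesis by (rule smooth_coinduct[OF assms(1) d p])
qed

lemma smooth_add: "smooth f \<Longrightarrow> smooth g \<Longrightarrow> smooth (\<lambda>x. f x + g x)"
  by (rule smooth_generated_algebra[of _ "{f. smooth f}"])
    (auto intro: generated_algebra.intros smooth_differentiable smooth_partial)

lemma smooth_mult: "smooth f \<Longrightarrow> smooth g \<Longrightarrow> smooth (\<lambda>x. f x * g x)"
  by (rule smooth_generated_algebra[of _ "{f. smooth f}"])
    (auto intro: generated_algebra.intros smooth_differentiable smooth_partial)

lemma partial_const: "partial i (\<lambda>x. c) = (\<lambda>x. 0)"
  by (rule ext) (rule has_derivative_imp_partial(2)[OF has_derivative_const])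

lemma smooth_const: "smooth (\<lambda>x. c)"
  by (rule smooth_coinduct[of _ "range (\<lambda>c x. c)"]) (auto simp: partial_const)

lemma smooth_linear:
  assumes "bounded_linear l" shows "smooth l" "partial i l = (\<lambda>x. l (axis i 1))"
proof -
  have d: "(l has_derivative l) (at x)" for x by (rule bounded_linear_imp_has_derivative[OF assms])
  show p: "partial i l = (\<lambda>x. l (axis i 1))" for i
    by (rule ext) (rule has_derivative_imp_partial(2)[OF d])
  show "smooth l"
    by (rule smooth_coinduct[of _ "insert l (range (\<lambda>c x. c))"])
      (auto simp: partial_const p intro: differentiableI[OF d])
qed

lemma bounded_linear_coord: "bounded_linear (\<lambda>x::real^'n::finite. complex_of_real (x $ i))"
  by (intro bounded_linear_compose[OF bounded_linear_of_real] bounded_linear_vec_nth)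

lemma smooth_coord: "smooth (\<lambda>x. complex_of_real (x $ i))"
  by (rule smooth_linear[OF bounded_linear_coord])

lemma smooth_cmult: "smooth f \<Longrightarrow> smooth (\<lambda>x. c * f x)"
  by (intro smooth_mult smooth_const)

lemma smooth_uminus: "smooth f \<Longrightarrow> smooth (\<lambda>x. - f x)"
  using smooth_cmult[of f "-1"] by simp

lemma smooth_diff: "smooth f \<Longrightarrow> smooth g \<Longrightarrow> smooth (\<lambda>x. f x - g x)"
  using smooth_add[OF _ smooth_uminus, of f g] by simp

lemma smooth_sum: "(\<And>i. i \<in> I \<Longrightarrow> smooth (f i)) \<Longrightarrow> smooth (\<lambda>x. \<Sum>i\<in>I. f i x)"
  by (induction I rule: infinite_finite_induct) (auto intro: smooth_add smooth_const)

lemma smooth_affine: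
  assumes "smooth f" shows "smooth (\<lambda>x. f (c *\<^sub>R x + b))"
proof -
  let ?X = "{(\<lambda>x. k * g (c *\<^sub>R x + b)) | k g. smooth g}"
  have d: "((\<lambda>x. k * g (c *\<^sub>R x + b)) has_derivative (\<lambda>h. k * frechet_derivative g (at (c *\<^sub>R x + b)) (c *\<^sub>R h))) (at x)"
    if "smooth g" for k g x
  proof -
    have "(g has_derivative frechet_derivative g (at (c *\<^sub>R x + b))) (at (c *\<^sub>R x + b))"
      using smooth_differentiable[OF that] by (simp add: frechet_derivative_works)
    moreover have "((\<lambda>x. c *\<^sub>R x + b) has_derivative (\<lambda>h. c *\<^sub>R h)) (at x)"
      by (auto intro!: derivative_eq_intros)
    ultimately show ?thesis
      by (intro has_derivative_mult_right) (rule diff_chain_at[unfolded o_def])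
  qed
  have p: "partial i (\<lambda>x. k * g (c *\<^sub>R x + b)) = (\<lambda>x. (k * of_real c) * partial i g (c *\<^sub>R x + b))"
    if "smooth g" for k g i
  proof (rule ext)
    fix x
    have g: "(g has_derivative frechet_derivative g (at (c *\<^sub>R x + b))) (at (c *\<^sub>R x + b))"
      using smooth_differentiable[OF that] by (simp add: frechet_derivative_works)
    interpret bounded_linear "frechet_derivative g (at (c *\<^sub>R x + b))" 
      using g by (rule has_derivative_bounded_linear)
    show "partial i (\<lambda>x. k * g (c *\<^sub>R x + b)) x = (k * of_real c) * partial i g (c *\<^sub>R x + b)"
      by (simp add: has_derivative_imp_partial(2)[OF d[OF that]] 
          has_derivative_imp_partial(2)[OF g] scaleR) (simp add: scaleR_conv_of_real)
  qed
  have "(\<lambda>x. f (c *\<^sub>R x + b)) = (\<lambda>x. 1 * f (c *\<^sub>R x + b))" by simp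
  then have 1: "(\<lambda>x. f (c *\<^sub>R x + b)) \<in> ?X" using assms by blast
  show ?thesis
  proof (rule smooth_coinduct[OF 1])
    fix g x assume "g \<in> ?X" then show "g differentiable at x"
      using differentiableI[OF d] by auto
  next
    fix g i assume "g \<in> ?X"
    then obtain k h where kh: "g = (\<lambda>x. k * h (c *\<^sub>R x + b))" "smooth h" by auto
    show "partial i g \<in> ?X"
      unfolding kh(1) p[OF kh(2)] using smooth_partial[OF kh(2)] by blast
  qed
qed

lemma smooth_character: "smooth (\<lambda>x. exp (\<i> * of_real (x \<bullet> a)))"
proof (rule smooth_coinduct[of _ "range (\<lambda>c x. c * exp (\<i> * of_real (x \<bullet> a)))"])
  have d: "((\<lambda>x. c * exp (\<i> * of_real (x \<bullet> a))) has_derivative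
      (\<lambda>h. c * ((\<i> * of_real (h \<bullet> a)) * exp (\<i> * of_real (x \<bullet> a))))) (at x)" for c x
  proof -
    have "((\<lambda>x. \<i> * complex_of_real (x \<bullet> a)) has_derivative (\<lambda>h. \<i> * complex_of_real (h \<bullet> a))) (at x)"
      by (auto intro!: derivative_eq_intros)
    from diff_chain_at[OF this DERIV_exp[unfolded has_field_derivative_def]]
    have "((\<lambda>x. exp (\<i> * complex_of_real (x \<bullet> a))) has_derivative
        (\<lambda>h. exp (\<i> * complex_of_real (x \<bullet> a)) * (\<i> * complex_of_real (h \<bullet> a)))) (at x)"
      by (simp add: o_def)
    from has_derivative_mult_right[OF this, of c] show ?thesis by (simp add: mult.commute)
  qed
  show "(\<lambda>x. exp (\<i> * of_real (x \<bullet> a))) \<in> range (\<lambda>c x. c * exp (\<i> * of_real (x \<bullet> a)))"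
    by (auto intro!: image_eqI[of _ _ 1])
  fix g assume "g \<in> range (\<lambda>c x. c * exp (\<i> * of_real (x \<bullet> a)))"
  then obtain c where g: "g = (\<lambda>x. c * exp (\<i> * of_real (x \<bullet> a)))" by auto
  show "g differentiable at x" for x unfolding g by (rule differentiableI[OF d])
  show "partial i g \<in> range (\<lambda>c x. c * exp (\<i> * of_real (x \<bullet> a)))" for i
    unfolding g has_derivative_imp_partial(2)[OF d]
    by (rule image_eqI[of _ _ "c * (\<i> * of_real (axis i 1 \<bullet> a))"]) 
      (auto simp: has_derivative_imp_partial(2)[OF d])
qed

text \<open>
  The derivative of \<open>1 / f\<close> is \<open>- f' (1 / f) (1 / f)\<close>, a polynomial in \<open>1 / f\<close> and smooth functions.
\<close>
lemma smooth_inverse: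
  assumes "smooth f" "\<And>x. f x \<noteq> 0" shows "smooth (\<lambda>x. inverse (f x))"
proof -
  let ?h = "\<lambda>x. inverse (f x)"
  let ?B = "insert ?h {f. smooth f}"
  have d: "(?h has_derivative (\<lambda>h. - (inverse (f x) * frechet_derivative f (at x) h * inverse (f x)))) (at x)" for x
    by (rule Deriv.has_derivative_inverse)
      (use smooth_differentiable[OF assms(1)] assms(2) in \<open>simp_all add: frechet_derivative_works\<close>)
  have "partial i f x = frechet_derivative f (at x) (axis i 1)" for i x
    by (rule has_derivative_imp_partial(2)) 
      (use smooth_differentiable[OF assms(1)] in \<open>simp add: frechet_derivative_works\<close>)
  then have p: "partial i ?h = (\<lambda>x. (inverse (f x) * (- partial i f x)) * inverse (f x))" for i
    by (auto simp: has_derivative_imp_partial(2)[OF d])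
  show ?thesis
  proof (rule smooth_generated_algebra[of _ ?B])
    fix g x assume "g \<in> ?B" then show "g differentiable at x"
      using differentiableI[OF d] by (auto intro: smooth_differentiable)
  next
    fix g i assume "g \<in> ?B"
    then consider "g = ?h" | "smooth g" by auto
    then show "partial i g \<in> generated_algebra ?B"
    proof cases
      case 1
      show ?thesis unfolding 1 p
        by (intro generated_algebra.mult generated_algebra.base)
          (auto intro: smooth_uminus smooth_partial assms)
    qed (auto intro: generated_algebra.base smooth_partial)
  qed (auto intro: generated_algebra.base)
qed

text \<open>
  The classical function \<open>exp (- 1 / t)\<close>, extended by 0 to the left; the negative powers of \<open>t\<close>
  make the family closed under differentiation up to linear combinations (\<open>DERIV_flat\<close>).
\<close>
definition flat :: "nat \<Rightarrow> real \<Rightarrow> real" where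
  "flat k t = (if t > 0 then exp (- 1 / t) / t ^ k else 0)"

lemma flat_tendsto_0: "((\<lambda>t. flat k t) \<longlongrightarrow> 0) (at 0)"
proof -
  have "((\<lambda>y::real. y ^ k / exp y) \<longlongrightarrow> 0) at_top" by (rule tendsto_power_div_exp_0)
  then have "((\<lambda>t::real. inverse t ^ k / exp (inverse t)) \<longlongrightarrow> 0) (at_right 0)"
    by (rule filterlim_compose[OF _ filterlim_inverse_at_top_right])
  then have "(flat k \<longlongrightarrow> 0) (at_right 0)"
    by (rule Lim_transform_eventually)
      (auto simp: eventually_at_filter flat_def exp_minus field_simps)
  moreover have "(flat k \<longlongrightarrow> 0) (at_left 0)"
    by (rule Lim_transform_eventually[OF tendsto_const])
      (auto simp: eventually_at_filter flat_def)
  ultimately show ?thesis by (simp add: filterlim_split_at)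
qed

lemma DERIV_flat: "(flat k has_real_derivative (flat (k+2) t - real k * flat (k+1) t)) (at t)"
proof -
  consider "t < 0" | "t = 0" | "t > 0" by linarith
  then show ?thesis
  proof cases
    case 1
    have "((\<lambda>_. 0) has_real_derivative 0) (at t)" by simp
    then have "(flat k has_real_derivative 0) (at t)"
      by (rule has_field_derivative_transform_within[where d="-t"]) (use 1 in \<open>auto simp: flat_def dist_real_def\<close>)
    with 1 show ?thesis by (simp add: flat_def)
  next
    case 2
    have "((\<lambda>h. (flat k (0 + h) - flat k 0) / h) \<longlongrightarrow> 0) (at 0)"
      by (rule Lim_transform_eventually[OF flat_tendsto_0[of "k+1"]])
        (auto simp: eventually_at_filter flat_def)
    then show ?thesis using 2 by (simp add: DERIV_def flat_def)
  next
    case 3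
    have "((\<lambda>t. exp (- 1 / t) / t ^ k) has_real_derivative 
        ((exp (- 1 / t) * (1 / (t*t))) * t ^ k - exp (- 1 / t) * (real k * t ^ (k - 1))) / (t^k * t^k)) (at t)"
      using 3 by (auto intro!: derivative_eq_intros)
    also have "((exp (- 1 / t) * (1 / (t*t))) * t ^ k - exp (- 1 / t) * (real k * t ^ (k - 1))) / (t^k * t^k)
        = flat (k+2) t - real k * flat (k+1) t"
      using 3 by (cases k) (simp_all add: flat_def field_simps)
    finally show ?thesis
      by (rule has_field_derivative_transform_within[where d=t]) (use 3 in \<open>auto simp: flat_def dist_real_def\<close>)
  qed
qed

lemma smooth_flat:
  assumes "smooth (\<lambda>x. complex_of_real (Q x))"
  shows "smooth (\<lambda>x. complex_of_real (flat k (Q x)))"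
proof -
  let ?q = "\<lambda>x. complex_of_real (Q x)"
  let ?F = "\<lambda>k x. complex_of_real (flat k (Q x))"
  let ?B = "range ?F \<union> {f. smooth f}"
  have q: "(?q has_derivative frechet_derivative ?q (at x)) (at x)" for x
    using smooth_differentiable[OF assms] by (simp add: frechet_derivative_works)
  have Q: "(Q has_derivative (\<lambda>h. Re (frechet_derivative ?q (at x) h))) (at x)" for x
    using has_derivative_Re[OF q] by simp
  \<comment> \<open>The chain rule for the real function \<open>flat\<close> requires the derivative of \<open>Q\<close> to be real.\<close>
  have im: "Im (frechet_derivative ?q (at x) h) = 0" for x h
  proof -
    have "((\<lambda>x. Im (?q x)) has_derivative (\<lambda>h. Im (frechet_derivative ?q (at x) h))) (at x)"
      by (rule has_derivative_Im[OF q])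
    then have "((\<lambda>x. 0) has_derivative (\<lambda>h. Im (frechet_derivative ?q (at x) h))) (at x)" by simp
    then have "(\<lambda>h. Im (frechet_derivative ?q (at x) h)) = (\<lambda>h. 0)"
      using has_derivative_const has_derivative_unique by blast
    then show ?thesis by metis
  qed
  have d: "(?F k has_derivative (\<lambda>h. of_real ((flat (k+2) (Q x) - real k * flat (k+1) (Q x))) * frechet_derivative ?q (at x) h)) (at x)" for k x
  proof -
    have "((\<lambda>x. flat k (Q x)) has_derivative (\<lambda>h. (flat (k+2) (Q x) - real k * flat (k+1) (Q x)) * Re (frechet_derivative ?q (at x) h))) (at x)"
      using diff_chain_at[OF Q, of "flat k" "(*) (flat (k+2) (Q x) - real k * flat (k+1) (Q x))" x] DERIV_flat[of k "Q x"]
      by (simp add: o_def has_field_derivative_def)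
    from has_derivative_of_real[OF this, where 'a=complex]
    show ?thesis
      by (rule has_derivative_eq_rhs) (auto simp: complex_eq_iff im)
  qed
  have "partial i ?q x = frechet_derivative ?q (at x) (axis i 1)" for i x
    by (rule has_derivative_imp_partial(2)[OF q])
  then have p: "partial i (?F k) = (\<lambda>x. (?F (k+2) x + of_real (- real k) * ?F (k+1) x) * partial i ?q x)" for i k
    by (auto simp: has_derivative_imp_partial(2)[OF d])
  show ?thesis
  proof (rule smooth_generated_algebra[of _ ?B])
    fix g x assume "g \<in> ?B" then show "g differentiable at x"
      using differentiableI[OF d] by (auto intro: smooth_differentiable)
  next
    fix g i assume "g \<in> ?B"
    then consider k where "g = ?F k" | "smooth g" by auto
    then show "partial i g \<in> generated_algebra ?B"
    proof cases
      case 1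
      show ?thesis unfolding 1 p
        by (intro generated_algebra.mult generated_algebra.add generated_algebra.base)
          (auto intro: smooth_partial smooth_const assms)
    qed (auto intro: generated_algebra.base smooth_partial)
  qed (auto intro: generated_algebra.base)
qed

lemma smooth_norm_diff_sq: "smooth (\<lambda>x. complex_of_real ((norm (x - c))\<^sup>2))"
proof -
  have *: "(\<lambda>x. complex_of_real ((norm (x - c))\<^sup>2)) =
      (\<lambda>x. \<Sum>i\<in>UNIV. (complex_of_real (x $ i) - of_real (c $ i)) * (complex_of_real (x $ i) - of_real (c $ i)))"
    by (rule ext) (simp add: norm_vec_def L2_set_def sum_nonneg power2_eq_square)
  show ?thesis unfolding * by (intro smooth_sum smooth_mult smooth_diff smooth_coord smooth_const)
qed

text \<open>
  The bump is \<open>f1 / (f1 + f2)\<close>, where \<open>f1\<close> is positive exactly inside the larger sphere and \<open>f2\<close>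
  exactly outside the smaller one.  As \<open>a < b\<close>, the denominator has no zero.
\<close>
lemma smooth_bump_exists:
  fixes c :: "real ^ 'n::finite"
  assumes "0 \<le> a" "a < b"
  obtains \<beta> :: "real ^ 'n \<Rightarrow> real" where "smooth (\<lambda>x. complex_of_real (\<beta> x))"
    "\<And>x. norm (x - c) \<le> a \<Longrightarrow> \<beta> x = 1" "\<And>x. b \<le> norm (x - c) \<Longrightarrow> \<beta> x = 0"
    "\<And>x. 0 \<le> \<beta> x"
proof
  define f1 where "f1 x = flat 0 (b\<^sup>2 - (norm (x - c))\<^sup>2)" for x
  define f2 where "f2 x = flat 0 ((norm (x - c))\<^sup>2 - a\<^sup>2)" for x
  define \<beta> where "\<beta> x = f1 x * inverse (f1 x + f2 x)" for x
  have nn: "f1 x \<ge> 0" "f2 x \<ge> 0" for x by (auto simp: f1_def f2_def flat_def)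
  have pos: "f1 x + f2 x > 0" for x
  proof (cases "norm (x - c) < b")
    case True
    then have "f1 x > 0" by (auto simp: f1_def flat_def intro: power_strict_mono)
    with nn show ?thesis by (simp add: add_pos_nonneg)
  next
    case False
    then have "a\<^sup>2 < (norm (x - c))\<^sup>2" using assms by (intro power_strict_mono) auto
    then have "f2 x > 0" by (auto simp: f2_def flat_def)
    with nn show ?thesis by (simp add: add_nonneg_pos)
  qed
  have 1: "smooth (\<lambda>x. complex_of_real (f1 x))" "smooth (\<lambda>x. complex_of_real (f2 x))"
    unfolding f1_def f2_def by (auto intro!: smooth_flat smooth_diff smooth_const smooth_norm_diff_sq simp flip: of_real_power
      simp: of_real_diff)
  have "smooth (\<lambda>x. complex_of_real (f1 x) * inverse (complex_of_real (f1 x) + complex_of_real (f2 x)))"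
    
  proof (intro smooth_mult smooth_inverse smooth_add 1)
    show "complex_of_real (f1 x) + complex_of_real (f2 x) \<noteq> 0" for x
      using pos[of x] by (metis of_real_add of_real_eq_0_iff less_irrefl)
  qed
  then show "smooth (\<lambda>x. complex_of_real (\<beta> x))" by (simp add: \<beta>_def)
  show "\<beta> x = 1" if "norm (x - c) \<le> a" for x
  proof -
    have "(norm (x - c))\<^sup>2 \<le> a\<^sup>2" using that by (intro power_mono) auto
    then have "f2 x = 0" by (auto simp: f2_def flat_def)
    then show ?thesis using pos[of x] by (simp add: \<beta>_def)
  qed
  show "\<beta> x = 0" if "b \<le> norm (x - c)" for x
  proof -
    have "b\<^sup>2 \<le> (norm (x - c))\<^sup>2" using that assms by (intro power_mono) auto
    then have "f1 x = 0" by (auto simp: f1_def flat_def)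
    then show ?thesis by (simp add: \<beta>_def)
  qed
  show "0 \<le> \<beta> x" for x using nn[of x] by (simp add: \<beta>_def)
qed

lemma vector_derivative_bound:
  fixes g :: "real \<Rightarrow> 'a::real_normed_vector"
  assumes g: "\<And>s. (g has_vector_derivative g' s) (at s)"
    and b: "\<And>s. s \<in> {a..b} \<Longrightarrow> norm (g' s) \<le> B" and "x \<in> {a..b}" "y \<in> {a..b}"
  shows "norm (g x - g y) \<le> B * norm (x - y)"
proof (rule differentiable_bound[where S="{a..b}" and f'="\<lambda>s h. h *\<^sub>R g' s"])
  show "(g has_derivative (\<lambda>h. h *\<^sub>R g' s)) (at s within {a..b})" for s
    using g[of s] by (auto simp: has_vector_derivative_def intro: has_derivative_at_withinI)
  show "onorm (\<lambda>h. h *\<^sub>R g' s) \<le> B" if "s \<in> {a..b}" for s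
    using b[OF that] by (intro onorm_le) (metis mult.commute norm_ge_zero mult_left_mono norm_scaleR real_norm_def)
qed (use assms in auto)

text \<open>
  The second difference of \<open>f\<close> over a small square with sides along the axes \<open>i\<close> and \<open>j\<close> is symmetric
  in \<open>i\<close> and \<open>j\<close>.  The mean value inequality in direction \<open>i\<close> and total differentiability of
  \<open>partial i f\<close> identify its leading term, and symmetry then yields \<open>partial_commute\<close>.
\<close>
lemma second_difference_estimate:
  fixes f :: "real ^ 'n::finite \<Rightarrow> complex"
  assumes f: "\<And>x. f differentiable (at x)" and p: "partial i f differentiable (at x)" and "e > 0"
  shows "\<exists>d>0. \<forall>h. 0 < h \<and> h < d \<longrightarrow>
    norm (f (x + h *\<^sub>R axis i 1 + h *\<^sub>R axis j 1) - f (x + h *\<^sub>R axis i 1) - f (x + h *\<^sub>R axis j 1) + f x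
      - h\<^sup>2 *\<^sub>R partial j (partial i f) x) \<le> e * h\<^sup>2"
proof -
  let ?a = "axis i (1::real) :: real ^ 'n" and ?b = "axis j (1::real) :: real ^ 'n"
  obtain L where L: "(partial i f has_derivative L) (at x)" using p by (auto simp: differentiable_def)
  interpret bounded_linear L using L by (rule has_derivative_bounded_linear)
  have Lb: "partial j (partial i f) x = L ?b" by (rule has_derivative_imp_partial(2)[OF L])
  obtain d where d: "d > 0" "\<And>y. norm (y - x) < d \<Longrightarrow>
      norm (partial i f y - partial i f x - L (y - x)) \<le> (e / 4) * norm (y - x)"
    using L[unfolded has_derivative_at_alt] \<open>e > 0\<close> by (metis divide_pos_pos zero_less_numeral)
  show ?thesis
  proof (intro exI[of _ "d/2"] conjI allI impI)
    fix h assume h: "0 < h \<and> h < d/2"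
    define g where "g s = f ((x + h *\<^sub>R ?b) + s *\<^sub>R ?a) - f (x + s *\<^sub>R ?a) - s *\<^sub>R (h *\<^sub>R L ?b)" for s :: real
    define g' where "g' s = partial i f ((x + h *\<^sub>R ?b) + s *\<^sub>R ?a) - partial i f (x + s *\<^sub>R ?a) - h *\<^sub>R L ?b" for s :: real
    have g: "(g has_vector_derivative g' s) (at s)" for s
      unfolding g_def g'_def
      by (intro derivative_intros has_vector_derivative_partial f)
        (auto intro!: derivative_eq_intros)
    have b: "norm (g' s) \<le> e * h" if "s \<in> {0..h}" for s
    proof -
      have n1: "norm (h *\<^sub>R ?b + s *\<^sub>R ?a) \<le> 2 * h"
        using norm_triangle_ineq[of "h *\<^sub>R ?b" "s *\<^sub>R ?a"] that by (auto simp: norm_axis_1)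
      have n2: "norm (s *\<^sub>R ?a) \<le> h" using that by (auto simp: norm_axis_1)
      have 1: "norm (partial i f (x + h *\<^sub>R ?b + s *\<^sub>R ?a) - partial i f x - L (h *\<^sub>R ?b + s *\<^sub>R ?a)) \<le> (e/4) * (2*h)"
      proof -
        have "norm (partial i f (x + h *\<^sub>R ?b + s *\<^sub>R ?a) - partial i f x - L (h *\<^sub>R ?b + s *\<^sub>R ?a))
            \<le> (e/4) * norm (h *\<^sub>R ?b + s *\<^sub>R ?a)"
          using d(2)[of "x + (h *\<^sub>R ?b + s *\<^sub>R ?a)"] n1 h by (simp add: add.assoc)
        also have "\<dots> \<le> (e/4) * (2*h)" using n1 \<open>e > 0\<close> by (intro mult_left_mono) auto
        finally show ?thesis .
      qed
      have 2: "norm (partial i f (x + s *\<^sub>R ?a) - partial i f x - L (s *\<^sub>R ?a)) \<le> (e/4) * h"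
      proof -
        have "norm (partial i f (x + s *\<^sub>R ?a) - partial i f x - L (s *\<^sub>R ?a)) \<le> (e/4) * norm (s *\<^sub>R ?a)"
          using d(2)[of "x + s *\<^sub>R ?a"] n2 h by simp
        also have "\<dots> \<le> (e/4) * h" using n2 \<open>e > 0\<close> by (intro mult_left_mono) auto
        finally show ?thesis .
      qed
      have "g' s = (partial i f (x + h *\<^sub>R ?b + s *\<^sub>R ?a) - partial i f x - L (h *\<^sub>R ?b + s *\<^sub>R ?a))
         - (partial i f (x + s *\<^sub>R ?a) - partial i f x - L (s *\<^sub>R ?a))"
        by (simp add: g'_def add scaleR)
      then have "norm (g' s) \<le> (e/4) * (2*h) + (e/4) * h"
        using norm_triangle_ineq4 1 2 by (smt (verit, best))
      also have "\<dots> \<le> e * h" using h \<open>e > 0\<close> by (simp add: field_simps)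
      finally show ?thesis .
    qed
    have "norm (g h - g 0) \<le> e * h * norm (h - 0)"
      by (rule vector_derivative_bound[OF g b]) (use h in auto)
    then show "norm (f (x + h *\<^sub>R ?a + h *\<^sub>R ?b) - f (x + h *\<^sub>R ?a) - f (x + h *\<^sub>R ?b) + f x
      - h\<^sup>2 *\<^sub>R partial j (partial i f) x) \<le> e * h\<^sup>2"
      using h by (simp add: g_def Lb power2_eq_square algebra_simps)
  qed (use d in auto)
qed

lemma partial_commute:
  fixes f :: "real ^ 'n::finite \<Rightarrow> complex"
  assumes "smooth f" shows "partial i (partial j f) = partial j (partial i f)"
proof (rule ext, rule ccontr)
  fix x assume ne: "partial i (partial j f) x \<noteq> partial j (partial i f) x"
  define e where "e = norm (partial i (partial j f) x - partial j (partial i f) x) / 4"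
  have e: "e > 0" using ne by (simp add: e_def)
  obtain d1 where d1: "d1 > 0" "\<And>h. 0 < h \<and> h < d1 \<Longrightarrow> norm (f (x + h *\<^sub>R axis i 1 + h *\<^sub>R axis j 1) - f (x + h *\<^sub>R axis i 1) - f (x + h *\<^sub>R axis j 1) + f x
      - h\<^sup>2 *\<^sub>R partial j (partial i f) x) \<le> e * h\<^sup>2"
    using second_difference_estimate[OF _ _ e] smooth_differentiable[OF assms] smooth_differentiable[OF smooth_partial[OF assms]]
    by (metis (no_types, lifting))
  obtain d2 where d2: "d2 > 0" "\<And>h. 0 < h \<and> h < d2 \<Longrightarrow> norm (f (x + h *\<^sub>R axis j 1 + h *\<^sub>R axis i 1) - f (x + h *\<^sub>R axis j 1) - f (x + h *\<^sub>R axis i 1) + f x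
      - h\<^sup>2 *\<^sub>R partial i (partial j f) x) \<le> e * h\<^sup>2"
    using second_difference_estimate[OF _ _ e] smooth_differentiable[OF assms] smooth_differentiable[OF smooth_partial[OF assms]]
    by (metis (no_types, lifting))
  define h where "h = min d1 d2 / 2"
  have h: "0 < h" "h < d1" "h < d2" using d1(1) d2(1) by (auto simp: h_def)
  let ?D = "f (x + h *\<^sub>R axis i 1 + h *\<^sub>R axis j 1) - f (x + h *\<^sub>R axis i 1) - f (x + h *\<^sub>R axis j 1) + f x"
  have 1: "norm (?D - h\<^sup>2 *\<^sub>R partial j (partial i f) x) \<le> e * h\<^sup>2" using d1(2) h by auto
  have "norm (?D - h\<^sup>2 *\<^sub>R partial i (partial j f) x) \<le> e * h\<^sup>2" using d2(2)[of h] h by (auto simp: algebra_simps)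
  with 1 have "norm ((?D - h\<^sup>2 *\<^sub>R partial j (partial i f) x) - (?D - h\<^sup>2 *\<^sub>R partial i (partial j f) x)) \<le> 2 * (e * h\<^sup>2)"
    using norm_triangle_ineq4 by (smt (verit, best))
  also have "(?D - h\<^sup>2 *\<^sub>R partial j (partial i f) x) - (?D - h\<^sup>2 *\<^sub>R partial i (partial j f) x)
      = h\<^sup>2 *\<^sub>R (partial i (partial j f) x - partial j (partial i f) x)" by (simp add: algebra_simps)
  finally have "h\<^sup>2 * (4 * e) \<le> h\<^sup>2 * (2 * e)" by (simp add: e_def)
  with h e show False by auto
qed

section \<open>Lebesgue measure in coordinates\<close>

lemma prod_Basis_vec: "(\<Prod>b\<in>(Basis :: (real^'n::finite) set). f b) = (\<Prod>i\<in>UNIV. f (axis i 1))"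
proof -
  have B: "(Basis :: (real^'n) set) = (\<lambda>i. axis i 1) ` UNIV" by (auto simp: Basis_vec_def)
  have inj: "inj (\<lambda>i::'n. axis i (1::real))" by (auto simp: inj_on_def axis_eq_axis)
  show ?thesis unfolding B by (subst prod.reindex[OF inj]) simp
qed

lemma measurable_vec_lambda [measurable]:
  "(\<lambda>f. \<chi> i. f i) \<in> (\<Pi>\<^sub>M i\<in>(UNIV::'n::finite set). (lborel::real measure)) \<rightarrow>\<^sub>M (borel :: (real^'n) measure)"
proof (subst borel_measurable_euclidean_space, rule ballI)
  fix b :: "real^'n" assume "b \<in> Basis"
  then obtain i where b: "b = axis i 1" by (auto simp: Basis_vec_def)
  show "(\<lambda>x. (\<chi> i. x i) \<bullet> b) \<in> borel_measurable (\<Pi>\<^sub>M i\<in>(UNIV::'n set). (lborel::real measure))"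
    unfolding b by (simp add: inner_axis)
qed

lemma lborel_vec:
  "(lborel :: (real^'n::finite) measure) = distr (\<Pi>\<^sub>M i\<in>UNIV. lborel) borel (\<lambda>f. \<chi> i. f i)"
proof (rule lborel_eqI)
  interpret product_sigma_finite "\<lambda>i::'n. lborel :: real measure" by standard
  interpret finite_product_sigma_finite "\<lambda>i::'n. lborel :: real measure" UNIV by standard auto
  fix l u :: "real^'n" assume *: "\<And>b. b \<in> Basis \<Longrightarrow> l \<bullet> b \<le> u \<bullet> b"
  have le: "l $ i \<le> u $ i" for i
  proof -
    have "axis i 1 \<in> (Basis :: (real^'n) set)" by (auto simp: Basis_vec_def)
    from *[OF this] show ?thesis by (simp add: inner_axis)
  qed
  have "(\<lambda>f. \<chi> i. f i) -` box l u \<inter> space (\<Pi>\<^sub>M i\<in>(UNIV::'n set). (lborel::real measure)) = (\<Pi>\<^sub>E i\<in>UNIV. {l $ i<..<u $ i})"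
    by (auto simp: mem_box_cart space_PiM PiE_def Pi_iff)
  then show "emeasure (distr (\<Pi>\<^sub>M i\<in>UNIV. lborel) borel (\<lambda>f. \<chi> i. f i)) (box l u) = (\<Prod>b\<in>Basis. (u - l) \<bullet> b)"
    using le by (simp add: emeasure_distr measure_times prod_Basis_vec inner_axis prod_ennreal)
qed simp

lemma nn_integral_vec:
  fixes F :: "real^'n::finite \<Rightarrow> ennreal"
  assumes [measurable]: "F \<in> borel_measurable borel"
  shows "(\<integral>\<^sup>+x. F x \<partial>lborel) = (\<integral>\<^sup>+f. F (\<chi> i. f i) \<partial>(\<Pi>\<^sub>M i\<in>UNIV. lborel))"
  by (subst lborel_vec, subst nn_integral_distr) auto

lemma
  fixes g :: "'n::finite \<Rightarrow> real \<Rightarrow> 'a::{real_normed_field,banach,second_countable_topology}"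
  assumes g: "\<And>i. integrable lborel (g i)"
  shows integrable_prod_vec: "integrable lborel (\<lambda>x::real^'n. \<Prod>i\<in>UNIV. g i (x $ i))"
    and integral_prod_vec: "(\<integral>x. (\<Prod>i\<in>UNIV. g i (x $ i)) \<partial>(lborel :: (real^'n) measure)) = (\<Prod>i\<in>UNIV. \<integral>t. g i t \<partial>lborel)"
proof -
  interpret product_sigma_finite "\<lambda>i::'n. lborel :: real measure" by standard
  have [measurable]: "g i \<in> borel_measurable borel" for i using g[of i] by auto
  have m: "(\<lambda>x::real^'n. \<Prod>i\<in>UNIV. g i (x $ i)) \<in> borel_measurable borel"
    by (intro borel_measurable_prod measurable_compose[OF _ \<open>\<And>i. g i \<in> borel_measurable borel\<close>]) measurable
  show "integrable lborel (\<lambda>x::real^'n. \<Prod>i\<in>UNIV. g i (x $ i))"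
    by (subst lborel_vec, subst integrable_distr_eq[OF measurable_vec_lambda m])
      (use product_integrable_prod[of UNIV g] g in simp)
  show "(\<integral>x. (\<Prod>i\<in>UNIV. g i (x $ i)) \<partial>(lborel :: (real^'n) measure)) = (\<Prod>i\<in>UNIV. \<integral>t. g i t \<partial>lborel)"
    by (subst lborel_vec, subst integral_distr[OF measurable_vec_lambda m])
      (use product_integral_prod[of UNIV g] g in simp)
qed

lemma integrable_cauchy_density: "integrable lborel (\<lambda>t::real. 1 / (1 + t\<^sup>2))"
  using integrable_inverse_1_plus_square by (simp add: set_integrable_def einterval_iff indicator_def inverse_eq_divide einterval_eq_UNIV)

text \<open>
  The comparison of a radial weight with a product of functions of one variable is used twice: it makes
  the radial weight integrable, and it bounds the convolution kernels by product kernels.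
\<close>
lemma prod_le_weight:
  fixes x :: "real^'n::finite"
  shows "1 / (1 + norm x) ^ (2 * CARD('n)) \<le> (\<Prod>i\<in>UNIV. 1 / (1 + (x $ i)\<^sup>2))"
proof -
  have "(\<Prod>i\<in>(UNIV::'n set). 1 + (x $ i)\<^sup>2) \<le> (\<Prod>i\<in>(UNIV::'n set). (1 + norm x)\<^sup>2)"
  proof (rule prod_mono, safe)
    fix i
    have "(x $ i)\<^sup>2 \<le> (norm x)\<^sup>2" 
      using component_le_norm_cart[of x i] by (metis abs_ge_zero norm_ge_zero power2_abs power_mono)
    then show "1 + (x $ i)\<^sup>2 \<le> (1 + norm x)\<^sup>2" 
    proof -
      assume *: "(x $ i)\<^sup>2 \<le> (norm x)\<^sup>2"
      have "0 \<le> norm x" by simp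
      with * have "1 + (x $ i)\<^sup>2 \<le> 1 + (norm x)\<^sup>2 + 2 * norm x" by linarith
      then show ?thesis by (simp add: power2_sum)
    qed
  qed simp
  also have "\<dots> = (1 + norm x) ^ (2 * CARD('n))" by (simp add: power_mult)
  finally have le: "(\<Prod>i\<in>(UNIV::'n set). 1 + (x $ i)\<^sup>2) \<le> (1 + norm x) ^ (2 * CARD('n))" .
  have "0 < (\<Prod>i\<in>(UNIV::'n set). 1 + (x $ i)\<^sup>2)" by (intro prod_pos) (simp add: add_pos_nonneg)
  then have "1 / (1 + norm x) ^ (2 * CARD('n)) \<le> 1 / (\<Prod>i\<in>(UNIV::'n set). 1 + (x $ i)\<^sup>2)"
    using le by (intro divide_left_mono mult_pos_pos) auto
  then show ?thesis by (simp add: prod_dividef)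
qed

lemma integrable_weight:
  "integrable lborel (\<lambda>x::real^'n::finite. 1 / (1 + norm x) ^ (2 * CARD('n)))"
proof (rule Bochner_Integration.integrable_bound)
  show "integrable lborel (\<lambda>x::real^'n. \<Prod>i\<in>UNIV. 1 / (1 + (x $ i)\<^sup>2))"
    by (rule integrable_prod_vec[OF integrable_cauchy_density])
  show "AE x::real^'n in lborel. norm (1 / (1 + norm x) ^ (2 * CARD('n))) \<le> norm (\<Prod>i\<in>UNIV. 1 / (1 + (x $ i)\<^sup>2))"
  proof (rule AE_I2)
    fix x :: "real^'n"
    have "norm (1 / (1 + norm x) ^ (2 * CARD('n))) = 1 / (1 + norm x) ^ (2 * CARD('n))" by simp
    also have "\<dots> \<le> (\<Prod>i\<in>UNIV. 1 / (1 + (x $ i)\<^sup>2))" by (rule prod_le_weight)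
    also have "\<dots> \<le> norm \<dots>" unfolding real_norm_def by (rule abs_ge_self)
    finally show "norm (1 / (1 + norm x) ^ (2 * CARD('n))) \<le> norm (\<Prod>i\<in>UNIV. 1 / (1 + (x $ i)\<^sup>2))" .
  qed
qed measurable

section \<open>Decay\<close>

definition decays :: "nat \<Rightarrow> (real^'n::finite \<Rightarrow> complex) \<Rightarrow> bool" where
  "decays M f \<longleftrightarrow> (\<exists>C. \<forall>x. norm (f x) * (1 + norm x) ^ M \<le> C)"

lemma decaysE:
  assumes "decays M f"
  obtains C where "C > 0" "\<And>x. norm (f x) * (1 + norm x) ^ M \<le> C" "\<And>x. norm (f x) \<le> C / (1 + norm x) ^ M"
proof -
  obtain C where C: "\<And>x. norm (f x) * (1 + norm x) ^ M \<le> C" using assms by (auto simp: decays_def)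
  have 1: "norm (f x) * (1 + norm x) ^ M \<le> max C 1" for x using C[of x] by simp
  have p: "(0::real) < (1 + norm x) ^ M" for x :: "real^'a" by (simp add: add_pos_nonneg)
  show ?thesis by (rule that[of "max C 1"]) (use 1 p in \<open>auto simp: pos_le_divide_eq\<close>)
qed

lemma decaysI: "(\<And>x. norm (f x) * (1 + norm x) ^ M \<le> C) \<Longrightarrow> decays M f"
  by (auto simp: decays_def)

lemma decays_mono: "decays M f \<Longrightarrow> N \<le> M \<Longrightarrow> decays N f"
  unfolding decays_def
proof (elim exE, intro exI allI)
  fix C and x :: "real^'a" assume N: "N \<le> M" and C: "\<forall>x. norm (f x) * (1 + norm x) ^ M \<le> C"
  have "(1 + norm x) ^ N \<le> (1 + norm x) ^ M" using N by (intro power_increasing) auto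
  then show "norm (f x) * (1 + norm x) ^ N \<le> C"
    using C by (meson mult_left_mono norm_ge_zero order_trans)
qed

lemma decays_mult:
  assumes "decays M f" "decays N g" shows "decays (M + N) (\<lambda>x. f x * g x)"
proof -
  obtain C D where C: "C > 0" "\<And>x. norm (f x) * (1 + norm x) ^ M \<le> C"
    and D: "D > 0" "\<And>x. norm (g x) * (1 + norm x) ^ N \<le> D" using assms by (metis decaysE)
  show ?thesis
  proof (rule decaysI)
    fix x
    have "norm (f x * g x) * (1 + norm x) ^ (M + N) = (norm (f x) * (1 + norm x) ^ M) * (norm (g x) * (1 + norm x) ^ N)"
      by (simp add: norm_mult power_add)
    also have "\<dots> \<le> C * D" by (intro mult_mono C D) (use C in auto)
    finally show "norm (f x * g x) * (1 + norm x) ^ (M + N) \<le> C * D" .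
  qed
qed

lemma decays_add:
  assumes "decays M f" "decays M g" shows "decays M (\<lambda>x. f x + g x)"
proof -
  obtain C D where C: "\<And>x. norm (f x) * (1 + norm x) ^ M \<le> C"
    and D: "\<And>x. norm (g x) * (1 + norm x) ^ M \<le> D" using assms by (metis decaysE)
  show ?thesis
  proof (rule decaysI)
    fix x
    have "norm (f x + g x) * (1 + norm x) ^ M \<le> (norm (f x) + norm (g x)) * (1 + norm x) ^ M"
      by (intro mult_right_mono norm_triangle_ineq) auto
    also have "\<dots> \<le> C + D" using C D by (simp add: ring_distribs add_mono)
    finally show "norm (f x + g x) * (1 + norm x) ^ M \<le> C + D" .
  qed
qed

lemma smooth_continuous: "smooth f \<Longrightarrow> continuous_on UNIV f"
  by (intro differentiable_imp_continuous_on) (auto simp: differentiable_on_def intro!: differentiable_at_withinI smooth_differentiable)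

lemma smooth_measurable: "smooth f \<Longrightarrow> f \<in> borel_measurable borel"
  by (intro borel_measurable_continuous_onI smooth_continuous)

lemma decays_integrable:
  fixes f :: "real^'n::finite \<Rightarrow> complex"
  assumes "decays (2 * CARD('n)) f" and m: "f \<in> borel_measurable borel"
  shows "integrable lborel f"
proof -
  obtain C where C: "C > 0" "\<And>x. norm (f x) \<le> C / (1 + norm x) ^ (2 * CARD('n))"
    using assms by (metis decaysE)
  show ?thesis
  proof (rule Bochner_Integration.integrable_bound)
    show "integrable lborel (\<lambda>x::real^'n. C * (1 / (1 + norm x) ^ (2 * CARD('n))))"
      by (intro integrable_mult_right integrable_weight)
    show "AE x in lborel. norm (f x) \<le> norm (C * (1 / (1 + norm x) ^ (2 * CARD('n))))"
    proof (rule AE_I2)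
      fix x :: "real^'n"
      have "norm (f x) \<le> C * (1 / (1 + norm x) ^ (2 * CARD('n)))" using C(2)[of x] by simp
      also have "\<dots> \<le> norm \<dots>" unfolding real_norm_def by (rule abs_ge_self)
      finally show "norm (f x) \<le> norm (C * (1 / (1 + norm x) ^ (2 * CARD('n))))" .
    qed
  qed (use m in simp)
qed

lemma integral_lborel_shift:
  fixes f :: "'a::euclidean_space \<Rightarrow> complex"
  assumes [measurable]: "f \<in> borel_measurable borel"
  shows "(\<integral>x. f (x + a) \<partial>lborel) = (\<integral>x. f x \<partial>lborel)"
    "integrable lborel (\<lambda>x. f (x + a)) \<longleftrightarrow> integrable lborel f"
proof -
  have "(\<integral>x. f x \<partial>lborel) = (\<integral>x. f x \<partial>(distr lborel borel ((+) a)))" by (simp add: lborel_distr_plus)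
  also have "\<dots> = (\<integral>x. f (a + x) \<partial>lborel)" by (subst integral_distr) auto
  finally show "(\<integral>x. f (x + a) \<partial>lborel) = (\<integral>x. f x \<partial>lborel)" by (simp add: add.commute)
  have "integrable lborel f \<longleftrightarrow> integrable (distr lborel borel ((+) a)) f" by (simp add: lborel_distr_plus)
  also have "\<dots> \<longleftrightarrow> integrable lborel (\<lambda>x. f (a + x))" by (subst integrable_distr_eq) auto
  finally show "integrable lborel (\<lambda>x. f (x + a)) \<longleftrightarrow> integrable lborel f" by (simp add: add.commute)
qed

text \<open>
  Difference quotients have integral 0 by translation invariance.  The mean value inequality and the
  decay of the derivative dominate them uniformly for step sizes at most 1.
\<close>
lemma integral_partial_eq_0:
  fixes F :: "real^'n::finite \<Rightarrow> complex"
  assumes F: "smooth F" "decays (2 * CARD('n)) F" "decays (2 * CARD('n)) (partial i F)"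
  shows "(\<integral>x. partial i F x \<partial>lborel) = 0"
proof -
  let ?M = "2 * CARD('n)" and ?e = "axis i (1::real) :: real^'n"
  define t where "t k = inverse (real (Suc k))" for k
  define G where "G k x = (F (x + t k *\<^sub>R ?e) - F x) /\<^sub>R t k" for k x
  have t: "0 < t k" "t k \<le> 1" for k by (auto simp: t_def field_simps)
  have t0: "t \<longlonglongrightarrow> 0" unfolding t_def by (rule LIMSEQ_inverse_real_of_nat)
  have F_int: "integrable lborel F" by (intro decays_integrable F smooth_measurable)
  have [measurable]: "F \<in> borel_measurable borel" "partial i F \<in> borel_measurable borel"
    by (auto intro: smooth_measurable smooth_partial F)
  obtain C where C: "C > 0" "\<And>x. norm (partial i F x) \<le> C / (1 + norm x) ^ ?M"
    using F(3) by (metis decaysE)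
  have "(\<integral>x. G k x \<partial>lborel) = 0" for k
    using F_int integral_lborel_shift[of F "t k *\<^sub>R ?e"] by (simp add: G_def)
  moreover have "(\<lambda>k. \<integral>x. G k x \<partial>lborel) \<longlonglongrightarrow> (\<integral>x. partial i F x \<partial>lborel)"
  proof (rule integral_dominated_convergence[where w="\<lambda>x. C * 2 ^ ?M * (1 / (1 + norm x) ^ ?M)"])
    show "integrable lborel (\<lambda>x::real^'n. C * 2 ^ ?M * (1 / (1 + norm x) ^ ?M))"
      by (intro integrable_mult_right integrable_weight)
    show "AE x in lborel. (\<lambda>k. G k x) \<longlonglongrightarrow> partial i F x"
    proof (rule AE_I2)
      fix x
      have "((\<lambda>t. F (x + t *\<^sub>R ?e)) has_vector_derivative partial i F (x + 0 *\<^sub>R ?e)) (at 0)"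
        by (rule has_vector_derivative_partial) (rule smooth_differentiable[OF F(1)])
      then have "((\<lambda>h. (F (x + h *\<^sub>R ?e) - F x) /\<^sub>R h) \<longlongrightarrow> partial i F x) (at 0)"
      proof -
        assume "((\<lambda>t. F (x + t *\<^sub>R ?e)) has_vector_derivative partial i F (x + 0 *\<^sub>R ?e)) (at 0)"
        then have *: "((\<lambda>y. norm (F (x + y *\<^sub>R ?e) - F x - y *\<^sub>R partial i F x) / \<bar>y\<bar>) \<longlongrightarrow> 0) (at 0)"
          by (simp add: has_vector_derivative_def has_derivative_iff_norm)
        have "norm (F (x + y *\<^sub>R ?e) - F x - y *\<^sub>R partial i F x) / \<bar>y\<bar>
            = norm ((F (x + y *\<^sub>R ?e) - F x) /\<^sub>R y - partial i F x)" if "y \<noteq> 0" for y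
        proof -
          have "(F (x + y *\<^sub>R ?e) - F x) /\<^sub>R y - partial i F x
              = (F (x + y *\<^sub>R ?e) - F x - y *\<^sub>R partial i F x) /\<^sub>R y"
            using that by (simp add: scaleR_diff_right)
          then show ?thesis by (simp add: divide_inverse mult.commute)
        qed
        then have "((\<lambda>y. norm ((F (x + y *\<^sub>R ?e) - F x) /\<^sub>R y - partial i F x)) \<longlongrightarrow> 0) (at 0)"
          by (intro Lim_transform_eventually[OF *]) (auto simp: eventually_at_filter)
        then show ?thesis by (rule LIM_zero_cancel[OF tendsto_norm_zero_cancel])
      qed
      then show "(\<lambda>k. G k x) \<longlonglongrightarrow> partial i F x"
        unfolding G_def
      proof (rule filterlim_compose)
        have "t k \<noteq> 0" for k using t(1)[of k] by simp
        then show "filterlim t (at 0) sequentially" using t0 by (simp add: filterlim_at)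
      qed
    qed
    show "AE x in lborel. norm (G k x) \<le> C * 2 ^ ?M * (1 / (1 + norm x) ^ ?M)" for k
    proof (rule AE_I2)
      fix x :: "real^'n"
      have "norm (F (x + t k *\<^sub>R ?e) - F (x + 0 *\<^sub>R ?e)) \<le> (C * 2 ^ ?M * (1 / (1 + norm x) ^ ?M)) * norm (t k - 0)"
      proof (rule vector_derivative_bound[where a=0 and b=1])
        show "((\<lambda>s. F (x + s *\<^sub>R ?e)) has_vector_derivative partial i F (x + s *\<^sub>R ?e)) (at s)" for s
          by (rule has_vector_derivative_partial) (rule smooth_differentiable[OF F(1)])
        fix s :: real assume s: "s \<in> {0..1}"
        have "norm x \<le> norm (x + s *\<^sub>R ?e) + norm (s *\<^sub>R ?e)" by (metis add_diff_cancel_right' norm_triangle_ineq4)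
        moreover have "norm (s *\<^sub>R ?e) \<le> 1" using s by (simp add: norm_axis_1)
        moreover have "1 + c \<le> 2 * (1 + a)" if "c \<le> a + b" "b \<le> 1" "0 \<le> a" for a b c :: real
          using that by simp
        ultimately have "1 + norm x \<le> 2 * (1 + norm (x + s *\<^sub>R ?e))" using norm_ge_zero by blast
        then have "(1 + norm x) ^ ?M \<le> (2 * (1 + norm (x + s *\<^sub>R ?e))) ^ ?M" by (intro power_mono) auto
        then have *: "(1 + norm x) ^ ?M \<le> 2 ^ ?M * (1 + norm (x + s *\<^sub>R ?e)) ^ ?M" by (simp only: power_mult_distrib)
        have p: "(0::real) < (1 + norm y) ^ ?M" for y :: "real^'n" by (simp add: add_pos_nonneg)
        have "norm (partial i F (x + s *\<^sub>R ?e)) \<le> C / (1 + norm (x + s *\<^sub>R ?e)) ^ ?M" by (rule C)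
        also have "\<dots> \<le> C * 2 ^ ?M * (1 / (1 + norm x) ^ ?M)"
          using mult_left_mono[OF *, of C] p[of x] p[of "x + s *\<^sub>R ?e"] C(1)
          by (simp add: divide_le_eq le_divide_eq mult.assoc mult.commute mult.left_commute)
        finally show "norm (partial i F (x + s *\<^sub>R ?e)) \<le> C * 2 ^ ?M * (1 / (1 + norm x) ^ ?M)" .
      qed (use t[of k] in auto)
      then have *: "norm (F (x + t k *\<^sub>R ?e) - F x) \<le> (C * 2 ^ ?M * (1 / (1 + norm x) ^ ?M)) * t k"
        (is "?N \<le> ?A * _") using t[of k] by simp
      show "norm (G k x) \<le> C * 2 ^ ?M * (1 / (1 + norm x) ^ ?M)"
      proof -
        have "norm (G k x) = ?N / t k" using t[of k] by (simp add: G_def divide_inverse mult.commute)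
        with * t[of k] show ?thesis by (simp add: pos_divide_le_eq)
      qed
    qed
  qed (auto simp: G_def)
  ultimately show ?thesis by (simp add: LIMSEQ_const_iff)
qed

section \<open>Test functions\<close>

lemma test_functions_smooth: "\<phi> \<in> test_functions U \<Longrightarrow> smooth \<phi>"
  by (simp add: test_functions_def)

lemma test_functions_mono: "\<phi> \<in> test_functions U \<Longrightarrow> U \<subseteq> V \<Longrightarrow> \<phi> \<in> test_functions V"
  by (auto simp: test_functions_def)

lemma test_functions_subsupport:
  assumes "\<phi> \<in> test_functions U" "smooth \<psi>" "{x. \<psi> x \<noteq> 0} \<subseteq> closure {x. \<phi> x \<noteq> 0}"
  shows "\<psi> \<in> test_functions U"
proof -
  have "closure {x. \<psi> x \<noteq> 0} \<subseteq> closure {x. \<phi> x \<noteq> 0}"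
    using assms(3) by (simp add: closure_minimal)
  moreover from this have "compact (closure {x. \<psi> x \<noteq> 0})"
    using assms(1) bounded_subset[of "closure {x. \<phi> x \<noteq> 0}" "closure {x. \<psi> x \<noteq> 0}"]
    by (simp add: test_functions_def compact_eq_bounded_closed)
  ultimately show ?thesis using assms(1,2) by (auto simp: test_functions_def)
qed

lemma test_functions_mult: "smooth f \<Longrightarrow> \<phi> \<in> test_functions U \<Longrightarrow> (\<lambda>x. f x * \<phi> x) \<in> test_functions U"
  by (rule test_functions_subsupport[of \<phi>]) (auto intro: smooth_mult test_functions_smooth closure_subset[THEN subsetD])

lemma test_functions_cmult: "\<phi> \<in> test_functions U \<Longrightarrow> (\<lambda>x. c * \<phi> x) \<in> test_functions U"
  by (rule test_functions_mult[OF smooth_const])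

lemma test_functions_partial:
  assumes "\<phi> \<in> test_functions U" shows "partial i \<phi> \<in> test_functions U"
proof (rule test_functions_subsupport[OF assms])
  show "smooth (partial i \<phi>)" by (intro smooth_partial test_functions_smooth[OF assms])
  show "{x. partial i \<phi> x \<noteq> 0} \<subseteq> closure {x. \<phi> x \<noteq> 0}"
  proof (rule subsetI, rule ccontr)
    fix x assume x: "x \<in> {x. partial i \<phi> x \<noteq> 0}" "x \<notin> closure {x. \<phi> x \<noteq> 0}"
    have "((\<lambda>_. 0) has_derivative (\<lambda>_. 0)) (at x)" by simp
    then have "(\<phi> has_derivative (\<lambda>_. 0)) (at x)"
      by (rule has_derivative_transform_within_open[where s="- closure {x. \<phi> x \<noteq> 0}"])
        (use x closure_subset[of "{x. \<phi> x \<noteq> 0}"] in auto)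
    then have "partial i \<phi> x = 0" by (rule has_derivative_imp_partial(2))
    with x show False by simp
  qed
qed

lemma test_functionsI:
  assumes "smooth \<phi>" "\<And>x. \<phi> x \<noteq> 0 \<Longrightarrow> norm x \<le> B" shows "\<phi> \<in> test_functions UNIV"
proof -
  have "bounded {x. \<phi> x \<noteq> 0}" using assms(2) by (auto simp: bounded_iff)
  then show ?thesis using assms(1) by (simp add: test_functions_def compact_closure)
qed

lemma test_functions_bounded:
  assumes "\<phi> \<in> test_functions U" obtains B where "B > 0" "\<And>x. \<phi> x \<noteq> 0 \<Longrightarrow> norm x \<le> B"
proof -
  have "bounded {x. \<phi> x \<noteq> 0}" using assms by (auto simp: test_functions_def compact_closure)
  then show ?thesis using that by (auto simp: bounded_pos)
qed

lemma test_functions_decays: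
  assumes "\<phi> \<in> test_functions U" shows "decays M \<phi>"
proof -
  let ?S = "closure {x. \<phi> x \<noteq> 0}"
  have "continuous_on ?S (\<lambda>x. norm (\<phi> x) * (1 + norm x) ^ M)"
    by (intro continuous_intros continuous_on_subset[OF smooth_continuous[OF test_functions_smooth[OF assms]]]) auto
  moreover have "compact ?S" using assms by (simp add: test_functions_def)
  ultimately have "bounded ((\<lambda>x. norm (\<phi> x) * (1 + norm x) ^ M) ` ?S)"
    by (intro compact_imp_bounded compact_continuous_image)
  then obtain C where C: "C > 0" "\<And>x. x \<in> ?S \<Longrightarrow> norm (\<phi> x) * (1 + norm x) ^ M \<le> C"
    by (auto simp: bounded_pos)
  show ?thesis
  proof (rule decaysI)
    fix x show "norm (\<phi> x) * (1 + norm x) ^ M \<le> C"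
      using C closure_subset[of "{x. \<phi> x \<noteq> 0}"] by (cases "\<phi> x = 0") auto
  qed
qed

lemma test_functions_integrable:
  fixes \<phi> :: "real^'n::finite \<Rightarrow> complex"
  assumes "\<phi> \<in> test_functions U" shows "integrable lborel \<phi>"
  by (intro decays_integrable test_functions_decays[OF assms] smooth_measurable test_functions_smooth[OF assms])

lemma test_functions_scale:
  assumes "\<phi> \<in> test_functions UNIV" "c > 0"
  shows "(\<lambda>x. \<phi> (c *\<^sub>R x)) \<in> test_functions UNIV"
proof -
  obtain B where B: "\<And>x. \<phi> x \<noteq> 0 \<Longrightarrow> norm x \<le> B" using test_functions_bounded[OF assms(1)] by metis
  show ?thesis
  proof (rule test_functionsI)
    show "smooth (\<lambda>x. \<phi> (c *\<^sub>R x))" using smooth_affine[OF test_functions_smooth[OF assms(1)], of c 0] by simp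
    show "norm x \<le> B / c" if "\<phi> (c *\<^sub>R x) \<noteq> 0" for x
      using B[OF that] assms(2) by (simp add: field_simps)
  qed
qed

section \<open>The Fourier transform of test functions\<close>

lemma partial_character:
  "partial i (\<lambda>x. exp (\<i> * complex_of_real (x \<bullet> a))) = (\<lambda>x. \<i> * complex_of_real (a $ i) * exp (\<i> * complex_of_real (x \<bullet> a)))"
proof (rule ext)
  fix x
  have "((\<lambda>x. \<i> * complex_of_real (x \<bullet> a)) has_derivative (\<lambda>h. \<i> * complex_of_real (h \<bullet> a))) (at x)"
    by (auto intro!: derivative_eq_intros)
  from diff_chain_at[OF this DERIV_exp[unfolded has_field_derivative_def]]
  have "((\<lambda>x. exp (\<i> * complex_of_real (x \<bullet> a))) has_derivative
      (\<lambda>h. exp (\<i> * complex_of_real (x \<bullet> a)) * (\<i> * complex_of_real (h \<bullet> a)))) (at x)"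
    by (simp add: o_def)
  from has_derivative_imp_partial(2)[OF this]
  show "partial i (\<lambda>x. exp (\<i> * complex_of_real (x \<bullet> a))) x = \<i> * complex_of_real (a $ i) * exp (\<i> * complex_of_real (x \<bullet> a))"
    by (simp add: inner_axis')
qed

lemma decays_dominated:
  assumes f: "decays (M + k) f" and le: "\<And>x. norm (g x) \<le> c * (1 + norm x) ^ k * norm (f x)" and "c \<ge> 0"
  shows "decays M g"
proof -
  obtain C where C: "C > 0" "\<And>x. norm (f x) * (1 + norm x) ^ (M + k) \<le> C" using f by (metis decaysE)
  show ?thesis
  proof (rule decaysI)
    fix x
    have "norm (g x) * (1 + norm x) ^ M \<le> c * (1 + norm x) ^ k * norm (f x) * (1 + norm x) ^ M"
      using le by (intro mult_right_mono) auto
    also have "\<dots> = c * (norm (f x) * (1 + norm x) ^ (M + k))" by (simp add: power_add)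
    also have "\<dots> \<le> c * C" using C \<open>c \<ge> 0\<close> by (intro mult_left_mono) auto
    finally show "norm (g x) * (1 + norm x) ^ M \<le> c * C" .
  qed
qed

lemma norm_character [simp]: "norm (exp (- (\<i> * complex_of_real r))) = 1" "norm (exp (\<i> * complex_of_real r)) = 1"
  by (simp_all add: norm_exp_eq_Re)

lemma fourier_integrable:
  assumes "integrable lborel \<theta>"
  shows "integrable lborel (\<lambda>\<xi>. exp (- \<i> * complex_of_real (\<xi> \<bullet> x)) * \<theta> \<xi>)"
  by (rule Bochner_Integration.integrable_bound[OF assms]) (use assms in \<open>auto simp: norm_mult\<close>)

lemma fourier_bound: "norm (fourier \<theta> x) \<le> (\<integral>\<xi>. norm (\<theta> \<xi>) \<partial>lborel)"
  unfolding fourier_def by (rule order_trans[OF integral_norm_bound]) (simp add: norm_mult)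

lemma fourier_add:
  "integrable lborel \<theta> \<Longrightarrow> integrable lborel \<eta> \<Longrightarrow> fourier (\<lambda>x. \<theta> x + \<eta> x) = (\<lambda>x. fourier \<theta> x + fourier \<eta> x)"
  using fourier_integrable[of \<theta>] fourier_integrable[of \<eta>] unfolding fourier_def
  by (auto simp: ring_distribs)

lemma fourier_cmult: "fourier (\<lambda>x. c * \<theta> x) = (\<lambda>x. c * fourier \<theta> x)"
  unfolding fourier_def by (auto simp: mult.left_commute)

text \<open>
  The remainder of the first-order expansion of \<open>exp (\<i> t)\<close> is at most \<open>t\<^sup>2\<close>, so the error of the
  linear approximation is controlled by \<open>\<integral> |\<xi>|\<^sup>2 |\<theta> \<xi>| d\<xi>\<close>.
\<close>
lemma fourier_has_derivative:
  fixes \<theta> :: "real^'n::finite \<Rightarrow> complex"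
  assumes [measurable]: "\<theta> \<in> borel_measurable borel" and dec: "decays (2 * CARD('n) + 2) \<theta>"
  shows "(fourier \<theta> has_derivative
    (\<lambda>h. \<integral>\<xi>. exp (- \<i> * complex_of_real (\<xi> \<bullet> x)) * (- \<i> * complex_of_real (\<xi> \<bullet> h) * \<theta> \<xi>) \<partial>lborel)) (at x)"
    (is "(_ has_derivative ?D) _")
proof -
  let ?e = "\<lambda>\<xi> x. exp (- \<i> * complex_of_real (\<xi> \<bullet> x))"
  have i0: "integrable lborel \<theta>" by (intro decays_integrable decays_mono[OF dec]) auto
  have dom: "integrable lborel (\<lambda>\<xi>. complex_of_real (r \<xi>) * \<theta> \<xi>)"
    if [measurable]: "r \<in> borel_measurable borel" and r: "\<And>\<xi>. \<bar>r \<xi>\<bar> \<le> c * (1 + norm \<xi>) ^ 2" and c: "0 \<le> c" for r c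
  proof (rule decays_integrable, rule decays_dominated[OF dec _ c])
    show "norm (complex_of_real (r \<xi>) * \<theta> \<xi>) \<le> c * (1 + norm \<xi>) ^ 2 * norm (\<theta> \<xi>)" for \<xi>
      using mult_right_mono[OF r[of \<xi>], of "norm (\<theta> \<xi>)"] by (simp add: norm_mult)
  qed simp
  have sq: "a \<le> (1 + a)\<^sup>2" if "0 \<le> a" for a :: real
    using that by (simp add: power2_eq_square algebra_simps)
  have n1: "integrable lborel (\<lambda>\<xi>. complex_of_real (\<xi> \<bullet> h) * \<theta> \<xi>)" for h
  proof (rule dom[of "\<lambda>\<xi>. \<xi> \<bullet> h" "norm h"])
    fix \<xi> :: "real^'n"
    have "\<bar>\<xi> \<bullet> h\<bar> \<le> norm \<xi> * norm h" by (rule Cauchy_Schwarz_ineq2)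
    also have "\<dots> \<le> (1 + norm \<xi>) ^ 2 * norm h"
      by (intro mult_right_mono sq) auto
    finally show "\<bar>\<xi> \<bullet> h\<bar> \<le> norm h * (1 + norm \<xi>) ^ 2" by (simp add: mult.commute)
  qed auto
  have n2: "integrable lborel (\<lambda>\<xi>. complex_of_real ((norm \<xi>)\<^sup>2) * \<theta> \<xi>)"
    by (rule dom[of "\<lambda>\<xi>. (norm \<xi>)\<^sup>2" 1]) (auto intro!: power_mono)
  have iD: "integrable lborel (\<lambda>\<xi>. ?e \<xi> x * (- \<i> * complex_of_real (\<xi> \<bullet> h) * \<theta> \<xi>))" for h
    by (rule fourier_integrable) (use integrable_mult_right[OF n1, of "- \<i>" h] in \<open>simp add: mult.assoc\<close>)
  define K1 where "K1 = (\<integral>\<xi>. norm \<xi> * norm (\<theta> \<xi>) \<partial>lborel)"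
  define K2 where "K2 = (\<integral>\<xi>. (norm \<xi>)\<^sup>2 * norm (\<theta> \<xi>) \<partial>lborel)"
  have n1': "integrable lborel (\<lambda>\<xi>. complex_of_real (norm \<xi>) * \<theta> \<xi>)"
    by (rule dom[of norm 1]) (auto intro!: sq)
  have iK1: "integrable lborel (\<lambda>\<xi>. norm \<xi> * norm (\<theta> \<xi>))"
    using integrable_norm[OF n1'] by (simp add: norm_mult)
  have iK2: "integrable lborel (\<lambda>\<xi>. (norm \<xi>)\<^sup>2 * norm (\<theta> \<xi>))"
    using integrable_norm[OF n2] by (simp add: norm_mult norm_power)
  have bl: "bounded_linear ?D"
  proof (rule bounded_linear_intro)
    show "?D (a + b) = ?D a + ?D b" for a b
      by (subst Bochner_Integration.integral_add[symmetric, OF iD iD]) (simp add: inner_add_right ring_distribs)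
    show "?D (r *\<^sub>R a) = r *\<^sub>R ?D a" for r a
      by (subst integral_scaleR_right[symmetric], intro Bochner_Integration.integral_cong refl)
        (simp add: scaleR_conv_of_real[where 'a=complex])
    show "norm (?D h) \<le> norm h * K1" for h
    proof -
      have "norm (?D h) \<le> (\<integral>\<xi>. norm (?e \<xi> x * (- \<i> * complex_of_real (\<xi> \<bullet> h) * \<theta> \<xi>)) \<partial>lborel)"
        by (rule integral_norm_bound)
      also have "\<dots> \<le> (\<integral>\<xi>. norm h * (norm \<xi> * norm (\<theta> \<xi>)) \<partial>lborel)"
      proof (rule integral_mono)
        fix \<xi> show "norm (?e \<xi> x * (- \<i> * complex_of_real (\<xi> \<bullet> h) * \<theta> \<xi>)) \<le> norm h * (norm \<xi> * norm (\<theta> \<xi>))"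
          using mult_right_mono[OF Cauchy_Schwarz_ineq2[of \<xi> h], of "norm (\<theta> \<xi>)"] by (simp add: norm_mult mult_ac)
      qed (use integrable_norm[OF iD] iK1 in auto)
      finally show ?thesis by (simp add: K1_def)
    qed
  qed
  show ?thesis
  proof (rule has_derivativeI_sandwich[where e=1 and H="\<lambda>y. K2 * norm (y - x)"])
    show "((\<lambda>y. K2 * norm (y - x)) \<longlongrightarrow> 0) (at x)"
      by (auto intro!: tendsto_eq_intros)
    fix y assume "y \<noteq> x"
    have ptw: "norm (?e \<xi> y * \<theta> \<xi> - ?e \<xi> x * \<theta> \<xi> - ?e \<xi> x * (- \<i> * complex_of_real (\<xi> \<bullet> (y - x)) * \<theta> \<xi>))
        \<le> (norm (y - x))\<^sup>2 * ((norm \<xi>)\<^sup>2 * norm (\<theta> \<xi>))" for \<xi>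
    proof -
      let ?t = "- (\<xi> \<bullet> (y - x))"
      have "?e \<xi> y = ?e \<xi> x * exp (\<i> * complex_of_real ?t)"
        by (simp add: exp_add[symmetric] inner_diff_right ring_distribs)
      then have "?e \<xi> y * \<theta> \<xi> - ?e \<xi> x * \<theta> \<xi> - ?e \<xi> x * (- \<i> * complex_of_real (\<xi> \<bullet> (y - x)) * \<theta> \<xi>)
          = ?e \<xi> x * \<theta> \<xi> * (exp (\<i> * complex_of_real ?t) - (1 + \<i> * complex_of_real ?t))"
        by (simp only:) (simp add: algebra_simps)
      also have "norm \<dots> = norm (\<theta> \<xi>) * norm (exp (\<i> * complex_of_real ?t) - (1 + \<i> * complex_of_real ?t))"
        by (simp add: norm_mult)
      also have "\<dots> \<le> norm (\<theta> \<xi>) * (norm \<xi> * norm (y - x))\<^sup>2"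
      proof (rule mult_left_mono)
        have "norm (exp (\<i> * complex_of_real ?t) - (1 + \<i> * complex_of_real ?t)) \<le> \<bar>?t\<bar>\<^sup>2 / 2"
          using iexp_approx1[of ?t 1] by (simp add: numeral_2_eq_2)
        also have "\<dots> \<le> \<bar>?t\<bar>\<^sup>2" by simp
        also have "\<dots> \<le> (norm \<xi> * norm (y - x))\<^sup>2"
          using Cauchy_Schwarz_ineq2[of \<xi> "y - x"] by (intro power_mono) auto
        finally show "norm (exp (\<i> * complex_of_real ?t) - (1 + \<i> * complex_of_real ?t)) \<le> (norm \<xi> * norm (y - x))\<^sup>2" .
      qed simp
      finally show ?thesis by (simp add: power_mult_distrib mult_ac)
    qed
    have i3: "integrable lborel (\<lambda>\<xi>. ?e \<xi> y * \<theta> \<xi> - ?e \<xi> x * \<theta> \<xi> - ?e \<xi> x * (- \<i> * complex_of_real (\<xi> \<bullet> (y - x)) * \<theta> \<xi>))"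
      by (intro Bochner_Integration.integrable_diff iD fourier_integrable i0)
    have "fourier \<theta> y - fourier \<theta> x - ?D (y - x) =
      (\<integral>\<xi>. ?e \<xi> y * \<theta> \<xi> - ?e \<xi> x * \<theta> \<xi> - ?e \<xi> x * (- \<i> * complex_of_real (\<xi> \<bullet> (y - x)) * \<theta> \<xi>) \<partial>lborel)"
      unfolding fourier_def
      by (simp only: Bochner_Integration.integral_diff Bochner_Integration.integrable_diff iD fourier_integrable[OF i0])
    also have "norm \<dots> \<le> (\<integral>\<xi>. (norm (y - x))\<^sup>2 * ((norm \<xi>)\<^sup>2 * norm (\<theta> \<xi>)) \<partial>lborel)"
      by (rule order_trans[OF integral_norm_bound], rule integral_mono)
        (use integrable_norm[OF i3] iK2 ptw in auto)
    also have "\<dots> = (norm (y - x))\<^sup>2 * K2" by (simp add: K2_def)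
    finally show "norm (fourier \<theta> y - fourier \<theta> x - ?D (y - x)) / norm (y - x) \<le> K2 * norm (y - x)"
      using \<open>y \<noteq> x\<close> by (simp add: divide_le_eq power2_eq_square mult_ac)
  qed (use bl in auto)
qed

lemma fourier_differentiable:
  fixes \<theta> :: "real^'n::finite \<Rightarrow> complex"
  assumes "\<theta> \<in> test_functions UNIV" 
  shows "fourier \<theta> differentiable (at x)"
    and "partial i (fourier \<theta>) = fourier (\<lambda>\<xi>. - \<i> * complex_of_real (\<xi> $ i) * \<theta> \<xi>)"
proof -
  note d = fourier_has_derivative[OF smooth_measurable[OF test_functions_smooth[OF assms]] test_functions_decays[OF assms]]
  show "fourier \<theta> differentiable (at x)" by (rule differentiableI[OF d])
  show "partial i (fourier \<theta>) = fourier (\<lambda>\<xi>. - \<i> * complex_of_real (\<xi> $ i) * \<theta> \<xi>)"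
    by (rule ext, subst has_derivative_imp_partial(2)[OF d]) (simp add: fourier_def inner_axis)
qed

lemma test_functions_coord_mult:
  "\<theta> \<in> test_functions U \<Longrightarrow> (\<lambda>\<xi>. c * complex_of_real (\<xi> $ i) * \<theta> \<xi>) \<in> test_functions U"
  by (intro test_functions_mult smooth_cmult smooth_coord)

lemma partial_fourier_closed:
  assumes "g \<in> fourier ` test_functions UNIV" shows "partial i g \<in> fourier ` test_functions UNIV"
proof -
  obtain \<theta> where \<theta>: "g = fourier \<theta>" "\<theta> \<in> test_functions UNIV" using assms by auto
  show ?thesis unfolding \<theta>(1) fourier_differentiable(2)[OF \<theta>(2)]
    by (intro imageI test_functions_coord_mult \<theta>)
qed

lemma fourier_smooth:
  assumes "\<theta> \<in> test_functions UNIV" shows "smooth (fourier \<theta>)"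
  by (rule smooth_coinduct[of _ "fourier ` test_functions UNIV"])
    (use assms in \<open>auto simp: fourier_differentiable(1) intro: partial_fourier_closed\<close>)

text \<open>
  Integration by parts, in the form that the derivative of \<open>\<theta>\<close> times a character has integral 0.
\<close>
lemma fourier_of_partial:
  fixes \<theta> :: "real^'n::finite \<Rightarrow> complex"
  assumes \<theta>: "\<theta> \<in> test_functions UNIV"
  shows "fourier (partial i \<theta>) x = \<i> * complex_of_real (x $ i) * fourier \<theta> x"
proof -
  let ?e = "\<lambda>\<xi>. exp (\<i> * complex_of_real (\<xi> \<bullet> (- x)))"
  let ?F = "\<lambda>\<xi>. ?e \<xi> * \<theta> \<xi>"
  have F: "?F \<in> test_functions UNIV" by (intro test_functions_mult smooth_character \<theta>)
  have pF: "partial i ?F = (\<lambda>\<xi>. ?e \<xi> * partial i \<theta> \<xi> + - \<i> * complex_of_real (x $ i) * (?e \<xi> * \<theta> \<xi>))"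
    by (rule ext, subst partial_mult)
      (auto simp: smooth_differentiable smooth_character[of "- x", simplified] test_functions_smooth[OF \<theta>] 
        partial_character[of i "- x", simplified])
  have i1: "integrable lborel (\<lambda>\<xi>. ?e \<xi> * partial i \<theta> \<xi>)"
    by (intro test_functions_integrable[of _ UNIV] test_functions_mult smooth_character test_functions_partial \<theta>)
  have i2: "integrable lborel (\<lambda>\<xi>. - \<i> * complex_of_real (x $ i) * (?e \<xi> * \<theta> \<xi>))"
    by (intro integrable_mult_right test_functions_integrable[of _ UNIV] F)
  have "0 = (\<integral>\<xi>. partial i ?F \<xi> \<partial>lborel)"
    by (rule integral_partial_eq_0[symmetric])
      (intro test_functions_smooth[OF F] test_functions_decays[OF F] test_functions_decays[OF test_functions_partial[OF F]])+
  also have "\<dots> = fourier (partial i \<theta>) x - \<i> * complex_of_real (x $ i) * fourier \<theta> x"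
    unfolding pF by (subst Bochner_Integration.integral_add[OF i1 i2]) (simp add: fourier_def)
  finally show ?thesis by simp
qed

text \<open>
  Every factor \<open>x\<^sub>i\<close> can be traded for a derivative of \<open>\<theta>\<close>, which is again a test function with a bounded
  Fourier transform.
\<close>
lemma fourier_decays:
  fixes \<theta> :: "real^'n::finite \<Rightarrow> complex"
  assumes "\<theta> \<in> test_functions UNIV" shows "decays M (fourier \<theta>)"
  using assms
proof (induction M arbitrary: \<theta>)
  case 0
  show ?case by (rule decaysI) (use fourier_bound in simp)
next
  case (Suc M)
  have "\<exists>C. \<forall>i x. norm (fourier (partial i \<theta>) x) * (1 + norm x) ^ M \<le> C i" 
    using Suc.IH[OF test_functions_partial[OF Suc.prems]] unfolding decays_def by metis
  then obtain C where C: "\<And>i x. norm (fourier (partial i \<theta>) x) * (1 + norm x) ^ M \<le> C i" by blast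
  obtain D where D: "\<And>x. norm (fourier \<theta> x) * (1 + norm x) ^ M \<le> D"
    using Suc.IH[OF Suc.prems] unfolding decays_def by blast
  show ?case
  proof (rule decaysI)
    fix x :: "real^'n"
    have "norm x * norm (fourier \<theta> x) \<le> (\<Sum>i\<in>UNIV. \<bar>x $ i\<bar>) * norm (fourier \<theta> x)"
      by (intro mult_right_mono norm_le_l1_cart) auto
    also have "\<dots> = (\<Sum>i\<in>UNIV. norm (fourier (partial i \<theta>) x))"
      by (simp add: fourier_of_partial[OF Suc.prems] sum_distrib_right norm_mult)
    finally have 1: "norm x * norm (fourier \<theta> x) \<le> (\<Sum>i\<in>UNIV. norm (fourier (partial i \<theta>) x))" .
    have "norm (fourier \<theta> x) * (1 + norm x) ^ Suc M
        = norm (fourier \<theta> x) * (1 + norm x) ^ M + (norm x * norm (fourier \<theta> x)) * (1 + norm x) ^ M"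
      by (simp add: algebra_simps)
    also have "\<dots> \<le> D + (\<Sum>i\<in>UNIV. norm (fourier (partial i \<theta>) x)) * (1 + norm x) ^ M"
      by (intro add_mono D mult_right_mono 1) auto
    also have "\<dots> \<le> D + (\<Sum>i\<in>UNIV. C i)"
      unfolding sum_distrib_right by (intro add_mono sum_mono C order_refl)
    finally show "norm (fourier \<theta> x) * (1 + norm x) ^ Suc M \<le> D + (\<Sum>i\<in>UNIV. C i)" .
  qed
qed

section \<open>Schwartz functions\<close>

lemma foldr_partial_closed:
  assumes "f \<in> X" "\<And>g i. g \<in> X \<Longrightarrow> partial i g \<in> X"
  shows "foldr (\<lambda>i. partial i ^^ \<alpha> i) is f \<in> X"
proof (induction "is")
  case (Cons i "is")
  have "(partial i ^^ n) g \<in> X" if "g \<in> X" for g n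
    by (induction n) (auto simp: that assms(2))
  with Cons show ?case by simp
qed (use assms in simp)

lemma multi_deriv_closed:
  "f \<in> X \<Longrightarrow> (\<And>g i. g \<in> X \<Longrightarrow> partial i g \<in> X) \<Longrightarrow> multi_deriv \<alpha> f \<in> X"
  unfolding multi_deriv_def by (rule foldr_partial_closed)

lemma funpow_partial_commute:
  "smooth f \<Longrightarrow> (partial i ^^ m) (partial j f) = partial j ((partial i ^^ m) f)"
proof (induction m)
  case (Suc m)
  have "smooth ((partial i ^^ m) f)" using Suc.prems by (induction m) (auto intro: smooth_partial)
  then show ?case using Suc by (simp add: partial_commute)
qed simp

lemma foldr_partial_commute:
  assumes "smooth f"
  shows "foldr (\<lambda>i. partial i ^^ \<alpha> i) is (partial j f) = partial j (foldr (\<lambda>i. partial i ^^ \<alpha> i) is f)"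
proof (induction "is")
  case (Cons i "is")
  have "smooth (foldr (\<lambda>i. partial i ^^ \<alpha> i) is f)"
    using foldr_partial_closed[of f "Collect smooth"] assms by (auto intro: smooth_partial)
  with Cons show ?case by (simp add: funpow_partial_commute)
qed simp

lemma multi_deriv_commute: "smooth f \<Longrightarrow> multi_deriv \<alpha> (partial j f) = partial j (multi_deriv \<alpha> f)"
  unfolding multi_deriv_def by (rule foldr_partial_commute)

text \<open>
  A multi-index derivative applies the partial derivatives in the order of the index type.  They
  commute, so a further one may be added at any place.
\<close>
lemma multi_deriv_partial:
  assumes "smooth f"
  shows "partial j (multi_deriv \<alpha> f) = multi_deriv (\<alpha>(j := Suc (\<alpha> j))) f"
proof -
  have ni: "foldr (\<lambda>i. partial i ^^ (\<alpha>(j := Suc (\<alpha> j))) i) is f = foldr (\<lambda>i. partial i ^^ \<alpha> i) is f"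
    if "j \<notin> set is" for "is" using that by (induction "is") auto
  have "foldr (\<lambda>i. partial i ^^ (\<alpha>(j := Suc (\<alpha> j))) i) is f = partial j (foldr (\<lambda>i. partial i ^^ \<alpha> i) is f)"
    if "distinct is" "j \<in> set is" for "is" using that
  proof (induction "is")
    case (Cons i "is")
    show ?case
    proof (cases "i = j")
      case True
      then show ?thesis using Cons.prems by (simp add: ni del: fun_upd_apply) simp
    next
      case False
      have "smooth (foldr (\<lambda>i. partial i ^^ \<alpha> i) is f)"
        using foldr_partial_closed[of f "Collect smooth"] assms by (auto intro: smooth_partial)
      with Cons False show ?thesis by (simp add: funpow_partial_commute)
    qed
  qed simp
  then show ?thesis unfolding multi_deriv_def by simp
qed

lemma multi_deriv_0: "multi_deriv (\<lambda>_. 0) f = f"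
proof -
  have "foldr (\<lambda>i. partial i ^^ 0) is f = f" for "is" by (induction "is") auto
  then show ?thesis by (simp add: multi_deriv_def)
qed

lemma multi_order_Suc: "multi_order (\<alpha>(j := Suc (\<alpha> j))) = Suc (multi_order \<alpha>)"
proof -
  have "(\<Sum>i\<in>UNIV. (\<alpha>(j := Suc (\<alpha> j))) i) = (\<Sum>i\<in>UNIV. \<alpha> i + (if i = j then 1 else 0))"
    by (intro sum.cong) auto
  then show ?thesis by (simp add: multi_order_def sum.distrib)
qed

lemma schwartz_iff: "\<phi> \<in> schwartz \<longleftrightarrow> smooth \<phi> \<and> (\<forall>\<alpha> m. decays m (multi_deriv \<alpha> \<phi>))"
  unfolding schwartz_def decays_def bounded_iff by (auto simp: mult.commute)

lemma schwartz_smooth: "\<phi> \<in> schwartz \<Longrightarrow> smooth \<phi>" by (simp add: schwartz_iff)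

lemma schwartz_decays: "\<phi> \<in> schwartz \<Longrightarrow> decays m \<phi>"
  unfolding schwartz_iff by (metis multi_deriv_0)

lemma schwartz_partial: "\<phi> \<in> schwartz \<Longrightarrow> partial i \<phi> \<in> schwartz"
  by (auto simp: schwartz_iff smooth_partial multi_deriv_commute multi_deriv_partial)

lemma schwartz_multi_deriv: "\<phi> \<in> schwartz \<Longrightarrow> multi_deriv \<alpha> \<phi> \<in> schwartz"
  by (rule multi_deriv_closed) (auto intro: schwartz_partial)

lemma fourier_schwartz:
  fixes \<theta> :: "real^'n::{finite,linorder} \<Rightarrow> complex"
  assumes "\<theta> \<in> test_functions UNIV" shows "fourier \<theta> \<in> schwartz"
proof -
  have "multi_deriv \<alpha> (fourier \<theta>) \<in> fourier ` test_functions UNIV" for \<alpha>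
    by (rule multi_deriv_closed) (use assms partial_fourier_closed in auto)
  then show ?thesis unfolding schwartz_iff
    using fourier_decays fourier_smooth[OF assms] by (metis (no_types, lifting) imageE)
qed

section \<open>Fourier inversion for test functions\<close>

lemma nn_integral_vec_affine:
  fixes f :: "real^'n::finite \<Rightarrow> ennreal"
  assumes [measurable]: "f \<in> borel_measurable borel" and c: "c \<noteq> 0"
  shows "(\<integral>\<^sup>+x. f x \<partial>lborel) = ennreal (\<bar>c\<bar> ^ CARD('n)) * (\<integral>\<^sup>+x. f (t + c *\<^sub>R x) \<partial>lborel)"
  by (subst lborel_affine[OF c, of t])
    (simp add: nn_integral_density nn_integral_distr nn_integral_cmult)

lemma integral_vec_affine:
  fixes f :: "real^'n::finite \<Rightarrow> complex"
  assumes [measurable]: "f \<in> borel_measurable borel" and c: "c \<noteq> 0"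
  shows "(\<integral>x. f x \<partial>lborel) = complex_of_real (\<bar>c\<bar> ^ CARD('n)) * (\<integral>x. f (t + c *\<^sub>R x) \<partial>lborel)"
  by (subst lborel_affine[OF c, of t])
    (simp add: integral_density integral_distr scaleR_conv_of_real[where 'a=complex])

lemma
  fixes f :: "'a::euclidean_space \<Rightarrow> 'b::euclidean_space \<Rightarrow> complex"
  assumes m: "(\<lambda>(x, y). f x y) \<in> borel_measurable (borel \<Otimes>\<^sub>M borel)"
    and fin: "(\<integral>\<^sup>+x. \<integral>\<^sup>+y. ennreal (norm (f x y)) \<partial>lborel \<partial>lborel) < \<infinity>"
  shows lborel_swap_integrals: "(\<integral>x. \<integral>y. f x y \<partial>lborel \<partial>lborel) = (\<integral>y. \<integral>x. f x y \<partial>lborel \<partial>lborel)"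
    and lborel_integrable_inner: "integrable lborel (\<lambda>x. \<integral>y. f x y \<partial>lborel)"
    and lborel_integrable_inner': "integrable lborel (\<lambda>y. \<integral>x. f x y \<partial>lborel)"
proof -
  have m': "(\<lambda>(x, y). f x y) \<in> borel_measurable (lborel \<Otimes>\<^sub>M lborel)"
    using m by (simp cong: measurable_cong_sets sets_pair_measure_cong)
  have i: "integrable (lborel \<Otimes>\<^sub>M lborel) (\<lambda>(x, y). f x y)"
  proof (rule integrableI_bounded[OF m'])
    have "(\<integral>\<^sup>+p. ennreal (norm (case p of (x, y) \<Rightarrow> f x y)) \<partial>(lborel \<Otimes>\<^sub>M lborel))
        = (\<integral>\<^sup>+x. \<integral>\<^sup>+y. ennreal (norm (f x y)) \<partial>lborel \<partial>lborel)"
      using m' by (subst lborel.nn_integral_fst[symmetric]) (auto simp: split_beta)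
    then show "(\<integral>\<^sup>+p. ennreal (norm (case p of (x, y) \<Rightarrow> f x y)) \<partial>(lborel \<Otimes>\<^sub>M lborel)) < \<infinity>"
      using fin by simp
  qed
  show "(\<integral>x. \<integral>y. f x y \<partial>lborel \<partial>lborel) = (\<integral>y. \<integral>x. f x y \<partial>lborel \<partial>lborel)"
    using lborel_pair.Fubini_integral[OF i] by simp
  show "integrable lborel (\<lambda>x. \<integral>y. f x y \<partial>lborel)"
    using lborel_pair.integrable_fst[OF i] by simp
  show "integrable lborel (\<lambda>y. \<integral>x. f x y \<partial>lborel)"
    using lborel_pair.integrable_snd[OF i] by simp
qed

lemma gaussian_1d:
  "integrable lborel (\<lambda>t. exp (\<i> * complex_of_real (t * y)) * complex_of_real (exp (- t\<^sup>2 / 2)))"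
  "(\<integral>t. exp (\<i> * complex_of_real (t * y)) * complex_of_real (exp (- t\<^sup>2 / 2)) \<partial>lborel)
    = complex_of_real (sqrt (2 * pi) * exp (- y\<^sup>2 / 2))"
proof -
  have e: "complex_of_real (exp (- t\<^sup>2 / 2)) = complex_of_real (sqrt (2 * pi)) * complex_of_real (std_normal_density t)" for t
  proof -
    have "exp (- t\<^sup>2 / 2) = sqrt (2 * pi) * std_normal_density t" by (simp add: std_normal_density_def)
    then show ?thesis by (simp only: of_real_mult)
  qed
  have "integrable lborel (\<lambda>t. complex_of_real (sqrt (2 * pi)) * (exp (\<i> * complex_of_real (t * y)) * complex_of_real (std_normal_density t)))"
    by (intro integrable_mult_right Bochner_Integration.integrable_bound[OF integrable_std_normal_moment[of 0]])
      (auto simp: norm_mult)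
  then show "integrable lborel (\<lambda>t. exp (\<i> * complex_of_real (t * y)) * complex_of_real (exp (- t\<^sup>2 / 2)))"
    unfolding e by (simp add: mult_ac)
  have "complex_of_real (exp (- (y^2) / 2)) = char std_normal_distribution y"
    by (simp add: char_std_normal_distribution)
  also have "\<dots> = (\<integral>t. exp (\<i> * complex_of_real (t * y)) * complex_of_real (std_normal_density t) \<partial>lborel)"
    unfolding char_def by (subst integral_density) (auto simp: scaleR_conv_of_real mult_ac)
  finally have "complex_of_real (sqrt (2 * pi) * exp (- y\<^sup>2 / 2)) =
      complex_of_real (sqrt (2 * pi)) * (\<integral>t. exp (\<i> * complex_of_real (t * y)) * complex_of_real (std_normal_density t) \<partial>lborel)"
    by simp
  also have "\<dots> = (\<integral>t. complex_of_real (sqrt (2 * pi)) * (exp (\<i> * complex_of_real (t * y)) * complex_of_real (std_normal_density t)) \<partial>lborel)"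
    by simp
  also have "\<dots> = (\<integral>t. exp (\<i> * complex_of_real (t * y)) * complex_of_real (exp (- t\<^sup>2 / 2)) \<partial>lborel)"
    unfolding e by (intro Bochner_Integration.integral_cong refl) (simp only: mult_ac)
  finally show "(\<integral>t. exp (\<i> * complex_of_real (t * y)) * complex_of_real (exp (- t\<^sup>2 / 2)) \<partial>lborel)
    = complex_of_real (sqrt (2 * pi) * exp (- y\<^sup>2 / 2))" by simp
qed

definition gauss :: "real^'n::finite \<Rightarrow> real" where "gauss x = exp (- (norm x)\<^sup>2 / 2)"

lemma gauss_prod: "gauss x = (\<Prod>i\<in>UNIV. exp (- (x $ i)\<^sup>2 / 2))"
proof -
  have "(norm x)\<^sup>2 = (\<Sum>i\<in>UNIV. (x $ i)\<^sup>2)" by (simp add: norm_vec_def L2_set_def sum_nonneg)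
  then have "- (norm x)\<^sup>2 / 2 = (\<Sum>i\<in>UNIV. - (x $ i)\<^sup>2 / 2)"
    by (simp add: sum_negf sum_divide_distrib)
  then show ?thesis by (simp add: gauss_def exp_sum)
qed

lemma gauss_nonneg [simp]: "0 \<le> gauss x" by (simp add: gauss_def)

lemma abs_gauss [simp]: "\<bar>gauss x\<bar> = gauss x" by (simp add: gauss_def)

lemma gauss_measurable [measurable]: "gauss \<in> borel_measurable borel"
  unfolding gauss_def by measurable

lemma character_prod: "exp (\<i> * complex_of_real (x \<bullet> y)) = (\<Prod>i\<in>UNIV. exp (\<i> * complex_of_real (x $ i * y $ i)))"
  by (simp add: inner_vec_def sum_distrib_left exp_sum)

lemma gaussian_fourier:
  fixes y :: "real^'n::finite"
  shows "integrable lborel (\<lambda>x. exp (\<i> * complex_of_real (x \<bullet> y)) * complex_of_real (gauss x))"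
    and "(\<integral>x. exp (\<i> * complex_of_real (x \<bullet> y)) * complex_of_real (gauss x) \<partial>lborel)
      = complex_of_real (sqrt (2 * pi) ^ CARD('n) * gauss y)"
proof -
  have e: "exp (\<i> * complex_of_real (x \<bullet> y)) * complex_of_real (gauss x)
      = (\<Prod>i\<in>UNIV. exp (\<i> * complex_of_real (x $ i * y $ i)) * complex_of_real (exp (- (x $ i)\<^sup>2 / 2)))" for x :: "real^'n"
    by (simp only: character_prod gauss_prod of_real_prod prod.distrib)
  show "integrable lborel (\<lambda>x. exp (\<i> * complex_of_real (x \<bullet> y)) * complex_of_real (gauss x))"
    unfolding e by (rule integrable_prod_vec) (rule gaussian_1d)
  show "(\<integral>x. exp (\<i> * complex_of_real (x \<bullet> y)) * complex_of_real (gauss x) \<partial>lborel)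
      = complex_of_real (sqrt (2 * pi) ^ CARD('n) * gauss y)"
    unfolding e by (subst integral_prod_vec[OF gaussian_1d(1)], unfold gaussian_1d(2)) (simp only: gauss_prod of_real_mult of_real_prod of_real_power prod.distrib prod_constant)
qed

lemma integrable_gauss: "integrable lborel (gauss :: real^'n::finite \<Rightarrow> real)"
  "(\<integral>x. complex_of_real (gauss x) \<partial>(lborel :: (real^'n) measure)) = complex_of_real (sqrt (2 * pi) ^ CARD('n))"
proof -
  have "integrable lborel (\<lambda>x :: real^'n. complex_of_real (gauss x))"
    using gaussian_fourier(1)[of 0] by simp
  from integrable_Re[OF this] show "integrable lborel (gauss :: real^'n \<Rightarrow> real)" by simp
  show "(\<integral>x. complex_of_real (gauss x) \<partial>(lborel :: (real^'n) measure)) = complex_of_real (sqrt (2 * pi) ^ CARD('n))"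
    using gaussian_fourier(2)[of 0] by (simp add: gauss_def[of 0])
qed

lemma gauss_bounds: "0 < gauss x" "gauss x \<le> 1"
  by (simp_all add: gauss_def)

text \<open>
  The Gaussian factor makes the double integral over \<open>x\<close> and the frequency absolutely convergent, so
  the integrals may be interchanged.  The inner one is then the Fourier transform of a Gaussian, an
  approximate identity of width \<open>e\<close>.  Letting \<open>e\<close> tend to 0 yields \<open>fourier_inversion\<close>.
\<close>
lemma gaussian_regularised_inversion:
  fixes m :: "real^'n::finite \<Rightarrow> complex"
  assumes m: "m \<in> test_functions UNIV" and e: "e > 0"
  shows "(\<integral>x. exp (\<i> * complex_of_real (x \<bullet> \<xi>)) * fourier m x * complex_of_real (gauss (e *\<^sub>R x)) \<partial>lborel)
    = complex_of_real (sqrt (2 * pi) ^ CARD('n)) * (\<integral>s. m (\<xi> + e *\<^sub>R s) * complex_of_real (gauss s) \<partial>lborel)"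
proof -
  have [measurable]: "m \<in> borel_measurable borel" by (intro smooth_measurable test_functions_smooth[OF m])
  have im: "integrable lborel m" by (rule test_functions_integrable[OF m])
  have ige: "integrable lborel (\<lambda>x :: real^'n. gauss (e *\<^sub>R x))"
  proof (rule integrableI_bounded)
    have "ennreal (\<bar>e\<bar> ^ CARD('n)) * (\<integral>\<^sup>+x. ennreal (gauss (0 + e *\<^sub>R (x :: real^'n))) \<partial>lborel) = (\<integral>\<^sup>+x. ennreal (gauss (x :: real^'n)) \<partial>lborel)"
      by (rule nn_integral_vec_affine[where f="\<lambda>x. ennreal (gauss x)" and t=0, symmetric]) (use e in auto)
    also have "\<dots> < \<infinity>"
      using integrable_gauss(1)[where 'n='n] gauss_bounds
      by (auto simp: integrable_iff_bounded less_imp_le abs_of_nonneg)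
    finally have *: "ennreal (\<bar>e\<bar> ^ CARD('n)) * (\<integral>\<^sup>+x. ennreal (gauss (0 + e *\<^sub>R (x :: real^'n))) \<partial>lborel) < \<infinity>" .
    have "ennreal (\<bar>e\<bar> ^ CARD('n)) \<noteq> 0"
      using zero_less_power[OF e, of "CARD('n)"] e by (simp add: ennreal_eq_0_iff not_le)
    with * show "(\<integral>\<^sup>+x. ennreal (norm (gauss (e *\<^sub>R (x :: real^'n)))) \<partial>lborel) < \<infinity>"
      by (auto simp: ennreal_mult_less_top)
  qed measurable
  let ?f = "\<lambda>x \<eta>. exp (\<i> * complex_of_real (x \<bullet> (\<xi> - \<eta>))) * m \<eta> * complex_of_real (gauss (e *\<^sub>R x))"
  have fin: "(\<integral>\<^sup>+x. \<integral>\<^sup>+\<eta>. ennreal (norm (?f x \<eta>)) \<partial>lborel \<partial>lborel) < \<infinity>"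
  proof -
    have "(\<integral>\<^sup>+x. \<integral>\<^sup>+\<eta>. ennreal (norm (?f x \<eta>)) \<partial>lborel \<partial>lborel)
        = (\<integral>\<^sup>+x. \<integral>\<^sup>+\<eta>. ennreal (gauss (e *\<^sub>R (x :: real^'n))) * ennreal (norm (m \<eta>)) \<partial>lborel \<partial>lborel)"
      by (intro nn_integral_cong) (simp add: norm_mult ennreal_mult mult.commute)
    also have "\<dots> = (\<integral>\<^sup>+x. ennreal (gauss (e *\<^sub>R (x :: real^'n))) \<partial>lborel) * (\<integral>\<^sup>+\<eta>. ennreal (norm (m \<eta>)) \<partial>lborel)"
      by (simp add: nn_integral_cmult nn_integral_multc)
    also have "\<dots> < \<infinity>"
      using ige im gauss_bounds by (auto simp: integrable_iff_bounded less_imp_le abs_of_nonneg ennreal_mult_less_top)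
    finally show ?thesis .
  qed
  have inner: "(\<integral>x. ?f x (\<xi> + e *\<^sub>R s) \<partial>lborel) * complex_of_real (e ^ CARD('n))
      = complex_of_real (sqrt (2 * pi) ^ CARD('n)) * (m (\<xi> + e *\<^sub>R s) * complex_of_real (gauss s))" for s
  proof -
    have "(\<integral>x. exp (\<i> * complex_of_real (x \<bullet> - s)) * complex_of_real (gauss x) \<partial>lborel)
        = complex_of_real (\<bar>e\<bar> ^ CARD('n)) * (\<integral>x. exp (\<i> * complex_of_real ((0 + e *\<^sub>R x) \<bullet> - s)) * complex_of_real (gauss (0 + e *\<^sub>R x)) \<partial>lborel)"
      by (rule integral_vec_affine) (use e in auto)
    then have "complex_of_real (sqrt (2 * pi) ^ CARD('n) * gauss s)
        = complex_of_real (e ^ CARD('n)) * (\<integral>x. exp (\<i> * complex_of_real (x \<bullet> - (e *\<^sub>R s))) * complex_of_real (gauss (e *\<^sub>R x)) \<partial>lborel)"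
      using e unfolding gaussian_fourier(2) by (simp add: gauss_def)
    moreover have "(\<integral>x. ?f x (\<xi> + e *\<^sub>R s) \<partial>lborel)
        = m (\<xi> + e *\<^sub>R s) * (\<integral>x. exp (\<i> * complex_of_real (x \<bullet> - (e *\<^sub>R s))) * complex_of_real (gauss (e *\<^sub>R x)) \<partial>lborel)"
      by (subst integral_mult_right_zero[symmetric], intro Bochner_Integration.integral_cong refl)
        (simp add: mult_ac)
    ultimately show ?thesis by (simp add: mult_ac)
  qed
  have "(\<integral>x. exp (\<i> * complex_of_real (x \<bullet> \<xi>)) * fourier m x * complex_of_real (gauss (e *\<^sub>R x)) \<partial>lborel)
      = (\<integral>x. \<integral>\<eta>. ?f x \<eta> \<partial>lborel \<partial>lborel)"
  proof (intro Bochner_Integration.integral_cong refl)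
    fix x :: "real^'n"
    have "exp (\<i> * complex_of_real (x \<bullet> (\<xi> - \<eta>)))
        = exp (\<i> * complex_of_real (x \<bullet> \<xi>)) * exp (- \<i> * complex_of_real (\<eta> \<bullet> x))" for \<eta>
      by (simp add: exp_add[symmetric] inner_diff_right inner_commute right_diff_distrib)
    then have "?f x \<eta> = (exp (\<i> * complex_of_real (x \<bullet> \<xi>)) * complex_of_real (gauss (e *\<^sub>R x))) * (exp (- \<i> * complex_of_real (\<eta> \<bullet> x)) * m \<eta>)" for \<eta>
      by (simp only: mult_ac)
    then show "exp (\<i> * complex_of_real (x \<bullet> \<xi>)) * fourier m x * complex_of_real (gauss (e *\<^sub>R x)) = (\<integral>\<eta>. ?f x \<eta> \<partial>lborel)"
      by (simp only: integral_mult_right_zero fourier_def) (simp only: mult_ac)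
  qed
  also have "\<dots> = (\<integral>\<eta>. \<integral>x. ?f x \<eta> \<partial>lborel \<partial>lborel)"
    by (rule lborel_swap_integrals[OF _ fin]) measurable
  also have "\<dots> = complex_of_real (\<bar>e\<bar> ^ CARD('n)) * (\<integral>s. \<integral>x. ?f x (\<xi> + e *\<^sub>R s) \<partial>lborel \<partial>lborel)"
    by (rule integral_vec_affine) (use e in auto)
  also have "\<dots> = (\<integral>s. complex_of_real (sqrt (2 * pi) ^ CARD('n)) * (m (\<xi> + e *\<^sub>R s) * complex_of_real (gauss s)) \<partial>lborel)"
    unfolding inner[symmetric] using e by (simp add: mult.commute)
  finally show ?thesis by simp
qed

definition inverse_fourier :: "(real^'n::finite \<Rightarrow> complex) \<Rightarrow> real^'n \<Rightarrow> complex" where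
  "inverse_fourier m x = fourier m (- x) / complex_of_real ((2 * pi) ^ CARD('n))"

lemma fourier_inversion:
  fixes m :: "real^'n::finite \<Rightarrow> complex"
  assumes m: "m \<in> test_functions UNIV"
  shows "fourier (inverse_fourier m) \<xi> = m \<xi>"
proof -
  have [measurable]: "m \<in> borel_measurable borel" "fourier m \<in> borel_measurable borel"
    by (intro smooth_measurable test_functions_smooth[OF m] fourier_smooth[OF m])+
  have ifm: "integrable lborel (fourier m)"
    by (intro decays_integrable fourier_decays[OF m]) simp
  define t where "t k = inverse (real (Suc k))" for k
  have t: "0 < t k" for k by (auto simp: t_def)
  have t0: "t \<longlonglongrightarrow> 0" unfolding t_def by (rule LIMSEQ_inverse_real_of_nat)
  have g0: "gauss (0 :: real^'n) = 1" by (simp add: gauss_def)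
  obtain C where C: "\<And>x. norm (m x) \<le> C" "C > 0"
  proof -
    obtain C where "C > 0" "\<And>x. norm (m x) * (1 + norm x) ^ 0 \<le> C" by (metis decaysE test_functions_decays[OF m])
    then show ?thesis by (intro that) auto
  qed
  let ?c = "complex_of_real (sqrt (2 * pi) ^ CARD('n))"
  have "(\<lambda>k. \<integral>x. exp (\<i> * complex_of_real (x \<bullet> \<xi>)) * fourier m x * complex_of_real (gauss (t k *\<^sub>R x)) \<partial>lborel)
      \<longlonglongrightarrow> (\<integral>x. exp (\<i> * complex_of_real (x \<bullet> \<xi>)) * fourier m x \<partial>lborel)"
  proof (rule integral_dominated_convergence[where w="\<lambda>x. norm (fourier m x)"])
    show "AE x in lborel. (\<lambda>k. exp (\<i> * complex_of_real (x \<bullet> \<xi>)) * fourier m x * complex_of_real (gauss (t k *\<^sub>R x)))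
        \<longlonglongrightarrow> exp (\<i> * complex_of_real (x \<bullet> \<xi>)) * fourier m x"
    proof (rule AE_I2)
      fix x :: "real^'n"
      have "(\<lambda>k. exp (- (norm (t k *\<^sub>R x))\<^sup>2 / 2)) \<longlonglongrightarrow> exp (- (norm (0 *\<^sub>R x))\<^sup>2 / 2)"
        by (intro tendsto_intros t0) simp
      then have *: "(\<lambda>k. gauss (t k *\<^sub>R x)) \<longlonglongrightarrow> 1" by (simp add: gauss_def)
      show "(\<lambda>k. exp (\<i> * complex_of_real (x \<bullet> \<xi>)) * fourier m x * complex_of_real (gauss (t k *\<^sub>R x)))
        \<longlonglongrightarrow> exp (\<i> * complex_of_real (x \<bullet> \<xi>)) * fourier m x"
        using tendsto_mult[OF tendsto_const tendsto_of_real[OF *]] by auto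
    qed
    show "AE x in lborel. norm (exp (\<i> * complex_of_real (x \<bullet> \<xi>)) * fourier m x * complex_of_real (gauss (t k *\<^sub>R x))) \<le> norm (fourier m x)" for k
    proof (rule AE_I2)
      fix x :: "real^'n"
      have "\<bar>gauss (t k *\<^sub>R x)\<bar> \<le> 1" using gauss_bounds[of "t k *\<^sub>R x"] by simp
      then show "norm (exp (\<i> * complex_of_real (x \<bullet> \<xi>)) * fourier m x * complex_of_real (gauss (t k *\<^sub>R x))) \<le> norm (fourier m x)"
        using mult_left_le[of "\<bar>gauss (t k *\<^sub>R x)\<bar>" "norm (fourier m x)"] by (simp add: norm_mult)
    qed
  qed (use integrable_norm[OF ifm] in auto)
  moreover have "(\<lambda>k. ?c * (\<integral>s. m (\<xi> + t k *\<^sub>R s) * complex_of_real (gauss s) \<partial>lborel))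
      \<longlonglongrightarrow> ?c * (\<integral>s. m \<xi> * complex_of_real (gauss (s :: real^'n)) \<partial>lborel)"
  proof (rule tendsto_mult[OF tendsto_const], rule integral_dominated_convergence[where w="\<lambda>s::real^'n. C * gauss s"])
    show "AE s in lborel. (\<lambda>k. m (\<xi> + t k *\<^sub>R s) * complex_of_real (gauss s)) \<longlonglongrightarrow> m \<xi> * complex_of_real (gauss s)"
    proof (rule AE_I2)
      fix s :: "real^'n"
      have "(\<lambda>k. \<xi> + t k *\<^sub>R s) \<longlonglongrightarrow> \<xi> + 0 *\<^sub>R s" by (intro tendsto_intros t0)
      moreover have "isCont m \<xi>"
        using smooth_continuous[OF test_functions_smooth[OF m]] by (simp add: continuous_on_eq_continuous_at)
      ultimately have "(\<lambda>k. m (\<xi> + t k *\<^sub>R s)) \<longlonglongrightarrow> m \<xi>" by (auto intro: isCont_tendsto_compose[of _ m])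
      then show "(\<lambda>k. m (\<xi> + t k *\<^sub>R s) * complex_of_real (gauss s)) \<longlonglongrightarrow> m \<xi> * complex_of_real (gauss s)"
        by (intro tendsto_intros)
    qed
    show "AE s in lborel. norm (m (\<xi> + t k *\<^sub>R s) * complex_of_real (gauss s)) \<le> C * gauss s" for k
      using C by (intro AE_I2) (simp add: norm_mult mult_right_mono)
  qed (use integrable_gauss(1) in auto)
  ultimately have "(\<integral>x. exp (\<i> * complex_of_real (x \<bullet> \<xi>)) * fourier m x \<partial>lborel) = ?c * (\<integral>s. m \<xi> * complex_of_real (gauss (s :: real^'n)) \<partial>lborel)"
    unfolding gaussian_regularised_inversion[OF m t] by (rule LIMSEQ_unique)
  also have "\<dots> = complex_of_real ((2 * pi) ^ CARD('n)) * m \<xi>"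
  proof -
    have "sqrt (2 * pi) ^ CARD('n) * sqrt (2 * pi) ^ CARD('n) = (2 * pi) ^ CARD('n)"
      by (simp only: power_mult_distrib[symmetric] real_sqrt_mult_self) simp
    then have c: "?c * ?c = complex_of_real ((2 * pi) ^ CARD('n))" by (simp only: of_real_mult[symmetric])
    have "?c * (\<integral>s. m \<xi> * complex_of_real (gauss (s :: real^'n)) \<partial>lborel) = (?c * ?c) * m \<xi>"
      by (simp only: integral_mult_right_zero integrable_gauss(2) mult_ac)
    then show ?thesis unfolding c .
  qed
  finally have *: "(\<integral>x. exp (\<i> * complex_of_real (x \<bullet> \<xi>)) * fourier m x \<partial>lborel) = complex_of_real ((2 * pi) ^ CARD('n)) * m \<xi>" .
  have "(\<integral>x. exp (\<i> * complex_of_real (x \<bullet> \<xi>)) * fourier m x \<partial>lborel)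
      = complex_of_real (\<bar>-1\<bar> ^ CARD('n)) * (\<integral>x. exp (\<i> * complex_of_real ((0 + (-1) *\<^sub>R x) \<bullet> \<xi>)) * fourier m (0 + (-1) *\<^sub>R x) \<partial>lborel)"
    by (rule integral_vec_affine) auto
  also have "\<dots> = complex_of_real ((2 * pi) ^ CARD('n)) * fourier (inverse_fourier m) \<xi>"
    unfolding fourier_def[of "inverse_fourier m"] inverse_fourier_def by simp
  finally show ?thesis using * by simp
qed

section \<open>Functions of moderate growth and their convolutions\<close>

text \<open>
  The exponent \<open>2 n\<close> makes the weight integrable and comparable to a product of Cauchy densities.
\<close>
definition slow :: "(real^'n::finite \<Rightarrow> complex) \<Rightarrow> bool" where
  "slow f \<longleftrightarrow> f \<in> borel_measurable borel \<and> integrable lborel (\<lambda>x. norm (f x) / (1 + norm x) ^ (2 * CARD('n)))"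

definition convolve :: "(real^'n::finite \<Rightarrow> complex) \<Rightarrow> (real^'n \<Rightarrow> complex) \<Rightarrow> real^'n \<Rightarrow> complex" where
  "convolve f k x = (\<integral>y. f y * k (x - y) \<partial>lborel)"

lemma slow_measurable [measurable_dest]: "slow f \<Longrightarrow> f \<in> borel_measurable borel"
  by (simp add: slow_def)

text \<open>
  Peetre's inequality, which moves polynomial weights from one argument of a convolution to the
  other.
\<close>
lemma peetre: "1 + norm y \<le> (1 + norm (x - y)) * (1 + norm (x :: 'a::real_normed_vector))"
proof -
  have "norm y \<le> norm (x - y) + norm x" by (metis add.commute norm_minus_commute norm_triangle_sub)
  moreover have "0 \<le> norm (x - y) * norm x" by simp
  moreover have "(1 + norm (x - y)) * (1 + norm x) = 1 + norm (x - y) + norm x + norm (x - y) * norm x"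
    by (simp add: algebra_simps)
  ultimately show ?thesis by linarith
qed

lemma weight_pos: "(0::real) < (1 + norm x) ^ M"
  by (simp add: add_pos_nonneg)

lemma weight_decays: "decays M (\<lambda>x. complex_of_real (1 / (1 + norm x) ^ M))"
proof (rule decaysI[of _ _ 1])
  fix x :: "real^'a"
  have "\<bar>1 / (1 + norm x) ^ M\<bar> = 1 / (1 + norm x) ^ M" using weight_pos[of x M] by simp
  then show "norm (complex_of_real (1 / (1 + norm x) ^ M)) * (1 + norm x) ^ M \<le> 1"
    unfolding norm_of_real using weight_pos[of x M] by simp
qed

lemma slow_mult_integrable:
  fixes f :: "real^'n::finite \<Rightarrow> complex"
  assumes f: "slow f" and \<phi>: "decays (2 * CARD('n)) \<phi>" "\<phi> \<in> borel_measurable borel"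
  shows "integrable lborel (\<lambda>x. f x * \<phi> x)"
proof -
  note [measurable] = slow_measurable[OF f] \<phi>(2)
  obtain C where C: "C > 0" "\<And>x. norm (\<phi> x) \<le> C / (1 + norm x) ^ (2 * CARD('n))" using \<phi>(1) by (metis decaysE)
  show ?thesis
  proof (rule Bochner_Integration.integrable_bound)
    show "integrable lborel (\<lambda>x. C * (norm (f x) / (1 + norm x) ^ (2 * CARD('n))))"
      using f by (intro integrable_mult_right) (simp add: slow_def)
    show "AE x in lborel. norm (f x * \<phi> x) \<le> norm (C * (norm (f x) / (1 + norm x) ^ (2 * CARD('n))))"
    proof (rule AE_I2)
      fix x
      have "norm (f x * \<phi> x) \<le> norm (f x) * (C / (1 + norm x) ^ (2 * CARD('n)))"
        unfolding norm_mult by (intro mult_left_mono C) auto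
      also have "\<dots> = C * (norm (f x) / (1 + norm x) ^ (2 * CARD('n)))" by simp
      also have "\<dots> \<le> norm \<dots>" unfolding real_norm_def by (rule abs_ge_self)
      finally show "norm (f x * \<phi> x) \<le> norm (C * (norm (f x) / (1 + norm x) ^ (2 * CARD('n))))" .
    qed
  qed measurable
qed

text \<open>
  Half of the decay of \<open>k\<close> is spent, by Peetre's inequality, on transporting the weight from \<open>x\<close> to
  \<open>y\<close>; the other half remains and makes the bound integrable in \<open>x\<close>.
\<close>
lemma convolution_kernel_estimate:
  fixes k \<psi> :: "real^'n::finite \<Rightarrow> complex"
  assumes k: "decays (4 * CARD('n)) k" and \<psi>: "decays (2 * CARD('n)) \<psi>"
  obtains C where "C > 0"
    "\<And>x y. norm (k (x - y) * \<psi> x) \<le> C * (1 / (1 + norm y) ^ (2 * CARD('n))) * (1 / (1 + norm (x - y)) ^ (2 * CARD('n)))"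
proof -
  let ?M = "2 * CARD('n)"
  obtain A where A: "A > 0" "\<And>x. norm (k x) * (1 + norm x) ^ (4 * CARD('n)) \<le> A" using k by (metis decaysE)
  obtain B where B: "B > 0" "\<And>x. norm (\<psi> x) * (1 + norm x) ^ ?M \<le> B" using \<psi> by (metis decaysE)
  show ?thesis
  proof (rule that[of "A * B"])
    fix x y :: "real^'n"
    let ?a = "(1 + norm (x - y)) ^ ?M" and ?b = "(1 + norm x) ^ ?M" and ?c = "(1 + norm y) ^ ?M"
    have pos: "0 < ?a" "0 < ?c" by (rule weight_pos)+
    have "?c \<le> ?a * ?b"
      using peetre[of y x] by (subst power_mult_distrib[symmetric]) (intro power_mono, auto)
    then have "norm (k (x - y) * \<psi> x) * (?c * ?a) \<le> norm (k (x - y) * \<psi> x) * ((?a * ?b) * ?a)"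
      using pos by (intro mult_left_mono mult_right_mono) auto
    also have "\<dots> = (norm (k (x - y)) * (?a * ?a)) * (norm (\<psi> x) * ?b)" by (simp add: norm_mult)
    also have "?a * ?a = (1 + norm (x - y)) ^ (4 * CARD('n))" by (simp flip: power_add)
    also have "(norm (k (x - y)) * (1 + norm (x - y)) ^ (4 * CARD('n))) * (norm (\<psi> x) * ?b) \<le> A * B"
      using A B by (intro mult_mono) (auto simp: less_imp_le)
    finally have "norm (k (x - y) * \<psi> x) \<le> A * B / (?c * ?a)"
      using pos by (simp add: pos_le_divide_eq)
    then show "norm (k (x - y) * \<psi> x) \<le> A * B * (1 / ?c) * (1 / ?a)" by simp
  qed (use A B in auto)
qed

lemma convolution_triple_finite:
  fixes f k \<psi> :: "real^'n::finite \<Rightarrow> complex"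
  assumes f: "slow f" and k: "decays (4 * CARD('n)) k" "k \<in> borel_measurable borel"
    and \<psi>: "decays (2 * CARD('n)) \<psi>" "\<psi> \<in> borel_measurable borel"
  shows "(\<integral>\<^sup>+x. \<integral>\<^sup>+y. ennreal (norm (f y * k (x - y) * \<psi> x)) \<partial>lborel \<partial>lborel) < \<infinity>"
proof -
  let ?M = "2 * CARD('n)"
  note [measurable] = slow_measurable[OF f] k(2) \<psi>(2)
  obtain C where C: "C > 0"
    "\<And>x y. norm (k (x - y) * \<psi> x) \<le> C * (1 / (1 + norm y) ^ ?M) * (1 / (1 + norm (x - y)) ^ ?M)"
    using convolution_kernel_estimate[OF k(1) \<psi>(1)] by metis
  define W where "W = (\<integral>\<^sup>+x. ennreal (1 / (1 + norm (x :: real^'n)) ^ ?M) \<partial>lborel)"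
  have W: "W < \<infinity>"
    using integrable_weight[where 'n='n] by (auto simp: W_def integrable_iff_bounded)
  have W': "(\<integral>\<^sup>+x. ennreal (1 / (1 + norm (x - y :: real^'n)) ^ ?M) \<partial>lborel) = W" for y
    using nn_integral_vec_affine[of "\<lambda>x :: real^'n. ennreal (1 / (1 + norm x) ^ ?M)" 1 "- y"] by (simp add: W_def)
  have "(\<integral>\<^sup>+x. \<integral>\<^sup>+y. ennreal (norm (f y * k (x - y) * \<psi> x)) \<partial>lborel \<partial>lborel)
      = (\<integral>\<^sup>+y. \<integral>\<^sup>+x. ennreal (norm (f y * k (x - y) * \<psi> x)) \<partial>lborel \<partial>lborel)"
    by (rule lborel_pair.Fubini') measurable
  also have "\<dots> \<le> (\<integral>\<^sup>+y. \<integral>\<^sup>+x. ennreal (norm (f y) * (C * (1 / (1 + norm y) ^ ?M))) * ennreal (1 / (1 + norm (x - y)) ^ ?M) \<partial>lborel \<partial>lborel)"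
  proof (intro nn_integral_mono)
    fix x y :: "real^'n"
    have "norm (f y * k (x - y) * \<psi> x) \<le> norm (f y) * (C * (1 / (1 + norm y) ^ ?M) * (1 / (1 + norm (x - y)) ^ ?M))"
      unfolding mult.assoc norm_mult[of "f y"] by (intro mult_left_mono C[unfolded mult.assoc]) auto
    then show "ennreal (norm (f y * k (x - y) * \<psi> x)) \<le> ennreal (norm (f y) * (C * (1 / (1 + norm y) ^ ?M))) * ennreal (1 / (1 + norm (x - y)) ^ ?M)"
      using C(1) by (subst ennreal_mult[symmetric]) (auto intro!: ennreal_leI simp: mult.assoc)
  qed
  also have "\<dots> = (\<integral>\<^sup>+y. ennreal (norm (f y) * (C * (1 / (1 + norm y) ^ ?M))) * W \<partial>lborel)"
    by (simp add: nn_integral_cmult W')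
  also have "\<dots> = (\<integral>\<^sup>+y. ennreal C * ennreal (norm (f y) / (1 + norm y) ^ ?M) \<partial>lborel) * W"
    using C(1) by (subst nn_integral_multc[symmetric]) (auto simp: ennreal_mult[symmetric] less_imp_le mult.commute)
  also have "\<dots> = ennreal C * (\<integral>\<^sup>+y. ennreal (norm (f y) / (1 + norm y) ^ ?M) \<partial>lborel) * W"
    by (subst nn_integral_cmult) auto
  also have "\<dots> < \<infinity>"
    using f W by (auto simp: slow_def integrable_iff_bounded ennreal_mult_less_top)
  finally show ?thesis .
qed

lemma
  fixes f k \<psi> :: "real^'n::finite \<Rightarrow> complex"
  assumes f: "slow f" and k: "decays (4 * CARD('n)) k" "k \<in> borel_measurable borel"
    and \<psi>: "decays (2 * CARD('n)) \<psi>" "\<psi> \<in> borel_measurable borel"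
  shows convolve_pairing: "(\<integral>x. convolve f k x * \<psi> x \<partial>lborel) = (\<integral>y. f y * (\<integral>x. k (x - y) * \<psi> x \<partial>lborel) \<partial>lborel)"
    and convolve_mult_integrable: "integrable lborel (\<lambda>x. convolve f k x * \<psi> x)"
proof -
  note [measurable] = slow_measurable[OF f] k(2) \<psi>(2)
  note fin = convolution_triple_finite[OF f k \<psi>]
  have m: "(\<lambda>(x, y). f y * k (x - y) * \<psi> x) \<in> borel_measurable (borel \<Otimes>\<^sub>M borel)" by measurable
  have e: "convolve f k x * \<psi> x = (\<integral>y. f y * k (x - y) * \<psi> x \<partial>lborel)" for x
    by (simp add: convolve_def)
  show "integrable lborel (\<lambda>x. convolve f k x * \<psi> x)"
    unfolding e by (rule lborel_integrable_inner[OF m fin])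
  show "(\<integral>x. convolve f k x * \<psi> x \<partial>lborel) = (\<integral>y. f y * (\<integral>x. k (x - y) * \<psi> x \<partial>lborel) \<partial>lborel)"
    unfolding e by (subst lborel_swap_integrals[OF m fin]) (simp add: mult.assoc)
qed

lemma convolve_measurable:
  assumes [measurable]: "f \<in> borel_measurable borel" "k \<in> borel_measurable borel"
  shows "convolve f k \<in> borel_measurable borel"
  unfolding convolve_def by measurable

lemma slow_convolve:
  fixes f k :: "real^'n::finite \<Rightarrow> complex"
  assumes f: "slow f" and k: "decays (4 * CARD('n)) k" "k \<in> borel_measurable borel"
  shows "slow (convolve f k)"
proof -
  let ?w = "\<lambda>x :: real^'n. complex_of_real (1 / (1 + norm x) ^ (2 * CARD('n)))"
  from convolve_mult_integrable[OF f k weight_decays]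
  have "integrable lborel (\<lambda>x. norm (convolve f k x * ?w x))" by (intro integrable_norm) auto
  then have "integrable lborel (\<lambda>x. norm (convolve f k x) / (1 + norm x) ^ (2 * CARD('n)))"
    by (simp only: norm_mult norm_of_real) simp
  then show ?thesis using convolve_measurable[OF slow_measurable[OF f] k(2)] by (simp add: slow_def)
qed

lemma decays_reflect: "decays M f \<Longrightarrow> decays M (\<lambda>x. f (- x))"
  unfolding decays_def by (metis norm_minus_cancel)

lemma
  fixes m :: "real^'n::finite \<Rightarrow> complex"
  assumes "m \<in> test_functions UNIV"
  shows inverse_fourier_decays: "decays M (inverse_fourier m)"
    and inverse_fourier_smooth: "smooth (inverse_fourier m)"
    and inverse_fourier_measurable: "inverse_fourier m \<in> borel_measurable borel"
proof -
  have e: "inverse_fourier m = (\<lambda>x. (1 / complex_of_real ((2 * pi) ^ CARD('n))) * fourier m ((-1) *\<^sub>R x + 0))"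
    by (auto simp: inverse_fourier_def)
  show "decays M (inverse_fourier m)"
    unfolding e
    by (rule decays_dominated[where k=0 and f="\<lambda>x. fourier m (- x)" and c="norm (1 / complex_of_real ((2 * pi) ^ CARD('n)))"])
      (use decays_reflect[OF fourier_decays[OF assms, of M]] in \<open>auto simp: norm_mult norm_divide\<close>)
  show "smooth (inverse_fourier m)"
    unfolding e by (intro smooth_cmult smooth_affine fourier_smooth assms)
  then show "inverse_fourier m \<in> borel_measurable borel" by (rule smooth_measurable)
qed

text \<open>
  This is the convolution theorem in the weak form in which it is needed: against Fourier
  transforms of test functions, convolution with \<open>inverse_fourier m\<close> acts as multiplication by \<open>m\<close>.
  By Fubini's theorem it is enough to compute the convolution of \<open>fourier \<theta>\<close> with the reflected kernel,
  and there \<open>m\<close> is written as \<open>fourier (inverse_fourier m)\<close>.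
\<close>
lemma convolve_fourier_multiplier:
  fixes f m \<theta> :: "real^'n::finite \<Rightarrow> complex"
  assumes f: "slow f" and m: "m \<in> test_functions UNIV" and \<theta>: "\<theta> \<in> test_functions UNIV"
  shows "(\<integral>x. convolve f (inverse_fourier m) x * fourier \<theta> x \<partial>lborel) = (\<integral>y. f y * fourier (\<lambda>\<xi>. m \<xi> * \<theta> \<xi>) y \<partial>lborel)"
proof -
  let ?k = "inverse_fourier m"
  note [measurable] = inverse_fourier_measurable[OF m] smooth_measurable[OF fourier_smooth[OF \<theta>]]
    smooth_measurable[OF test_functions_smooth[OF \<theta>]]
  have ik: "integrable lborel ?k" by (intro decays_integrable inverse_fourier_decays m) simp
  have i\<theta>: "integrable lborel \<theta>" by (rule test_functions_integrable[OF \<theta>])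
  have "(\<integral>x. ?k (x - y) * fourier \<theta> x \<partial>lborel) = fourier (\<lambda>\<xi>. m \<xi> * \<theta> \<xi>) y" for y
  proof -
    let ?f = "\<lambda>\<eta> x. exp (- \<i> * complex_of_real (\<eta> \<bullet> (x + y))) * \<theta> \<eta> * ?k x"
    have fin: "(\<integral>\<^sup>+\<eta>. \<integral>\<^sup>+x. ennreal (norm (?f \<eta> x)) \<partial>lborel \<partial>lborel) < \<infinity>"
    proof -
      have "(\<integral>\<^sup>+\<eta>. \<integral>\<^sup>+x. ennreal (norm (?f \<eta> x)) \<partial>lborel \<partial>lborel)
          = (\<integral>\<^sup>+\<eta>. \<integral>\<^sup>+x. ennreal (norm (\<theta> \<eta>)) * ennreal (norm (?k x)) \<partial>lborel \<partial>lborel)"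
        by (simp add: norm_mult ennreal_mult)
      also have "\<dots> = (\<integral>\<^sup>+\<eta>. ennreal (norm (\<theta> \<eta>)) \<partial>lborel) * (\<integral>\<^sup>+x. ennreal (norm (?k x)) \<partial>lborel)"
        by (simp add: nn_integral_cmult nn_integral_multc)
      also have "\<dots> < \<infinity>"
        using ik i\<theta> by (auto simp: integrable_iff_bounded ennreal_mult_less_top)
      finally show ?thesis .
    qed
    have e: "exp (- \<i> * complex_of_real (\<eta> \<bullet> (x + y))) = exp (- \<i> * complex_of_real (\<eta> \<bullet> y)) * exp (- \<i> * complex_of_real (x \<bullet> \<eta>))" for \<eta> x
      by (simp add: exp_add[symmetric] inner_add_right inner_commute distrib_left add.commute)
    have "fourier (\<lambda>\<xi>. m \<xi> * \<theta> \<xi>) y = (\<integral>\<eta>. exp (- \<i> * complex_of_real (\<eta> \<bullet> y)) * (fourier ?k \<eta> * \<theta> \<eta>) \<partial>lborel)"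
      unfolding fourier_inversion[OF m] by (simp only: fourier_def)
    also have "\<dots> = (\<integral>\<eta>. \<integral>x. ?f \<eta> x \<partial>lborel \<partial>lborel)"
    proof (rule Bochner_Integration.integral_cong[OF refl])
      fix \<eta>
      have "(\<integral>x. ?f \<eta> x \<partial>lborel) = (\<integral>x. (exp (- \<i> * complex_of_real (\<eta> \<bullet> y)) * \<theta> \<eta>) * (exp (- \<i> * complex_of_real (x \<bullet> \<eta>)) * ?k x) \<partial>lborel)"
        unfolding e by (simp only: mult_ac)
      also have "\<dots> = (exp (- \<i> * complex_of_real (\<eta> \<bullet> y)) * \<theta> \<eta>) * fourier ?k \<eta>"
        by (simp only: integral_mult_right_zero fourier_def)
      finally show "exp (- \<i> * complex_of_real (\<eta> \<bullet> y)) * (fourier ?k \<eta> * \<theta> \<eta>) = (\<integral>x. ?f \<eta> x \<partial>lborel)"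
        by (simp only: mult_ac)
    qed
    also have "\<dots> = (\<integral>x. \<integral>\<eta>. ?f \<eta> x \<partial>lborel \<partial>lborel)"
      by (rule lborel_swap_integrals[OF _ fin]) measurable
    also have "\<dots> = (\<integral>x. ?k (x + y - y) * fourier \<theta> (x + y) \<partial>lborel)"
      by (simp add: fourier_def mult.commute)
    also have "\<dots> = (\<integral>x. ?k (x - y) * fourier \<theta> x \<partial>lborel)"
      by (rule integral_lborel_shift(1)[of "\<lambda>x. ?k (x - y) * fourier \<theta> x"]) measurable
    finally show ?thesis by simp
  qed
  then show ?thesis
    by (subst convolve_pairing[OF f inverse_fourier_decays[OF m] _ fourier_decays[OF \<theta>]]) auto
qed

section \<open>Fourier transforms of test functions separate functions of moderate growth\<close>

lemma fourier_dilate: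
  fixes \<theta> :: "real^'n::finite \<Rightarrow> complex"
  assumes [measurable]: "\<theta> \<in> borel_measurable borel" and c: "c > 0"
  shows "complex_of_real (c ^ CARD('n)) * fourier (\<lambda>\<xi>. \<theta> (c *\<^sub>R \<xi>)) (c *\<^sub>R x) = fourier \<theta> x"
proof -
  have "fourier \<theta> x = complex_of_real (\<bar>c\<bar> ^ CARD('n)) *
      (\<integral>\<xi>. exp (- \<i> * complex_of_real ((0 + c *\<^sub>R \<xi>) \<bullet> x)) * \<theta> (0 + c *\<^sub>R \<xi>) \<partial>lborel)"
    unfolding fourier_def by (rule integral_vec_affine) (use c in auto)
  also have "\<dots> = complex_of_real (c ^ CARD('n)) * fourier (\<lambda>\<xi>. \<theta> (c *\<^sub>R \<xi>)) (c *\<^sub>R x)"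
    using c by (simp add: fourier_def)
  finally show ?thesis by simp
qed

lemma fourier_modulate:
  "fourier (\<lambda>\<xi>. exp (\<i> * complex_of_real (\<xi> \<bullet> y)) * \<theta> \<xi>) x = fourier \<theta> (x - y)"
proof -
  have e: "exp (- \<i> * complex_of_real (\<xi> \<bullet> (x - y))) = exp (- \<i> * complex_of_real (\<xi> \<bullet> x)) * exp (\<i> * complex_of_real (\<xi> \<bullet> y))" for \<xi>
    by (simp add: exp_add[symmetric] inner_diff_right right_diff_distrib)
  show ?thesis unfolding fourier_def e by (simp only: mult.assoc)
qed

text \<open>
  The Fourier transform \<open>\<kappa>\<close> of a suitable test function has integral 1, and all its dilations and
  translations are Fourier transforms of test functions too.  They form an approximate identity, so
  that the vanishing of the integrals carries over from them to \<open>\<phi>\<close>.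
\<close>
lemma fourier_test_separating:
  fixes v :: "real^'n::finite \<Rightarrow> complex"
  assumes v: "slow v" and 0: "\<And>\<theta>. \<theta> \<in> test_functions UNIV \<Longrightarrow> (\<integral>x. v x * fourier \<theta> x \<partial>lborel) = 0"
    and \<phi>: "continuous_on UNIV \<phi>" "decays (2 * CARD('n)) \<phi>"
  shows "(\<integral>x. v x * \<phi> x \<partial>lborel) = 0"
proof -
  let ?M = "2 * CARD('n)"
  obtain \<beta> :: "real^'n \<Rightarrow> real" where \<beta>: "smooth (\<lambda>x. complex_of_real (\<beta> x))"
    "\<And>x. norm (x - 0) \<le> 1 \<Longrightarrow> \<beta> x = 1" "\<And>x. 2 \<le> norm (x - 0) \<Longrightarrow> \<beta> x = 0" "\<And>x. 0 \<le> \<beta> x"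
    by (rule smooth_bump_exists[of 1 2 0]) auto
  let ?\<theta> = "\<lambda>x. complex_of_real (\<beta> x)"
  have \<theta>: "?\<theta> \<in> test_functions UNIV"
    by (rule test_functionsI[OF \<beta>(1), of 2]) (use \<beta>(3) in \<open>force simp: not_le[symmetric]\<close>)
  define \<kappa> where "\<kappa> x = inverse_fourier ?\<theta> (- x)" for x
  define K where "K = complex_of_real ((2 * pi) ^ CARD('n))"
  have K: "K \<noteq> 0" by (simp add: K_def)
  have \<kappa>_eq: "\<kappa> x = fourier ?\<theta> x / K" for x by (simp add: \<kappa>_def inverse_fourier_def K_def)
  have \<kappa>_dec: "decays M \<kappa>" for M
    unfolding \<kappa>_def by (intro decays_reflect inverse_fourier_decays \<theta>)
  have \<kappa>_cont: "continuous_on UNIV \<kappa>"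
    unfolding \<kappa>_eq by (intro continuous_intros smooth_continuous fourier_smooth \<theta>) (simp add: K)
  note [measurable] = borel_measurable_continuous_onI[OF \<kappa>_cont] borel_measurable_continuous_onI[OF \<phi>(1)] slow_measurable[OF v]
    smooth_measurable[OF \<beta>(1)]
  have \<kappa>_int: "(\<integral>x. \<kappa> x \<partial>lborel) = 1"
  proof -
    have "1 = fourier (inverse_fourier ?\<theta>) 0" unfolding fourier_inversion[OF \<theta>] using \<beta>(2)[of 0] by simp
    also have "\<dots> = (\<integral>x. inverse_fourier ?\<theta> x \<partial>lborel)" by (simp add: fourier_def)
    also have "\<dots> = complex_of_real (\<bar>-1\<bar> ^ CARD('n)) * (\<integral>x. inverse_fourier ?\<theta> (0 + (-1) *\<^sub>R x) \<partial>lborel)"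
      by (rule integral_vec_affine) (use inverse_fourier_measurable[OF \<theta>] in auto)
    finally show ?thesis by (simp add: \<kappa>_def[abs_def])
  qed
  obtain C where C: "C > 0" "\<And>x. norm (\<phi> x) * (1 + norm x) ^ ?M \<le> C" using \<phi>(2) by (metis decaysE)
  define \<Phi> where "\<Phi> e y = (\<integral>z. \<kappa> z * \<phi> (y - e *\<^sub>R z) \<partial>lborel)" for e y
  \<comment> \<open>Peetre's inequality: a bound with the decay of \<open>\<phi>\<close> in \<open>y\<close>, uniformly in the width \<open>e\<close>.\<close>
  have ptw: "norm (\<kappa> z * \<phi> (y - e *\<^sub>R z)) \<le> (C / (1 + norm y) ^ ?M) * (norm (\<kappa> z) * (1 + norm z) ^ ?M)"
    if "0 < e" "e \<le> 1" for e y z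
  proof -
    have "norm (e *\<^sub>R z) \<le> norm z" using that by (simp add: mult_left_le_one_le)
    then have n: "1 + norm (e *\<^sub>R z) \<le> 1 + norm z" by simp
    have "1 + norm y \<le> (1 + norm ((y - e *\<^sub>R z) - y)) * (1 + norm (y - e *\<^sub>R z))" by (rule peetre)
    also have "\<dots> = (1 + norm (e *\<^sub>R z)) * (1 + norm (y - e *\<^sub>R z))" by simp
    also have "\<dots> \<le> (1 + norm z) * (1 + norm (y - e *\<^sub>R z))"
      using n by (intro mult_right_mono) auto
    finally have "(1 + norm y) ^ ?M \<le> (1 + norm z) ^ ?M * (1 + norm (y - e *\<^sub>R z)) ^ ?M"
      by (subst power_mult_distrib[symmetric]) (intro power_mono, auto)
    then have "norm (\<phi> (y - e *\<^sub>R z)) * (1 + norm y) ^ ?M \<le> norm (\<phi> (y - e *\<^sub>R z)) * ((1 + norm z) ^ ?M * (1 + norm (y - e *\<^sub>R z)) ^ ?M)"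
      by (intro mult_left_mono) auto
    also have "\<dots> = (norm (\<phi> (y - e *\<^sub>R z)) * (1 + norm (y - e *\<^sub>R z)) ^ ?M) * (1 + norm z) ^ ?M" by simp
    also have "\<dots> \<le> C * (1 + norm z) ^ ?M" by (intro mult_right_mono C) auto
    finally have "norm (\<phi> (y - e *\<^sub>R z)) \<le> C * (1 + norm z) ^ ?M / (1 + norm y) ^ ?M"
      by (simp add: pos_le_divide_eq[OF weight_pos])
    then have "norm (\<kappa> z) * norm (\<phi> (y - e *\<^sub>R z)) \<le> norm (\<kappa> z) * (C * (1 + norm z) ^ ?M / (1 + norm y) ^ ?M)"
      by (intro mult_left_mono) auto
    then show ?thesis by (simp add: norm_mult mult_ac)
  qed
  define L where "L = (\<integral>z. norm (\<kappa> z) * (1 + norm z) ^ ?M \<partial>lborel)"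
  have iL: "integrable lborel (\<lambda>z. norm (\<kappa> z) * (1 + norm z) ^ ?M)"
  proof -
    have "integrable lborel (\<lambda>z. \<kappa> z * complex_of_real ((1 + norm z) ^ ?M))"
    proof (rule decays_integrable, rule decays_dominated[OF \<kappa>_dec[of "?M + ?M"]])
      show "norm (\<kappa> z * complex_of_real ((1 + norm z) ^ ?M)) \<le> 1 * (1 + norm z) ^ ?M * norm (\<kappa> z)" for z
        by (simp only: norm_mult norm_of_real abs_of_pos[OF weight_pos]) simp
    qed (simp, measurable)
    from integrable_norm[OF this] show ?thesis
      by (simp only: norm_mult norm_of_real abs_of_pos[OF weight_pos])
  qed
  have \<Phi>_bound: "norm (\<Phi> e y) \<le> C * L / (1 + norm y) ^ ?M" if "0 < e" "e \<le> 1" for e y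
  proof -
    have "norm (\<Phi> e y) \<le> (\<integral>z. norm (\<kappa> z * \<phi> (y - e *\<^sub>R z)) \<partial>lborel)"
      unfolding \<Phi>_def by (rule integral_norm_bound)
    also have "\<dots> \<le> (\<integral>z. (C / (1 + norm y) ^ ?M) * (norm (\<kappa> z) * (1 + norm z) ^ ?M) \<partial>lborel)"
    proof (rule integral_mono[OF _ _ ptw[OF that]])
      show 1: "integrable lborel (\<lambda>z. (C / (1 + norm y) ^ ?M) * (norm (\<kappa> z) * (1 + norm z) ^ ?M))"
        by (intro integrable_mult_right iL)
      show "integrable lborel (\<lambda>z. norm (\<kappa> z * \<phi> (y - e *\<^sub>R z)))"
      proof (rule Bochner_Integration.integrable_bound[OF 1])
        show "AE z in lborel. norm (norm (\<kappa> z * \<phi> (y - e *\<^sub>R z))) \<le> norm ((C / (1 + norm y) ^ ?M) * (norm (\<kappa> z) * (1 + norm z) ^ ?M))"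
          unfolding real_norm_def abs_norm_cancel by (intro AE_I2 order_trans[OF ptw[OF that] abs_ge_self])
      qed measurable
    qed
    finally show ?thesis by (simp add: L_def)
  qed
  \<comment> \<open>By Fubini the integral is one of \<open>\<phi>\<close> against pairings of \<open>v\<close> with translates of a dilated \<open>\<kappa>\<close>.\<close>
  have zero: "(\<integral>y. v y * \<Phi> e y \<partial>lborel) = 0" if e: "0 < e" "e \<le> 1" for e
  proof -
    define \<theta>' where "\<theta>' = (\<lambda>\<xi>. (1 / K) * ?\<theta> (e *\<^sub>R \<xi>))"
    have \<theta>': "\<theta>' \<in> test_functions UNIV"
      unfolding \<theta>'_def by (intro test_functions_cmult test_functions_scale \<theta> e)
    define \<kappa>' where "\<kappa>' = fourier \<theta>'"
    have \<kappa>': "complex_of_real (e ^ CARD('n)) * \<kappa>' (e *\<^sub>R z) = \<kappa> z" for z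
    proof -
      have *: "complex_of_real (e ^ CARD('n)) * fourier (\<lambda>\<xi>. ?\<theta> (e *\<^sub>R \<xi>)) (e *\<^sub>R z) = fourier ?\<theta> z"
        by (rule fourier_dilate) (use e in auto)
      show ?thesis
        unfolding \<kappa>'_def \<theta>'_def fourier_cmult \<kappa>_eq mult.left_commute[of _ "1 / K"] * by simp
    qed
    have [measurable]: "\<kappa>' \<in> borel_measurable borel"
      unfolding \<kappa>'_def by (intro smooth_measurable fourier_smooth \<theta>')
    have d: "decays M (\<lambda>z. \<kappa>' (- z))" for M unfolding \<kappa>'_def by (intro decays_reflect fourier_decays \<theta>')
    have c0: "convolve v (\<lambda>z. \<kappa>' (- z)) x = 0" for x
    proof -
      have "convolve v (\<lambda>z. \<kappa>' (- z)) x = (\<integral>y. v y * fourier (\<lambda>\<xi>. exp (\<i> * complex_of_real (\<xi> \<bullet> x)) * \<theta>' \<xi>) y \<partial>lborel)"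
        unfolding convolve_def fourier_modulate \<kappa>'_def by simp
      also have "\<dots> = 0" by (intro 0 test_functions_mult smooth_character \<theta>')
      finally show ?thesis .
    qed
    have "\<Phi> e y = (\<integral>x. \<kappa>' (- (x - y)) * \<phi> x \<partial>lborel)" for y
    proof -
      have "(\<integral>x. \<kappa>' (- (x - y)) * \<phi> x \<partial>lborel) = complex_of_real (\<bar>- e\<bar> ^ CARD('n)) *
          (\<integral>z. \<kappa>' (- ((y + (- e) *\<^sub>R z) - y)) * \<phi> (y + (- e) *\<^sub>R z) \<partial>lborel)"
        by (rule integral_vec_affine) (use e in auto)
      also have "\<dots> = (\<integral>z. (complex_of_real (e ^ CARD('n)) * \<kappa>' (e *\<^sub>R z)) * \<phi> (y - e *\<^sub>R z) \<partial>lborel)"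
        unfolding mult.assoc integral_mult_right_zero using e by simp
      also have "\<dots> = \<Phi> e y" unfolding \<kappa>' \<Phi>_def ..
      finally show ?thesis by simp
    qed
    then have "(\<integral>y. v y * \<Phi> e y \<partial>lborel) = (\<integral>x. convolve v (\<lambda>z. \<kappa>' (- z)) x * \<phi> x \<partial>lborel)"
      using convolve_pairing[OF v d _ \<phi>(2)] by simp
    also have "\<dots> = 0" unfolding c0 by simp
    finally show ?thesis .
  qed
  define t where "t k = inverse (real (Suc k))" for k
  have t: "0 < t k" "t k \<le> 1" for k by (auto simp: t_def field_simps)
  have t0: "t \<longlonglongrightarrow> 0" unfolding t_def by (rule LIMSEQ_inverse_real_of_nat)
  have \<Phi>_lim: "(\<lambda>k. \<Phi> (t k) y) \<longlonglongrightarrow> \<phi> y" for y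
  proof -
    have "(\<lambda>k. \<Phi> (t k) y) \<longlonglongrightarrow> (\<integral>z. \<kappa> z * \<phi> y \<partial>lborel)"
      unfolding \<Phi>_def
    proof (rule integral_dominated_convergence[where w="\<lambda>z. (C / (1 + norm y) ^ ?M) * (norm (\<kappa> z) * (1 + norm z) ^ ?M)"])
      show "AE z in lborel. (\<lambda>k. \<kappa> z * \<phi> (y - t k *\<^sub>R z)) \<longlonglongrightarrow> \<kappa> z * \<phi> y"
      proof (rule AE_I2)
        fix z
        have "(\<lambda>k. y - t k *\<^sub>R z) \<longlonglongrightarrow> y - 0 *\<^sub>R z" by (intro tendsto_intros t0)
        moreover have "isCont \<phi> y" using \<phi>(1) by (simp add: continuous_on_eq_continuous_at)
        ultimately have "(\<lambda>k. \<phi> (y - t k *\<^sub>R z)) \<longlonglongrightarrow> \<phi> y" by (auto intro: isCont_tendsto_compose[of _ \<phi>])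
        then show "(\<lambda>k. \<kappa> z * \<phi> (y - t k *\<^sub>R z)) \<longlonglongrightarrow> \<kappa> z * \<phi> y" by (intro tendsto_intros)
      qed
    qed (use ptw[OF t] iL in auto)
    then show ?thesis using \<kappa>_int by simp
  qed
  have "(\<lambda>k. \<integral>y. v y * \<Phi> (t k) y \<partial>lborel) \<longlonglongrightarrow> (\<integral>y. v y * \<phi> y \<partial>lborel)"
  proof (rule integral_dominated_convergence[where w="\<lambda>y. C * L * (norm (v y) / (1 + norm y) ^ ?M)"])
    show "integrable lborel (\<lambda>y. C * L * (norm (v y) / (1 + norm y) ^ ?M))"
      using v by (intro integrable_mult_right) (simp add: slow_def)
    show "AE y in lborel. (\<lambda>k. v y * \<Phi> (t k) y) \<longlonglongrightarrow> v y * \<phi> y"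
      by (intro AE_I2 tendsto_intros \<Phi>_lim)
    show "AE y in lborel. norm (v y * \<Phi> (t k) y) \<le> C * L * (norm (v y) / (1 + norm y) ^ ?M)" for k
    proof (rule AE_I2)
      fix y
      show "norm (v y * \<Phi> (t k) y) \<le> C * L * (norm (v y) / (1 + norm y) ^ ?M)"
        using mult_left_mono[OF \<Phi>_bound[OF t, of k y], of "norm (v y)"] by (simp add: norm_mult mult_ac)
    qed
    show "(\<lambda>y. v y * \<Phi> (t k) y) \<in> borel_measurable lborel" for k
      unfolding \<Phi>_def by measurable
  qed measurable
  then show ?thesis using zero[OF t] by (simp add: LIMSEQ_const_iff)
qed

text \<open>
  Continuous functions approximate the indicator functions of closed sets, and closed sets generate
  the Borel sets.  The weight turns \<open>v\<close> into an integrable function all of whose integrals over Borel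
  sets vanish.
\<close>
lemma slow_eq_0_AE:
  fixes v :: "real^'n::finite \<Rightarrow> complex"
  assumes v: "slow v" and 0: "\<And>\<theta>. \<theta> \<in> test_functions UNIV \<Longrightarrow> (\<integral>x. v x * fourier \<theta> x \<partial>lborel) = 0"
  shows "AE x in lborel. v x = 0"
proof -
  let ?M = "2 * CARD('n)"
  let ?w = "\<lambda>x :: real^'n. complex_of_real (1 / (1 + norm x) ^ ?M)"
  note [measurable] = slow_measurable[OF v]
  have wdec: "decays ?M ?w" by (rule weight_decays)
  have wcont: "continuous_on UNIV ?w"
    by (intro continuous_intros) (metis weight_pos less_irrefl)
  have ivw: "integrable lborel (\<lambda>x. v x * ?w x)"
    by (rule slow_mult_integrable[OF v wdec]) measurable
  have closed0: "(\<integral>x. indicator K x *\<^sub>R (v x * ?w x) \<partial>lborel) = 0" if K: "closed K" for K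
  proof (cases "K = {}")
    case False
    define cut where "cut k x = max 0 (1 - real k * infdist x K)" for k and x :: "real^'n"
    have cut: "0 \<le> cut k x" "cut k x \<le> 1" for k x by (auto simp: cut_def infdist_nonneg)
    have [measurable]: "cut k \<in> borel_measurable borel" for k
      unfolding cut_def by (intro borel_measurable_continuous_onI continuous_intros)
    have z: "(\<integral>x. v x * (complex_of_real (cut k x) * ?w x) \<partial>lborel) = 0" for k
    proof (rule fourier_test_separating[OF v 0])
      show "continuous_on UNIV (\<lambda>x. complex_of_real (cut k x) * ?w x)"
        unfolding cut_def by (intro continuous_on_mult wcont) (intro continuous_intros)
      show "decays ?M (\<lambda>x. complex_of_real (cut k x) * ?w x)"
        by (rule decays_dominated[where k=0 and c=1 and f="?w"])
          (use wdec cut in \<open>auto simp: norm_mult simp del: of_real_divide intro!: divide_right_mono\<close>)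
    qed
    have "(\<lambda>k. \<integral>x. v x * (complex_of_real (cut k x) * ?w x) \<partial>lborel) \<longlonglongrightarrow> (\<integral>x. indicator K x *\<^sub>R (v x * ?w x) \<partial>lborel)"
    proof (rule integral_dominated_convergence[where w="\<lambda>x. norm (v x * ?w x)"])
      show "AE x in lborel. (\<lambda>k. v x * (complex_of_real (cut k x) * ?w x)) \<longlonglongrightarrow> indicator K x *\<^sub>R (v x * ?w x)"
      proof (rule AE_I2)
        fix x
        have "(\<lambda>k. cut k x) \<longlonglongrightarrow> indicator K x"
        proof (cases "x \<in> K")
          case True
          then show ?thesis by (simp add: cut_def)
        next
          case False
          then have d: "infdist x K > 0"
            using K \<open>K \<noteq> {}\<close> by (metis in_closed_iff_infdist_zero infdist_nonneg order_le_less)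
          obtain N where N: "1 / infdist x K < real N" using reals_Archimedean2 by blast
          have "cut k x = 0" if "k \<ge> N" for k
          proof -
            have "1 < real N * infdist x K" using N d by (simp add: field_simps)
            also have "\<dots> \<le> real k * infdist x K" using that d by (intro mult_right_mono) auto
            finally show ?thesis by (simp add: cut_def)
          qed
          then have "eventually (\<lambda>k. cut k x = 0) sequentially" by (auto simp: eventually_sequentially)
          then show ?thesis using False by (simp add: tendsto_eventually)
        qed
        then have "(\<lambda>k. cut k x *\<^sub>R (v x * ?w x)) \<longlonglongrightarrow> indicator K x *\<^sub>R (v x * ?w x)" by (intro tendsto_intros)
        then show "(\<lambda>k. v x * (complex_of_real (cut k x) * ?w x)) \<longlonglongrightarrow> indicator K x *\<^sub>R (v x * ?w x)"
          by (simp add: scaleR_conv_of_real mult_ac)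
      qed
      show "AE x in lborel. norm (v x * (complex_of_real (cut k x) * ?w x)) \<le> norm (v x * ?w x)" for k
      proof (rule AE_I2)
        fix x
        have "norm (v x * (complex_of_real (cut k x) * ?w x)) = cut k x * norm (v x * ?w x)"
          unfolding norm_mult norm_of_real using cut(1)[of k x] by simp
        also have "\<dots> \<le> norm (v x * ?w x)" using cut[of k x] by (intro mult_left_le_one_le) auto
        finally show "norm (v x * (complex_of_real (cut k x) * ?w x)) \<le> norm (v x * ?w x)" .
      qed
      show "(\<lambda>x. indicator K x *\<^sub>R (v x * ?w x)) \<in> borel_measurable lborel"
        using borel_closed[OF K] by measurable
      show "(\<lambda>x. v x * (complex_of_real (cut k x) * ?w x)) \<in> borel_measurable lborel" for k
        by measurable
      show "integrable lborel (\<lambda>x. norm (v x * ?w x))" by (rule integrable_norm[OF ivw])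
    qed
    then show ?thesis using z by (simp add: LIMSEQ_const_iff)
  qed simp
  have "set_lebesgue_integral lborel A (\<lambda>x. v x * ?w x) = 0" if "A \<in> sets lborel" for A
  proof -
    have A: "A \<in> sigma_sets UNIV (Collect closed)" using that by (simp add: borel_eq_closed)
    have st: "Int_stable (Collect (closed :: (real^'n) set \<Rightarrow> bool))" "Collect closed \<subseteq> Pow (UNIV :: (real^'n) set)"
      by (auto simp: Int_stable_def)
    from st A show ?thesis
    proof (induction rule: sigma_sets_induct_disjoint)
      case (basic A) then show ?case using closed0 by (simp add: set_lebesgue_integral_def)
    next
      case empty show ?case by (simp add: set_lebesgue_integral_def)
    next
      case (compl A)
      have A: "A \<in> sets lborel" using compl by (simp add: borel_eq_closed)
      have "(\<integral>x. v x * ?w x \<partial>lborel) = 0" using closed0[of UNIV] by simp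
      moreover have "set_lebesgue_integral lborel (UNIV - A) (\<lambda>x. v x * ?w x)
          = set_lebesgue_integral lborel UNIV (\<lambda>x. v x * ?w x) - set_lebesgue_integral lborel A (\<lambda>x. v x * ?w x)"
      proof -
        have "set_lebesgue_integral lborel (UNIV - A) (\<lambda>x. v x * ?w x) = (\<integral>x. v x * ?w x - indicator A x *\<^sub>R (v x * ?w x) \<partial>lborel)"
          unfolding set_lebesgue_integral_def by (intro Bochner_Integration.integral_cong) (auto simp: indicator_def)
        also have "\<dots> = (\<integral>x. v x * ?w x \<partial>lborel) - (\<integral>x. indicator A x *\<^sub>R (v x * ?w x) \<partial>lborel)"
          by (intro Bochner_Integration.integral_diff ivw integrable_mult_indicator A)
        finally show ?thesis by (simp add: set_lebesgue_integral_def)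
      qed
      ultimately show ?case using compl by (simp add: set_lebesgue_integral_def)
    next
      case (union A)
      have A: "A i \<in> sets lborel" for i using union by (auto simp: borel_eq_closed)
      have "set_lebesgue_integral lborel (\<Union>i. A i) (\<lambda>x. v x * ?w x) = (\<Sum>i. set_lebesgue_integral lborel (A i) (\<lambda>x. v x * ?w x))"
      proof (rule lebesgue_integral_countable_add)
        show "A i \<inter> A j = {}" if "i \<noteq> j" for i j using union(1) that by (auto simp: disjoint_family_on_def)
        show "set_integrable lborel (\<Union>i. A i) (\<lambda>x. v x * ?w x)"
          unfolding set_integrable_def using A by (intro integrable_mult_indicator ivw) auto
      qed (use A in auto)
      then show ?case using union by simp
    qed
  qed
  from sigma_finite_measure.density_zero[OF sigma_finite_lborel ivw this]
  have "AE x in lborel. v x * ?w x = 0" .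
  then show ?thesis
  proof eventually_elim
    case (elim x)
    have "1 / (1 + norm x) ^ ?M \<noteq> 0" using weight_pos[of x ?M] by (metis divide_eq_0_iff less_irrefl zero_neq_one)
    then have "?w x \<noteq> 0" by (simp only: of_real_eq_0_iff not_False_eq_True)
    with elim show ?case by simp
  qed
qed

section \<open>The spectrum\<close>

abbreviation spectrum :: "(real^'n::{finite,linorder} \<Rightarrow> complex) \<Rightarrow> (real^'n::_) set" where
  "spectrum u \<equiv> distr_supp (distr_fourier (distr_of u))"

lemma spectrum_iff: "\<xi> \<in> spectrum u \<longleftrightarrow>
    (\<forall>U. open U \<and> \<xi> \<in> U \<longrightarrow> (\<exists>\<phi>\<in>test_functions U. (\<integral>x. u x * fourier \<phi> x \<partial>lborel) \<noteq> 0))"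
  by (simp add: distr_supp_def distr_fourier_def distr_of_def)

lemma slow_fourier_integrable:
  fixes u :: "real^'n::finite \<Rightarrow> complex"
  assumes "slow u" "\<theta> \<in> test_functions UNIV"
  shows "integrable lborel (\<lambda>x. u x * fourier \<theta> x)"
  by (intro slow_mult_integrable fourier_decays smooth_measurable fourier_smooth assms)

text \<open>
  Every point of the support of \<open>\<theta>\<close> has a ball such that the pairing vanishes for all test functions
  supported in it.  Finitely many of the concentric balls of half the radius cover the support.
  One ball after the other, \<open>\<theta>\<close> is multiplied by 1 minus a bump of the ball: this does not change the
  pairing, and after the last ball nothing is left of \<open>\<theta>\<close>.
\<close>
lemma spectrum_vanish:
  fixes u :: "real^'n::{finite,linorder} \<Rightarrow> complex"
  assumes u: "slow u" and \<theta>: "\<theta> \<in> test_functions UNIV"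
    and disj: "closure {x. \<theta> x \<noteq> 0} \<inter> spectrum u = {}"
  shows "(\<integral>x. u x * fourier \<theta> x \<partial>lborel) = 0"
proof -
  let ?T = "\<lambda>\<theta>. \<integral>x. u x * fourier \<theta> x \<partial>lborel"
  let ?K = "closure {x. \<theta> x \<noteq> 0}"
  have "\<exists>r>0. \<forall>\<phi>. smooth \<phi> \<and> {x. \<phi> x \<noteq> 0} \<subseteq> cball \<xi> (2 * r) \<longrightarrow> ?T \<phi> = 0" if "\<xi> \<in> ?K" for \<xi>
  proof -
    have "\<xi> \<notin> spectrum u" using that disj by auto
    then obtain U where U: "open U" "\<xi> \<in> U" "\<And>\<phi>. \<phi> \<in> test_functions U \<Longrightarrow> ?T \<phi> = 0"
      unfolding spectrum_iff by auto
    obtain s where s: "s > 0" "cball \<xi> s \<subseteq> U" using U(1,2) by (auto simp: open_contains_cball)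
    have "?T \<phi> = 0" if "smooth \<phi>" "{x. \<phi> x \<noteq> 0} \<subseteq> cball \<xi> s" for \<phi>
    proof -
      have c: "closure {x. \<phi> x \<noteq> 0} \<subseteq> cball \<xi> s" using that(2) by (simp add: closure_minimal)
      then have "compact (closure {x. \<phi> x \<noteq> 0})"
        using bounded_subset[OF bounded_cball c] by (simp add: compact_eq_bounded_closed)
      with c s that(1) have "\<phi> \<in> test_functions U" by (auto simp: test_functions_def)
      then show ?thesis by (rule U(3))
    qed
    note s' = this
    show ?thesis
    proof (intro exI[of _ "s / 2"] conjI allI impI)
      show "0 < s / 2" using s(1) by simp
      fix \<phi> :: "real^'n::_ \<Rightarrow> complex" assume "smooth \<phi> \<and> {x. \<phi> x \<noteq> 0} \<subseteq> cball \<xi> (2 * (s / 2))"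
      then have "smooth \<phi>" "{x. \<phi> x \<noteq> 0} \<subseteq> cball \<xi> s" by auto
      then show "?T \<phi> = 0" by (rule s')
    qed
  qed
  then have "\<forall>\<xi>\<in>?K. \<exists>r. r > 0 \<and> (\<forall>\<phi>. smooth \<phi> \<and> {x. \<phi> x \<noteq> 0} \<subseteq> cball \<xi> (2 * r) \<longrightarrow> ?T \<phi> = 0)" by blast
  from bchoice[OF this] obtain r where r': "\<forall>\<xi>\<in>?K. r \<xi> > 0 \<and> (\<forall>\<phi>. smooth \<phi> \<and> {x. \<phi> x \<noteq> 0} \<subseteq> cball \<xi> (2 * r \<xi>) \<longrightarrow> ?T \<phi> = 0)" ..
  have r: "\<And>\<xi>. \<xi> \<in> ?K \<Longrightarrow> r \<xi> > 0"
    "\<And>\<xi> \<phi>. \<xi> \<in> ?K \<Longrightarrow> smooth \<phi> \<Longrightarrow> {x. \<phi> x \<noteq> 0} \<subseteq> cball \<xi> (2 * r \<xi>) \<Longrightarrow> ?T \<phi> = 0"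
    using r' by blast+
  have "compact ?K" using \<theta> by (simp add: test_functions_def)
  then obtain F where F: "F \<subseteq> ?K" "finite F" "?K \<subseteq> (\<Union>\<xi>\<in>F. ball \<xi> (r \<xi>))"
  proof (rule compactE_image[where C="?K" and f="\<lambda>\<xi>. ball \<xi> (r \<xi>)"])
    show "?K \<subseteq> (\<Union>\<xi>\<in>?K. ball \<xi> (r \<xi>))" using r(1) by force
  qed auto
  have vanish: "?T \<psi> = 0" if "finite F" "F \<subseteq> ?K" "\<psi> \<in> test_functions UNIV" "{x. \<psi> x \<noteq> 0} \<subseteq> (\<Union>\<xi>\<in>F. ball \<xi> (r \<xi>))" for F \<psi>
    using that
  proof (induction F arbitrary: \<psi> rule: finite_induct)
    case empty
    then have "\<psi> = (\<lambda>x. 0)" by auto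
    then show ?case by (simp add: fourier_def)
  next
    case (insert \<xi> F)
    have \<xi>: "\<xi> \<in> ?K" using insert by auto
    obtain \<beta> :: "real^'n::_ \<Rightarrow> real" where \<beta>: "smooth (\<lambda>x. complex_of_real (\<beta> x))"
      "\<And>x. norm (x - \<xi>) \<le> r \<xi> \<Longrightarrow> \<beta> x = 1" "\<And>x. 2 * r \<xi> \<le> norm (x - \<xi>) \<Longrightarrow> \<beta> x = 0"
      by (rule smooth_bump_exists[of "r \<xi>" "2 * r \<xi>" \<xi>]) (use r(1)[OF \<xi>] in auto)
    let ?b = "\<lambda>x. complex_of_real (\<beta> x)"
    have s1: "(\<lambda>x. ?b x * \<psi> x) \<in> test_functions UNIV" 
      by (intro test_functions_mult \<beta> insert.prems)
    have s2: "(\<lambda>x. (1 - ?b x) * \<psi> x) \<in> test_functions UNIV"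
      by (intro test_functions_mult smooth_diff smooth_const \<beta> insert.prems)
    have 1: "?T (\<lambda>x. ?b x * \<psi> x) = 0"
    proof (rule r(2)[OF \<xi>])
      show "smooth (\<lambda>x. ?b x * \<psi> x)" by (rule test_functions_smooth[OF s1])
      show "{x. ?b x * \<psi> x \<noteq> 0} \<subseteq> cball \<xi> (2 * r \<xi>)"
        using \<beta>(3) by (force simp: dist_norm norm_minus_commute)
    qed
    have 2: "?T (\<lambda>x. (1 - ?b x) * \<psi> x) = 0"
    proof (rule insert.IH)
      show "{x. (1 - ?b x) * \<psi> x \<noteq> 0} \<subseteq> (\<Union>\<xi>\<in>F. ball \<xi> (r \<xi>))"
      proof
        fix x assume x: "x \<in> {x. (1 - ?b x) * \<psi> x \<noteq> 0}"
        then have "x \<in> (\<Union>\<xi>\<in>insert \<xi> F. ball \<xi> (r \<xi>))" using insert.prems(3) by auto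
        moreover have "x \<notin> ball \<xi> (r \<xi>)" using x \<beta>(2)[of x] by (auto simp: dist_norm norm_minus_commute)
        ultimately show "x \<in> (\<Union>\<xi>\<in>F. ball \<xi> (r \<xi>))" by auto
      qed
    qed (use insert s2 in auto)
    have "fourier \<psi> = (\<lambda>x. fourier (\<lambda>x. ?b x * \<psi> x) x + fourier (\<lambda>x. (1 - ?b x) * \<psi> x) x)"
      by (subst fourier_add[symmetric, OF test_functions_integrable[OF s1] test_functions_integrable[OF s2]])
        (simp add: algebra_simps)
    then have "?T \<psi> = (\<integral>x. u x * fourier (\<lambda>x. ?b x * \<psi> x) x + u x * fourier (\<lambda>x. (1 - ?b x) * \<psi> x) x \<partial>lborel)"
      by (simp add: distrib_left)
    also have "\<dots> = ?T (\<lambda>x. ?b x * \<psi> x) + ?T (\<lambda>x. (1 - ?b x) * \<psi> x)"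
      by (intro Bochner_Integration.integral_add slow_fourier_integrable u s1 s2)
    finally show ?case using 1 2 by simp
  qed
  show ?thesis
    by (rule vanish[OF F(2,1) \<theta>]) (use F(3) closure_subset[of "{x. \<theta> x \<noteq> 0}"] in auto)
qed

text \<open>
  The difference of the two test functions is \<open>(1 - m) \<theta>\<close>, whose support avoids the spectrum.
\<close>
lemma spectral_multiplier_1:
  fixes u :: "real^'n::{finite,linorder} \<Rightarrow> complex"
  assumes u: "slow u" and m: "smooth m" and V: "open V" "spectrum u \<subseteq> V" "\<And>\<xi>. \<xi> \<in> V \<Longrightarrow> m \<xi> = 1"
    and \<theta>: "\<theta> \<in> test_functions UNIV"
  shows "(\<integral>x. u x * fourier (\<lambda>\<xi>. m \<xi> * \<theta> \<xi>) x \<partial>lborel) = (\<integral>x. u x * fourier \<theta> x \<partial>lborel)"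
proof -
  let ?\<eta> = "\<lambda>\<xi>. (1 - m \<xi>) * \<theta> \<xi>"
  have t1: "?\<eta> \<in> test_functions UNIV" by (intro test_functions_mult smooth_diff smooth_const m \<theta>)
  have t2: "(\<lambda>\<xi>. m \<xi> * \<theta> \<xi>) \<in> test_functions UNIV" by (intro test_functions_mult m \<theta>)
  have "{\<xi>. ?\<eta> \<xi> \<noteq> 0} \<subseteq> - V" using V(3) by auto
  then have "closure {\<xi>. ?\<eta> \<xi> \<noteq> 0} \<subseteq> - V" using V(1) by (intro closure_minimal) auto
  then have 0: "(\<integral>x. u x * fourier ?\<eta> x \<partial>lborel) = 0"
    using V(2) by (intro spectrum_vanish[OF u t1]) auto
  have "fourier \<theta> = (\<lambda>x. fourier (\<lambda>\<xi>. m \<xi> * \<theta> \<xi>) x + fourier ?\<eta> x)"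
    by (subst fourier_add[symmetric, OF test_functions_integrable[OF t2] test_functions_integrable[OF t1]])
      (simp add: algebra_simps)
  then have "(\<integral>x. u x * fourier \<theta> x \<partial>lborel) = (\<integral>x. u x * fourier (\<lambda>\<xi>. m \<xi> * \<theta> \<xi>) x + u x * fourier ?\<eta> x \<partial>lborel)"
    by (simp add: distrib_left)
  also have "\<dots> = (\<integral>x. u x * fourier (\<lambda>\<xi>. m \<xi> * \<theta> \<xi>) x \<partial>lborel) + (\<integral>x. u x * fourier ?\<eta> x \<partial>lborel)"
    by (intro Bochner_Integration.integral_add slow_fourier_integrable u t1 t2)
  finally show ?thesis using 0 by simp
qed

lemma slow_diff:
  assumes "slow f" "slow g" shows "slow (\<lambda>x. f x - g x)"
proof -
  note [measurable] = slow_measurable[OF assms(1)] slow_measurable[OF assms(2)]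
  have "integrable lborel (\<lambda>x. norm (f x - g x) / (1 + norm x) ^ (2 * CARD('a)))"
  proof (rule Bochner_Integration.integrable_bound)
    show "integrable lborel (\<lambda>x. norm (f x) / (1 + norm x) ^ (2 * CARD('a)) + norm (g x) / (1 + norm x) ^ (2 * CARD('a)))"
      by (rule Bochner_Integration.integrable_add[OF assms(1)[unfolded slow_def, THEN conjunct2] assms(2)[unfolded slow_def, THEN conjunct2]])
    show "AE x in lborel. norm (norm (f x - g x) / (1 + norm x) ^ (2 * CARD('a)))
        \<le> norm (norm (f x) / (1 + norm x) ^ (2 * CARD('a)) + norm (g x) / (1 + norm x) ^ (2 * CARD('a)))"
    proof (rule AE_I2)
      fix x :: "real^'a"
      have p: "0 \<le> (1 + norm x) ^ (2 * CARD('a))" using weight_pos[of x] by (rule less_imp_le)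
      have "norm (f x - g x) / (1 + norm x) ^ (2 * CARD('a)) \<le> (norm (f x) + norm (g x)) / (1 + norm x) ^ (2 * CARD('a))"
        by (rule divide_right_mono[OF norm_triangle_ineq4 p])
      also have "\<dots> = norm (f x) / (1 + norm x) ^ (2 * CARD('a)) + norm (g x) / (1 + norm x) ^ (2 * CARD('a))"
        by (rule add_divide_distrib)
      finally have "norm (f x - g x) / (1 + norm x) ^ (2 * CARD('a)) \<le> norm (f x) / (1 + norm x) ^ (2 * CARD('a)) + norm (g x) / (1 + norm x) ^ (2 * CARD('a))" .
      moreover have "0 \<le> norm (f x - g x) / (1 + norm x) ^ (2 * CARD('a))" using p by (intro divide_nonneg_nonneg) auto
      ultimately show "norm (norm (f x - g x) / (1 + norm x) ^ (2 * CARD('a)))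
        \<le> norm (norm (f x) / (1 + norm x) ^ (2 * CARD('a)) + norm (g x) / (1 + norm x) ^ (2 * CARD('a)))"
        unfolding real_norm_def by linarith
    qed
  qed measurable
  then show ?thesis by (simp add: slow_def)
qed

lemma slow_0: "slow (\<lambda>x. 0)" by (simp add: slow_def)

lemma slow_uminus: "slow f \<Longrightarrow> slow (\<lambda>x. - f x)" by (auto simp: slow_def)

lemma slow_add: "slow f \<Longrightarrow> slow g \<Longrightarrow> slow (\<lambda>x. f x + g x)"
  using slow_diff[of f "\<lambda>x. - g x"] slow_uminus[of g] by simp

lemma slow_sum: "(\<And>i. i \<in> I \<Longrightarrow> slow (f i)) \<Longrightarrow> slow (\<lambda>x. \<Sum>i\<in>I. f i x)"
  by (induction I rule: infinite_finite_induct) (auto simp: slow_0 slow_add)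

lemma slow_eq_AE:
  fixes f g :: "real^'n::finite \<Rightarrow> complex"
  assumes f: "slow f" and g: "slow g"
    and eq: "\<And>\<theta>. \<theta> \<in> test_functions UNIV \<Longrightarrow> (\<integral>x. f x * fourier \<theta> x \<partial>lborel) = (\<integral>x. g x * fourier \<theta> x \<partial>lborel)"
  shows "AE x in lborel. f x = g x"
proof -
  have "AE x in lborel. f x - g x = 0"
  proof (rule slow_eq_0_AE[OF slow_diff[OF f g]])
    fix \<theta> :: "real^'n::_ \<Rightarrow> complex" assume \<theta>: "\<theta> \<in> test_functions UNIV"
    show "(\<integral>x. (f x - g x) * fourier \<theta> x \<partial>lborel) = 0"
      unfolding left_diff_distrib
      by (subst Bochner_Integration.integral_diff) (auto intro: slow_fourier_integrable f g \<theta> simp: eq[OF \<theta>])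
  qed
  then show ?thesis by eventually_elim simp
qed

text \<open>The function \<open>g\<close> is the derivative of \<open>f\<close> in the sense of tempered distributions.\<close>
definition weak_partial :: "'n::{finite,linorder} \<Rightarrow> (real^'n::_ \<Rightarrow> complex) \<Rightarrow> (real^'n::_ \<Rightarrow> complex) \<Rightarrow> bool" where
  "weak_partial j f g \<longleftrightarrow> (\<forall>\<phi>\<in>schwartz. (\<integral>x. g x * \<phi> x \<partial>lborel) = - (\<integral>x. f x * partial j \<phi> x \<partial>lborel))"

lemma spectrum_reproduce:
  fixes u :: "real^'n::{finite,linorder} \<Rightarrow> complex"
  assumes u: "slow u" and m: "m \<in> test_functions UNIV" and V: "open V" "spectrum u \<subseteq> V" "\<And>\<xi>. \<xi> \<in> V \<Longrightarrow> m \<xi> = 1"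
  shows "AE x in lborel. u x = convolve u (inverse_fourier m) x"
proof (rule slow_eq_AE[OF u slow_convolve[OF u inverse_fourier_decays[OF m] inverse_fourier_measurable[OF m]]])
  fix \<theta> :: "real^'n::_ \<Rightarrow> complex" assume \<theta>: "\<theta> \<in> test_functions UNIV"
  show "(\<integral>x. u x * fourier \<theta> x \<partial>lborel) = (\<integral>x. convolve u (inverse_fourier m) x * fourier \<theta> x \<partial>lborel)"
    unfolding convolve_fourier_multiplier[OF u m \<theta>]
    by (rule spectral_multiplier_1[symmetric, OF u test_functions_smooth[OF m] V \<theta>])
qed

lemma schwartz_measurable: "\<phi> \<in> schwartz \<Longrightarrow> \<phi> \<in> borel_measurable borel"
  by (intro smooth_measurable schwartz_smooth)

lemma partial_inverse_fourier:
  fixes m :: "real^'n::finite \<Rightarrow> complex"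
  assumes m: "m \<in> test_functions UNIV"
  shows "partial j (inverse_fourier m) = inverse_fourier (\<lambda>\<xi>. \<i> * complex_of_real (\<xi> $ j) * m \<xi>)"
proof (rule ext)
  fix x
  let ?c = "complex_of_real ((2 * pi) ^ CARD('n))"
  have f: "(fourier m has_derivative frechet_derivative (fourier m) (at (- x))) (at (- x))"
    using fourier_differentiable(1)[OF m] by (simp add: frechet_derivative_works)
  interpret bounded_linear "frechet_derivative (fourier m) (at (- x))" using f by (rule has_derivative_bounded_linear)
  have "((\<lambda>x. fourier m (- x)) has_derivative (\<lambda>h. frechet_derivative (fourier m) (at (- x)) (- h))) (at x)"
    using diff_chain_at[of uminus uminus x "fourier m"] f by (simp add: o_def has_derivative_minus)
  then have "((\<lambda>x. fourier m (- x) * inverse ?c) has_derivative (\<lambda>h. frechet_derivative (fourier m) (at (- x)) (- h) * inverse ?c)) (at x)"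
    by (rule has_derivative_mult_left)
  then have "partial j (\<lambda>x. fourier m (- x) * inverse ?c) x = - (frechet_derivative (fourier m) (at (- x)) (axis j 1)) * inverse ?c"
    using has_derivative_imp_partial(2) by (fastforce simp: neg)
  also have "frechet_derivative (fourier m) (at (- x)) (axis j 1) = partial j (fourier m) (- x)"
    by (rule has_derivative_imp_partial(2)[OF f, symmetric])
  also have "\<dots> = - fourier (\<lambda>\<xi>. \<i> * complex_of_real (\<xi> $ j) * m \<xi>) (- x)"
    unfolding fourier_differentiable(2)[OF m] by (simp add: fourier_def)
  finally show "partial j (inverse_fourier m) x = inverse_fourier (\<lambda>\<xi>. \<i> * complex_of_real (\<xi> $ j) * m \<xi>) x"
    by (simp add: inverse_fourier_def[abs_def] divide_inverse)
qed

text \<open>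
  The decay of the product and of its derivative makes the boundary terms vanish.
\<close>
lemma schwartz_integral_by_parts:
  fixes k \<phi> :: "real^'n::{finite,linorder} \<Rightarrow> complex"
  assumes k: "smooth k" "\<And>M. decays M k" "\<And>M. decays M (partial j k)" and \<phi>: "\<phi> \<in> schwartz"
  shows "(\<integral>x. k (x - y) * partial j \<phi> x \<partial>lborel) = - (\<integral>x. partial j k (x - y) * \<phi> x \<partial>lborel)"
proof -
  have \<phi>': "partial j \<phi> \<in> schwartz" by (rule schwartz_partial[OF \<phi>])
  let ?k = "\<lambda>x. k (1 *\<^sub>R x + - y)"
  have sk: "smooth ?k" by (rule smooth_affine[OF k(1)])
  have pk: "partial j ?k x = partial j k (x - y)" for x
    unfolding partial_def by (simp add: algebra_simps)
  have shift: "decays M (\<lambda>x. f (x - y))" if "decays M f" for M f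
  proof -
    obtain C where C: "C > 0" "\<And>x. norm (f x) * (1 + norm x) ^ M \<le> C" using \<open>decays M f\<close> by (metis decaysE)
    show ?thesis
    proof (rule decaysI)
      fix x :: "real^'n::_"
      have "1 + norm x \<le> (1 + norm y) * (1 + norm (x - y))"
        using peetre[of x "x - y"] by simp
      then have "(1 + norm x) ^ M \<le> (1 + norm y) ^ M * (1 + norm (x - y)) ^ M"
        by (subst power_mult_distrib[symmetric]) (intro power_mono, auto)
      then have "norm (f (x - y)) * (1 + norm x) ^ M \<le> norm (f (x - y)) * ((1 + norm y) ^ M * (1 + norm (x - y)) ^ M)"
        by (intro mult_left_mono) auto
      also have "\<dots> = (norm (f (x - y)) * (1 + norm (x - y)) ^ M) * (1 + norm y) ^ M" by simp
      also have "\<dots> \<le> C * (1 + norm y) ^ M" by (intro mult_right_mono C) auto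
      finally show "norm (f (x - y)) * (1 + norm x) ^ M \<le> C * (1 + norm y) ^ M" .
    qed
  qed
  have [measurable]: "k \<in> borel_measurable borel" "partial j k \<in> borel_measurable borel"
    "\<phi> \<in> borel_measurable borel" "partial j \<phi> \<in> borel_measurable borel"
    by (intro smooth_measurable smooth_partial k schwartz_measurable \<phi> \<phi>')+
  have p: "partial j (\<lambda>x. ?k x * \<phi> x) = (\<lambda>x. k (x - y) * partial j \<phi> x + partial j k (x - y) * \<phi> x)"
    by (rule ext, subst partial_mult) (auto simp: pk[simplified] intro: smooth_differentiable[OF sk[simplified]] smooth_differentiable[OF schwartz_smooth[OF \<phi>]])
  have d1: "decays (M + M) (\<lambda>x. k (x - y) * partial j \<phi> x)" for M
    by (intro decays_mult shift k schwartz_decays \<phi>')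
  have d2: "decays (M + M) (\<lambda>x. partial j k (x - y) * \<phi> x)" for M
    by (intro decays_mult shift k schwartz_decays \<phi>)
  have d3: "decays (M + M) (\<lambda>x. k (x - y) * \<phi> x)" for M
    by (intro decays_mult shift k schwartz_decays \<phi>)
  have "(\<integral>x. partial j (\<lambda>x. ?k x * \<phi> x) x \<partial>lborel) = 0"
  proof (rule integral_partial_eq_0)
    show "smooth (\<lambda>x. ?k x * \<phi> x)" by (intro smooth_mult sk schwartz_smooth \<phi>)
    show "decays (2 * CARD('n)) (\<lambda>x. ?k x * \<phi> x)" using decays_mono[OF d3[of "2 * CARD('n)"]] by simp
    show "decays (2 * CARD('n)) (partial j (\<lambda>x. ?k x * \<phi> x))"
      unfolding p by (rule decays_add[OF decays_mono[OF d1[of "2 * CARD('n)"]] decays_mono[OF d2[of "2 * CARD('n)"]]]) simp_all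
  qed
  moreover have "(\<integral>x. partial j (\<lambda>x. ?k x * \<phi> x) x \<partial>lborel) = (\<integral>x. k (x - y) * partial j \<phi> x \<partial>lborel) + (\<integral>x. partial j k (x - y) * \<phi> x \<partial>lborel)"
    unfolding p
  proof (rule Bochner_Integration.integral_add)
    show "integrable lborel (\<lambda>x. k (x - y) * partial j \<phi> x)"
      by (rule decays_integrable[OF decays_mono[OF d1[of "2 * CARD('n)"]]]) (simp, measurable)
    show "integrable lborel (\<lambda>x. partial j k (x - y) * \<phi> x)"
      by (rule decays_integrable[OF decays_mono[OF d2[of "2 * CARD('n)"]]]) (simp, measurable)
  qed
  ultimately show ?thesis by (simp add: add_eq_0_iff2)
qed

text \<open>
  The identity is required for every Schwartz function \<open>\<phi>\<close>, not only for Fourier transforms of test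
  functions.  It therefore starts from the almost everywhere identity \<open>spectrum_reproduce\<close>, moves the
  kernel to \<open>\<phi>\<close> and integrates by parts there.
\<close>
lemma spectrum_weak_partial:
  fixes u :: "real^'n::{finite,linorder} \<Rightarrow> complex"
  assumes u: "slow u" and m: "m \<in> test_functions UNIV" and V: "open V" "spectrum u \<subseteq> V" "\<And>\<xi>. \<xi> \<in> V \<Longrightarrow> m \<xi> = 1"
  shows "weak_partial j u (convolve u (inverse_fourier (\<lambda>\<xi>. \<i> * complex_of_real (\<xi> $ j) * m \<xi>)))"
  unfolding weak_partial_def
proof
  fix \<phi> :: "real^'n::_ \<Rightarrow> complex" assume \<phi>: "\<phi> \<in> schwartz"
  note \<phi>' = schwartz_partial[OF \<phi>, of j]
  let ?k = "inverse_fourier m" and ?k' = "inverse_fourier (\<lambda>\<xi>. \<i> * complex_of_real (\<xi> $ j) * m \<xi>)"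
  have m': "(\<lambda>\<xi>. \<i> * complex_of_real (\<xi> $ j) * m \<xi>) \<in> test_functions UNIV"
    by (rule test_functions_coord_mult[OF m])
  have ae: "AE x in lborel. u x = convolve u ?k x" by (rule spectrum_reproduce[OF u m V])
  have "(\<integral>x. u x * partial j \<phi> x \<partial>lborel) = (\<integral>x. convolve u ?k x * partial j \<phi> x \<partial>lborel)"
  proof (rule integral_cong_AE)
    show "AE x in lborel. u x * partial j \<phi> x = convolve u ?k x * partial j \<phi> x"
      using ae by eventually_elim simp
  qed (use slow_measurable[OF u] convolve_measurable[OF slow_measurable[OF u] inverse_fourier_measurable[OF m]] schwartz_measurable[OF \<phi>'] in measurable)
  also have "\<dots> = (\<integral>y. u y * (\<integral>x. ?k (x - y) * partial j \<phi> x \<partial>lborel) \<partial>lborel)"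
    by (rule convolve_pairing[OF u inverse_fourier_decays[OF m] inverse_fourier_measurable[OF m] schwartz_decays[OF \<phi>'] schwartz_measurable[OF \<phi>']])
  also have "\<dots> = (\<integral>y. u y * (- (\<integral>x. ?k' (x - y) * \<phi> x \<partial>lborel)) \<partial>lborel)"
    by (subst schwartz_integral_by_parts[OF inverse_fourier_smooth[OF m] inverse_fourier_decays[OF m] _ \<phi>])
      (simp_all add: partial_inverse_fourier[OF m] inverse_fourier_decays[OF m'])
  also have "\<dots> = - (\<integral>x. convolve u ?k' x * \<phi> x \<partial>lborel)"
    by (subst convolve_pairing[OF u inverse_fourier_decays[OF m'] inverse_fourier_measurable[OF m'] schwartz_decays[OF \<phi>] schwartz_measurable[OF \<phi>]]) simp
  finally show "(\<integral>x. convolve u ?k' x * \<phi> x \<partial>lborel) = - (\<integral>x. u x * partial j \<phi> x \<partial>lborel)" by simp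
qed

lemma weak_partial_fourier:
  fixes u g :: "real^'n::{finite,linorder} \<Rightarrow> complex"
  assumes "weak_partial j u g" and \<theta>: "\<theta> \<in> test_functions UNIV"
  shows "(\<integral>x. g x * fourier \<theta> x \<partial>lborel) = (\<integral>x. u x * fourier (\<lambda>\<xi>. \<i> * complex_of_real (\<xi> $ j) * \<theta> \<xi>) x \<partial>lborel)"
proof -
  have "(\<integral>x. g x * fourier \<theta> x \<partial>lborel) = - (\<integral>x. u x * partial j (fourier \<theta>) x \<partial>lborel)"
    using assms(1) fourier_schwartz[OF \<theta>] by (simp add: weak_partial_def)
  also have "partial j (fourier \<theta>) = (\<lambda>x. - fourier (\<lambda>\<xi>. \<i> * complex_of_real (\<xi> $ j) * \<theta> \<xi>) x)"
    unfolding fourier_differentiable(2)[OF \<theta>] by (auto simp: fourier_def)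
  finally show ?thesis by simp
qed

text \<open>
  Differentiation corresponds to multiplication of the test function by \<open>\<i> \<xi>\<^sub>j\<close>, which does not
  enlarge its support.
\<close>
lemma spectrum_weak_partial_subset:
  assumes "weak_partial j u g" shows "spectrum g \<subseteq> spectrum u"
proof
  fix \<xi> assume "\<xi> \<in> spectrum g"
  show "\<xi> \<in> spectrum u" unfolding spectrum_iff
  proof (intro allI impI)
    fix U assume U: "open U \<and> \<xi> \<in> U"
    then obtain \<phi> where \<phi>: "\<phi> \<in> test_functions U" "(\<integral>x. g x * fourier \<phi> x \<partial>lborel) \<noteq> 0"
      using \<open>\<xi> \<in> spectrum g\<close> unfolding spectrum_iff by blast
    then have "(\<integral>x. u x * fourier (\<lambda>\<xi>. \<i> * complex_of_real (\<xi> $ j) * \<phi> \<xi>) x \<partial>lborel) \<noteq> 0"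
      using weak_partial_fourier[OF assms test_functions_mono[OF \<phi>(1)]] by simp
    then show "\<exists>\<phi>\<in>test_functions U. (\<integral>x. u x * fourier \<phi> x \<partial>lborel) \<noteq> 0"
      using test_functions_coord_mult[OF \<phi>(1)] by blast
  qed
qed

text \<open>
  Both sides have the same pairings with Fourier transforms of test functions: on the right the
  multipliers add up to the symbol in \<open>m1\<close>, which is 1 near the spectrum.
\<close>
lemma spectrum_reconstruct:
  fixes u :: "real^'n::{finite,linorder} \<Rightarrow> complex" and g :: "'n \<Rightarrow> real^'n::_ \<Rightarrow> complex"
  assumes u: "slow u" and m: "\<And>j. m j \<in> test_functions UNIV" and V: "open V" "spectrum u \<subseteq> V"
    and m1: "\<And>\<xi>. \<xi> \<in> V \<Longrightarrow> (\<Sum>j\<in>UNIV. \<i> * complex_of_real (\<xi> $ j) * m j \<xi>) = 1"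
    and g: "\<And>j. slow (g j)" "\<And>j. weak_partial j u (g j)"
  shows "AE x in lborel. u x = (\<Sum>j\<in>UNIV. convolve (g j) (inverse_fourier (m j)) x)"
proof (rule slow_eq_AE[OF u])
  have sc: "slow (convolve (g j) (inverse_fourier (m j)))" for j
    by (rule slow_convolve[OF g(1) inverse_fourier_decays[OF m] inverse_fourier_measurable[OF m]])
  then show "slow (\<lambda>x. \<Sum>j\<in>UNIV. convolve (g j) (inverse_fourier (m j)) x)" by (rule slow_sum)
  fix \<theta> :: "real^'n::_ \<Rightarrow> complex" assume \<theta>: "\<theta> \<in> test_functions UNIV"
  let ?m = "\<lambda>\<xi>. \<Sum>j\<in>UNIV. \<i> * complex_of_real (\<xi> $ j) * m j \<xi>"
  have sm: "smooth ?m" by (intro smooth_sum smooth_mult smooth_const smooth_coord test_functions_smooth[OF m])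
  have t: "(\<lambda>\<xi>. m j \<xi> * \<theta> \<xi>) \<in> test_functions UNIV" for j
    by (intro test_functions_mult test_functions_smooth[OF m] \<theta>)
  have t': "(\<lambda>\<xi>. \<i> * complex_of_real (\<xi> $ j) * (m j \<xi> * \<theta> \<xi>)) \<in> test_functions UNIV" for j
    by (rule test_functions_coord_mult[OF t])
  have fs: "fourier (\<lambda>\<xi>. \<Sum>j\<in>I. f j \<xi>) x = (\<Sum>j\<in>I. fourier (f j) x)"
    if "\<And>j. integrable lborel (f j)" for I and f :: "'n \<Rightarrow> real^'n::_ \<Rightarrow> complex" and x
    using fourier_integrable[OF that] unfolding fourier_def
    by (simp add: sum_distrib_left Bochner_Integration.integral_sum)
  have "(\<integral>x. (\<Sum>j\<in>UNIV. convolve (g j) (inverse_fourier (m j)) x) * fourier \<theta> x \<partial>lborel)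
      = (\<Sum>j\<in>UNIV. \<integral>x. convolve (g j) (inverse_fourier (m j)) x * fourier \<theta> x \<partial>lborel)"
    unfolding sum_distrib_right
    by (rule Bochner_Integration.integral_sum) (rule slow_fourier_integrable[OF sc \<theta>])
  also have "\<dots> = (\<Sum>j\<in>UNIV. \<integral>x. u x * fourier (\<lambda>\<xi>. \<i> * complex_of_real (\<xi> $ j) * (m j \<xi> * \<theta> \<xi>)) x \<partial>lborel)"
    by (simp only: convolve_fourier_multiplier[OF g(1) m \<theta>] weak_partial_fourier[OF g(2) t])
  also have "\<dots> = (\<integral>x. u x * fourier (\<lambda>\<xi>. \<Sum>j\<in>UNIV. \<i> * complex_of_real (\<xi> $ j) * (m j \<xi> * \<theta> \<xi>)) x \<partial>lborel)"
    unfolding fs[OF test_functions_integrable[OF t']] sum_distrib_left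
    by (rule Bochner_Integration.integral_sum[symmetric]) (rule slow_fourier_integrable[OF u t'])
  also have "(\<lambda>\<xi>. \<Sum>j\<in>UNIV. \<i> * complex_of_real (\<xi> $ j) * (m j \<xi> * \<theta> \<xi>)) = (\<lambda>\<xi>. ?m \<xi> * \<theta> \<xi>)"
    by (simp add: sum_distrib_right mult.assoc)
  also have "(\<integral>x. u x * fourier (\<lambda>\<xi>. ?m \<xi> * \<theta> \<xi>) x \<partial>lborel) = (\<integral>x. u x * fourier \<theta> x \<partial>lborel)"
    by (rule spectral_multiplier_1[OF u sm V m1 \<theta>])
  finally show "(\<integral>x. u x * fourier \<theta> x \<partial>lborel)
    = (\<integral>x. (\<Sum>j\<in>UNIV. convolve (g j) (inverse_fourier (m j)) x) * fourier \<theta> x \<partial>lborel)" by simp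
qed

section \<open>One-dimensional Lebesgue norms\<close>

lemma ennpowr_ennreal: "0 \<le> x \<Longrightarrow> ennpowr (ennreal x) a = ennreal (x powr a)"
  by (simp add: ennpowr_def)

lemma ennpowr_top [simp]: "ennpowr \<top> a = \<top>" by (simp add: ennpowr_def)

lemma ennpowr_0 [simp]: "ennpowr 0 a = 0" by (simp add: ennpowr_def)

lemma ennpowr_eq_top_iff [simp]: "ennpowr x a = \<top> \<longleftrightarrow> x = \<top>" by (simp add: ennpowr_def)

lemma ennpowr_eq_0_iff [simp]: "ennpowr x a = 0 \<longleftrightarrow> x = 0"
  by (cases x) (auto simp: ennpowr_def ennreal_eq_0_iff)

lemma ennpowr_one [simp]: "ennpowr x 1 = x"
  by (cases x) (auto simp: ennpowr_def)

lemma ennpowr_mono: "x \<le> y \<Longrightarrow> 0 \<le> a \<Longrightarrow> ennpowr x a \<le> ennpowr y a"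
  by (cases x; cases y) (auto simp: ennpowr_def top_unique intro!: ennreal_leI powr_mono2)

lemma ennpowr_ennpowr: "ennpowr (ennpowr x a) b = ennpowr x (a * b)"
  by (cases x) (auto simp: ennpowr_def powr_powr)

lemma ennpowr_mult: "ennpowr (x * y) a = ennpowr x a * ennpowr y a"
  by (cases x; cases y) (auto simp: ennpowr_ennreal ennreal_mult[symmetric] powr_mult ennreal_mult_top ennreal_top_mult ennreal_eq_0_iff)

lemma ennpowr_add: "0 < a \<Longrightarrow> 0 < b \<Longrightarrow> ennpowr x (a + b) = ennpowr x a * ennpowr x b"
  by (cases x) (auto simp: ennpowr_ennreal ennreal_mult[symmetric] powr_add ennreal_top_mult)

lemma ennpowr_measurable [measurable]:
  assumes [measurable]: "f \<in> borel_measurable M"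
  shows "(\<lambda>x. ennpowr (f x) a) \<in> borel_measurable M"
proof -
  have "{x \<in> space M. f x = \<infinity>} \<in> sets M" by measurable
  then show ?thesis unfolding ennpowr_def by measurable
qed

lemma exponent_cases:
  fixes p :: ennreal
  assumes "1 \<le> p"
  obtains (top) "p = \<infinity>" "recip p = 0"
    | (fin) r where "1 \<le> r" "p = ennreal r" "enn2real p = r" "recip p = 1 / r"
proof (cases p)
  case (real r)
  then have "1 \<le> r" using assms by (simp flip: ennreal_1)
  moreover have "recip p = 1 / r"
    using real \<open>1 \<le> r\<close> by (simp add: recip_def divide_ennreal flip: ennreal_1)
  ultimately show ?thesis using fin real by auto
next
  case top
  then show ?thesis using that(1) by (simp add: recip_def)
qed

lemma Lp_norm_fin:
  assumes "1 \<le> r" shows "Lp_norm_1d (ennreal r) g = ennpowr (\<integral>\<^sup>+ t. ennpowr (g t) r \<partial>lborel) (1 / r)"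
proof -
  have "recip (ennreal r) = 1 / r" using assms by (simp add: recip_def divide_ennreal flip: ennreal_1)
  then show ?thesis using assms by (simp add: Lp_norm_1d_def)
qed

lemma Lp_norm_fin_powr:
  assumes "1 \<le> r" shows "ennpowr (Lp_norm_1d (ennreal r) g) r = (\<integral>\<^sup>+ t. ennpowr (g t) r \<partial>lborel)"
  using assms by (simp add: Lp_norm_fin ennpowr_ennpowr)

lemma Lp_norm_top: "Lp_norm_1d \<infinity> g = esssup lborel g"
  by (simp add: Lp_norm_1d_def)

lemma Lp_norm_le_powr:
  assumes "1 \<le> r" "(\<integral>\<^sup>+ t. ennpowr (g t) r \<partial>lborel) \<le> ennpowr c r" shows "Lp_norm_1d (ennreal r) g \<le> c"
proof -
  have "Lp_norm_1d (ennreal r) g \<le> ennpowr (ennpowr c r) (1 / r)"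
    unfolding Lp_norm_fin[OF assms(1)] using assms by (intro ennpowr_mono) auto
  then show ?thesis using assms by (simp add: ennpowr_ennpowr)
qed

lemma Lp_norm_1: "Lp_norm_1d 1 g = (\<integral>\<^sup>+ t. g t \<partial>lborel)"
  using Lp_norm_fin[of 1 g] by simp

lemma Lp_norm_mono_AE:
  assumes [measurable]: "f \<in> borel_measurable borel" and le: "AE t in lborel. f t \<le> g t" and p: "1 \<le> p"
  shows "Lp_norm_1d p f \<le> Lp_norm_1d p g"
  using p
proof (cases rule: exponent_cases)
  case top
  then show ?thesis using le by (simp add: Lp_norm_top[simplified] esssup_AE_mono)
next
  case (fin r)
  have "AE t in lborel. ennpowr (f t) r \<le> ennpowr (g t) r"
    using le by eventually_elim (use fin in \<open>auto intro: ennpowr_mono\<close>)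
  then have "(\<integral>\<^sup>+ t. ennpowr (f t) r \<partial>lborel) \<le> (\<integral>\<^sup>+ t. ennpowr (g t) r \<partial>lborel)"
    by (rule nn_integral_mono_AE)
  then show ?thesis using fin by (simp add: Lp_norm_fin ennpowr_mono)
qed

lemma Lp_norm_mono:
  "f \<in> borel_measurable borel \<Longrightarrow> (\<And>t. f t \<le> g t) \<Longrightarrow> 1 \<le> p \<Longrightarrow> Lp_norm_1d p f \<le> Lp_norm_1d p g"
  by (rule Lp_norm_mono_AE) auto

lemma Lp_norm_cmult_le:
  assumes [measurable]: "f \<in> borel_measurable borel" and p: "1 \<le> p"
  shows "Lp_norm_1d p (\<lambda>t. c * f t) \<le> c * Lp_norm_1d p f"
  using p
proof (cases rule: exponent_cases)
  case top
  have "AE t in lborel. c * f t \<le> c * esssup lborel f"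
    using esssup_AE[of f lborel] by eventually_elim (rule mult_left_mono, auto)
  then show ?thesis using top by (simp add: Lp_norm_top[simplified] esssup_I)
next
  case (fin r)
  then show ?thesis
    by (simp add: Lp_norm_fin ennpowr_mult nn_integral_cmult ennpowr_ennpowr)
qed

lemma Lp_norm_top_const:
  assumes "1 \<le> p" shows "Lp_norm_1d p (\<lambda>t. \<top>) = \<top>"
  using assms
proof (cases rule: exponent_cases)
  case top
  then show ?thesis by (simp add: Lp_norm_top[simplified] esssup_const)
next
  case (fin r)
  then show ?thesis by (simp add: Lp_norm_fin ennreal_mult_top)
qed

lemma nn_integral_shift_reflect:
  assumes [measurable]: "f \<in> borel_measurable (borel :: real measure)"
  shows "(\<integral>\<^sup>+ t. f (t - s) \<partial>lborel) = (\<integral>\<^sup>+ t. f t \<partial>lborel)" "(\<integral>\<^sup>+ t. f (s - t) \<partial>lborel) = (\<integral>\<^sup>+ t. f t \<partial>lborel)"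
  using nn_integral_real_affine[of f 1 "- s"] nn_integral_real_affine[of f "- 1" s] by simp_all

lemma Lp_norm_shift_le:
  assumes [measurable]: "f \<in> borel_measurable borel" and p: "1 \<le> p"
  shows "Lp_norm_1d p (\<lambda>t. f (t - s)) \<le> Lp_norm_1d p f"
  using p
proof (cases rule: exponent_cases)
  case top
  have "AE t in lborel. f (- s + 1 * t) \<le> esssup lborel f"
    by (rule AE_borel_affine[OF _ _ esssup_AE]) auto
  then have "AE t in lborel. f (t - s) \<le> esssup lborel f" by simp
  then show ?thesis unfolding top Lp_norm_top by (intro esssup_I) auto
next
  case (fin r)
  then show ?thesis
    using nn_integral_shift_reflect(1)[of "\<lambda>t. ennpowr (f t) r" s] by (simp add: Lp_norm_fin)
qed

text \<open>
  For \<open>p = \<infinity>\<close> the sublevel sets are measurable because \<open>esssup (F x) \<le> c\<close> says that the section at \<open>x\<close>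
  of the set where \<open>F\<close> exceeds \<open>c\<close> is a null set.
\<close>
lemma Lp_norm_measurable:
  assumes F [measurable]: "(\<lambda>(x, t). F x t) \<in> borel_measurable (M \<Otimes>\<^sub>M borel)" and p: "1 \<le> p"
  shows "(\<lambda>x. Lp_norm_1d p (F x)) \<in> borel_measurable M"
  using p
proof (cases rule: exponent_cases)
  case top
  have F': "(\<lambda>(x, t). F x t) \<in> borel_measurable (M \<Otimes>\<^sub>M lborel)"
    using F by (simp cong: measurable_cong_sets sets_pair_measure_cong)
  have Fx: "F x \<in> borel_measurable lborel" if "x \<in> space M" for x
    using measurable_compose[OF measurable_Pair1'[OF that] F'] by simp
  have "(\<lambda>x. esssup lborel (F x)) \<in> borel_measurable M"
  proof (rule borel_measurableI_le)
    fix c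
    have eq: "{x \<in> space M. esssup lborel (F x) \<le> c} = {x \<in> space M. (\<integral>\<^sup>+ t. indicator {p. c < F (fst p) (snd p)} (x, t) \<partial>lborel) = 0}"
    proof (intro Collect_cong conj_cong refl)
      fix x assume x: "x \<in> space M"
      have [measurable]: "F x \<in> borel_measurable borel" using Fx[OF x] by simp
      have "esssup lborel (F x) \<le> c \<longleftrightarrow> (AE t in lborel. F x t \<le> c)"
      proof
        assume *: "esssup lborel (F x) \<le> c"
        show "AE t in lborel. F x t \<le> c" using esssup_AE[of "F x" lborel] by eventually_elim (use * in auto)
      qed (auto intro: esssup_I)
      also have "\<dots> \<longleftrightarrow> (\<integral>\<^sup>+ t. indicator {p. c < F (fst p) (snd p)} (x, t) \<partial>lborel) = 0"
      proof -
        have *: "(\<lambda>t. indicator {p. c < F (fst p) (snd p)} (x, t) :: ennreal) = (\<lambda>t. indicator {t. c < F x t} t)"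
          by (auto simp: indicator_def)
        show ?thesis unfolding * 
          by (subst nn_integral_0_iff_AE) (auto simp: indicator_def not_less split: if_splits)
      qed
      finally show "esssup lborel (F x) \<le> c \<longleftrightarrow> (\<integral>\<^sup>+ t. indicator {p. c < F (fst p) (snd p)} (x, t) \<partial>lborel) = 0" .
    qed
    have "{p \<in> space (M \<Otimes>\<^sub>M lborel). c < F (fst p) (snd p)} \<in> sets (M \<Otimes>\<^sub>M lborel)"
    proof -
      have m: "(\<lambda>p. F (fst p) (snd p)) \<in> borel_measurable (M \<Otimes>\<^sub>M lborel)"
        using F' by (simp only: split_beta')
      have "{p \<in> space (M \<Otimes>\<^sub>M lborel). c < F (fst p) (snd p)} = (\<lambda>p. F (fst p) (snd p)) -` {c<..} \<inter> space (M \<Otimes>\<^sub>M lborel)"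
        by auto
      also have "\<dots> \<in> sets (M \<Otimes>\<^sub>M lborel)" by (rule measurable_sets[OF m]) auto
      finally show ?thesis .
    qed
    then have i: "(\<lambda>p. indicator {p \<in> space (M \<Otimes>\<^sub>M lborel). c < F (fst p) (snd p)} p :: ennreal) \<in> borel_measurable (M \<Otimes>\<^sub>M lborel)"
      by simp
    have "(\<lambda>(x, t). indicator {p. c < F (fst p) (snd p)} (x, t) :: ennreal) \<in> borel_measurable (M \<Otimes>\<^sub>M lborel)"
      by (rule measurable_cong[THEN iffD1, OF _ i]) (auto simp: indicator_def)
    from lborel.borel_measurable_nn_integral[OF this]
    show "{x \<in> space M. esssup lborel (F x) \<le> c} \<in> sets M" unfolding eq by measurable
  qed
  then show ?thesis using top by (simp add: Lp_norm_top[simplified])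
next
  case (fin r)
  show ?thesis unfolding fin(2) Lp_norm_fin[OF fin(1)] by measurable
qed

text \<open>
  If the mean \<open>m\<close> is finite, Young's inequality provides the tangent \<open>r m\<^bsup>r - 1\<^esup> a \<le> a\<^sup>r + (r - 1) m\<^sup>r\<close>,
  which is integrated and has \<open>(r - 1) m\<^sup>r\<close> cancelled on both sides.
\<close>
lemma ennpowr_jensen:
  assumes "prob_space N" and [measurable]: "f \<in> borel_measurable N" and r: "1 \<le> r"
  shows "ennpowr (\<integral>\<^sup>+ y. f y \<partial>N) r \<le> (\<integral>\<^sup>+ y. ennpowr (f y) r \<partial>N)"
proof -
  interpret prob_space N by fact
  show ?thesis
  proof (cases "(\<integral>\<^sup>+ y. f y \<partial>N)")
    case top
    have "f y \<le> 1 + ennpowr (f y) r" for y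
    proof (cases "f y")
      case (real a)
      have "a \<le> 1 + a powr r"
      proof (cases "a \<le> 1")
        case True then show ?thesis by (simp add: add_increasing2)
      next
        case False
        then have "a powr 1 \<le> a powr r" using r by (intro powr_mono) auto
        with False real show ?thesis by simp
      qed
      then show ?thesis using real by (simp add: ennpowr_ennreal flip: ennreal_1 ennreal_plus)
    qed simp
    then have "(\<integral>\<^sup>+ y. f y \<partial>N) \<le> (\<integral>\<^sup>+ y. 1 + ennpowr (f y) r \<partial>N)" by (intro nn_integral_mono)
    also have "\<dots> = 1 + (\<integral>\<^sup>+ y. ennpowr (f y) r \<partial>N)" by (subst nn_integral_add) (auto simp: emeasure_space_1)
    finally show ?thesis using top by (simp add: top_unique ennreal_add_eq_top)
  next
    case (real m)
    note m = real
    have young: "ennreal (r * m powr (r - 1)) * f y \<le> ennpowr (f y) r + ennreal ((r - 1) * m powr r)" for y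
    proof (cases "f y")
      case (real a)
      have "0 \<le> a" "0 \<le> m" using real m by auto
      have "r * m powr (r - 1) * a \<le> a powr r + (r - 1) * m powr r"
      proof (cases "a = 0 \<or> m = 0")
        case True then show ?thesis using r by auto
      next
        case False
        have "(a powr r) powr (1 / r) * (m powr r) powr (1 - 1 / r) \<le> (1 / r) * a powr r + (1 - 1 / r) * m powr r"
          using r False by (intro Youngs_inequality_0) auto
        moreover have "(a powr r) powr (1 / r) = a" using r \<open>0 \<le> a\<close> by (simp add: powr_powr)
        moreover have "(m powr r) powr (1 - 1 / r) = m powr (r - 1)" using r by (simp add: powr_powr right_diff_distrib)
        ultimately have "r * (a * m powr (r - 1)) \<le> r * ((1 / r) * a powr r + (1 - 1 / r) * m powr r)"
          using r by (intro mult_left_mono) auto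
        also have "\<dots> = a powr r + (r - 1) * m powr r" using r by (simp add: field_simps)
        finally show ?thesis by (simp add: mult_ac)
      qed
      then show ?thesis using real r by (simp add: ennpowr_ennreal flip: ennreal_mult ennreal_plus)
    qed (simp)
    have m: "0 \<le> m" using m by simp
    have "ennreal (r * m powr (r - 1)) * ennreal m = (\<integral>\<^sup>+ y. ennreal (r * m powr (r - 1)) * f y \<partial>N)"
      by (simp add: nn_integral_cmult real)
    also have "\<dots> \<le> (\<integral>\<^sup>+ y. ennpowr (f y) r + ennreal ((r - 1) * m powr r) \<partial>N)"
      by (intro nn_integral_mono young)
    also have "\<dots> = (\<integral>\<^sup>+ y. ennpowr (f y) r \<partial>N) + ennreal ((r - 1) * m powr r)"
      by (subst nn_integral_add) (auto simp: emeasure_space_1)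
    finally have *: "ennreal (r * m powr (r - 1)) * ennreal m \<le> (\<integral>\<^sup>+ y. ennpowr (f y) r \<partial>N) + ennreal ((r - 1) * m powr r)" .
    have "m powr (r - 1) * m = m powr r"
    proof (cases "m = 0")
      case False
      then show ?thesis using m powr_add[of m "r - 1" 1] by simp
    qed simp
    note e = this
    have "ennreal (r * m powr (r - 1)) * ennreal m = ennreal (m powr r) + ennreal ((r - 1) * m powr r)"
    proof -
      have "r * m powr (r - 1) * m = r * (m powr (r - 1) * m)" by (rule mult.assoc)
      also have "\<dots> = m powr r + (r - 1) * m powr r" unfolding e by (simp add: left_diff_distrib)
      finally have "r * m powr (r - 1) * m = m powr r + (r - 1) * m powr r" .
      then show ?thesis using r m by (simp add: ennreal_mult[symmetric] ennreal_plus[symmetric] del: ennreal_plus)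
    qed
    with * have "ennreal (m powr r) \<le> (\<integral>\<^sup>+ y. ennpowr (f y) r \<partial>N)"
      by (simp add: add.commute[of _ "ennreal ((r - 1) * m powr r)"] ennreal_add_left_cancel_le)
    then show ?thesis using real by (simp add: ennpowr_ennreal)
  qed
qed

text \<open>
  Minkowski's integral inequality.  For a finite exponent \<open>r\<close> let \<open>n y\<close> be the norm of \<open>F _ y\<close> and \<open>M\<close> the
  integral of \<open>n\<close>.  Then \<open>n / M\<close> is a probability density, and \<open>\<integral> F t y dy\<close> is the mean of
  \<open>M F t y / n y\<close> with respect to it.  Jensen's inequality followed by an integration over \<open>t\<close> gives the
  claim, since \<open>F t y / n y\<close> has norm at most 1.
\<close>
lemma Lp_minkowski:
  fixes F :: "real \<Rightarrow> real \<Rightarrow> ennreal"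
  assumes F: "(\<lambda>(t, y). F t y) \<in> borel_measurable (borel \<Otimes>\<^sub>M borel)" and p: "1 \<le> p"
  shows "Lp_norm_1d p (\<lambda>t. \<integral>\<^sup>+ y. F t y \<partial>lborel) \<le> (\<integral>\<^sup>+ y. Lp_norm_1d p (\<lambda>t. F t y) \<partial>lborel)"
proof -
  note [measurable] = F
  define n where "n y = Lp_norm_1d p (\<lambda>t. F t y)" for y
  have n [measurable]: "n \<in> borel_measurable borel"
    unfolding n_def by (rule Lp_norm_measurable[OF _ p]) measurable
  have Fy [measurable]: "(\<lambda>t. F t y) \<in> borel_measurable borel" for y by measurable
  have Ft [measurable]: "F t \<in> borel_measurable borel" for t by measurable
  show ?thesis using p
  proof (cases rule: exponent_cases)
    case top
    have "AE y in lborel. AE t in lborel. F t y \<le> n y"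
      unfolding n_def top Lp_norm_top by (intro AE_I2 esssup_AE)
    then have "AE t in lborel. AE y in lborel. F t y \<le> n y"
      by (subst lborel_pair.AE_commute) measurable
    then have "AE t in lborel. (\<integral>\<^sup>+ y. F t y \<partial>lborel) \<le> (\<integral>\<^sup>+ y. n y \<partial>lborel)"
      by eventually_elim (rule nn_integral_mono_AE)
    then show ?thesis unfolding top Lp_norm_top n_def[symmetric, unfolded top] 
      by (intro esssup_I) (auto simp: n_def[unfolded top Lp_norm_top])
  next
    case (fin r)
    define M where "M = (\<integral>\<^sup>+ y. n y \<partial>lborel)"
    have npow: "(\<integral>\<^sup>+ t. ennpowr (F t y) r \<partial>lborel) = ennpowr (n y) r" for y
      unfolding n_def fin(2) by (rule Lp_norm_fin_powr[symmetric, OF fin(1)])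
    have n0: "AE t in lborel. n y = 0 \<longrightarrow> F t y = 0" for y
    proof (cases "n y = 0")
      case True
      then have "(\<integral>\<^sup>+ t. ennpowr (F t y) r \<partial>lborel) = 0" by (simp add: npow)
      then show ?thesis by (subst (asm) nn_integral_0_iff_AE) auto
    qed simp
    consider "M = \<top>" | "M = 0" | "0 < M" "M < \<top>" by (metis less_top not_gr_zero)
    then show ?thesis
    proof cases
      case 1 then show ?thesis by (simp add: M_def n_def)
    next
      case 2
      then have "AE y in lborel. n y = 0" unfolding M_def by (subst (asm) nn_integral_0_iff_AE) auto
      then have "AE y in lborel. AE t in lborel. F t y = 0"
        by eventually_elim (use n0 in \<open>force elim: eventually_mono\<close>)
      then have "AE t in lborel. AE y in lborel. F t y = 0"
        by (subst lborel_pair.AE_commute) measurable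
      then have *: "AE t in lborel. (\<integral>\<^sup>+ y. F t y \<partial>lborel) = 0"
        by eventually_elim (subst nn_integral_0_iff_AE, auto)
      have "(\<integral>\<^sup>+ t. ennpowr (\<integral>\<^sup>+ y. F t y \<partial>lborel) r \<partial>lborel) = 0"
        using * by (subst nn_integral_0_iff_AE) auto
      then show ?thesis using fin by (simp add: Lp_norm_fin)
    next
      case 3
      define P where "P = density lborel (\<lambda>y. n y / M)"
      have "emeasure P (space P) = (\<integral>\<^sup>+ y. n y / M \<partial>lborel)"
        by (simp add: P_def emeasure_density)
      also have "\<dots> = 1" using 3 by (simp add: nn_integral_divide M_def[symmetric] ennreal_divide_self)
      finally have "prob_space P" by (rule prob_spaceI)
      have "AE y in lborel. n y \<noteq> \<infinity>"
        by (rule nn_integral_PInf_AE) (use 3 in \<open>auto simp: M_def\<close>)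
      then have "AE y in lborel. AE t in lborel. F t y = (n y / M) * (M * (F t y / n y))"
      proof eventually_elim
        case (elim y)
        show ?case using n0[of y]
        proof eventually_elim
          case (elim t)
          show ?case
          proof (cases "n y = 0")
            case False
            have "(n y / M) * (M * (F t y / n y)) = (M / M) * (n y / n y) * F t y"
              by (simp add: divide_ennreal_def mult_ac)
            then show ?thesis using False \<open>n y \<noteq> \<infinity>\<close> 3 by (simp add: ennreal_divide_self less_top)
          qed (use elim in simp)
        qed
      qed
      note ae = this
      define R where "R = (\<lambda>(t, y). (n y / M) * (M * (F t y / n y)))"
      have [measurable]: "R \<in> borel_measurable (borel \<Otimes>\<^sub>M borel)" unfolding R_def by measurable
      have "{p \<in> space (borel \<Otimes>\<^sub>M borel). (case p of (t, y) \<Rightarrow> F t y) = R p} \<in> sets (borel \<Otimes>\<^sub>M borel)"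
        by (rule borel_measurable_eq) measurable
      then have "{p \<in> space (lborel \<Otimes>\<^sub>M lborel). F (fst p) (snd p) = R (fst p, snd p)} \<in> sets (lborel \<Otimes>\<^sub>M lborel)"
        by (simp add: split_beta' space_pair_measure cong: sets_pair_measure_cong)
      from lborel_pair.AE_commute[OF this]
      \<comment> \<open>Where \<open>n y = 0\<close> the right-hand side is 0, and so is \<open>F t y\<close> for almost every \<open>t\<close>.\<close>
      have eq: "AE t in lborel. AE y in lborel. F t y = (n y / M) * (M * (F t y / n y))"
        unfolding R_def prod.case using ae by blast
      have "(\<integral>\<^sup>+ t. ennpowr (\<integral>\<^sup>+ y. F t y \<partial>lborel) r \<partial>lborel)
          \<le> (\<integral>\<^sup>+ t. \<integral>\<^sup>+ y. (n y / M) * ennpowr (M * (F t y / n y)) r \<partial>lborel \<partial>lborel)"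
      proof (rule nn_integral_mono_AE)
        show "AE t in lborel. ennpowr (\<integral>\<^sup>+ y. F t y \<partial>lborel) r \<le> (\<integral>\<^sup>+ y. (n y / M) * ennpowr (M * (F t y / n y)) r \<partial>lborel)"
          using eq
        proof eventually_elim
          case (elim t)
          have "(\<integral>\<^sup>+ y. F t y \<partial>lborel) = (\<integral>\<^sup>+ y. (n y / M) * (M * (F t y / n y)) \<partial>lborel)"
            by (rule nn_integral_cong_AE[OF elim])
          also have "\<dots> = (\<integral>\<^sup>+ y. M * (F t y / n y) \<partial>P)"
            unfolding P_def by (subst nn_integral_density) auto
          finally have "ennpowr (\<integral>\<^sup>+ y. F t y \<partial>lborel) r \<le> (\<integral>\<^sup>+ y. ennpowr (M * (F t y / n y)) r \<partial>P)"
            using ennpowr_jensen[OF \<open>prob_space P\<close> _ fin(1), of "\<lambda>y. M * (F t y / n y)"] by (simp add: P_def)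
          also have "\<dots> = (\<integral>\<^sup>+ y. (n y / M) * ennpowr (M * (F t y / n y)) r \<partial>lborel)"
            unfolding P_def by (subst nn_integral_density) auto
          finally show ?case .
        qed
      qed
      also have "\<dots> = (\<integral>\<^sup>+ y. \<integral>\<^sup>+ t. (n y / M) * ennpowr (M * (F t y / n y)) r \<partial>lborel \<partial>lborel)"
        by (rule lborel_pair.Fubini') measurable
      also have "\<dots> \<le> (\<integral>\<^sup>+ y. (n y / M) * ennpowr M r \<partial>lborel)"
      proof (rule nn_integral_mono)
        fix y
        have "(\<integral>\<^sup>+ t. (n y / M) * ennpowr (M * (F t y / n y)) r \<partial>lborel)
            = (\<integral>\<^sup>+ t. ((n y / M) * (ennpowr M r * ennpowr (inverse (n y)) r)) * ennpowr (F t y) r \<partial>lborel)"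
          by (simp add: ennpowr_mult divide_ennreal_def mult_ac)
        also have "\<dots> = ((n y / M) * (ennpowr M r * ennpowr (inverse (n y)) r)) * ennpowr (n y) r"
          by (subst nn_integral_cmult) (auto simp: npow)
        also have "\<dots> = (n y / M) * (ennpowr M r * ennpowr (n y / n y) r)"
          by (simp add: ennpowr_mult divide_ennreal_def mult_ac)
        also have "\<dots> \<le> (n y / M) * (ennpowr M r * 1)"
        proof (intro mult_left_mono)
          have "n y / n y \<le> 1"
            by (cases "n y = 0 \<or> n y = \<top>") (auto simp: ennreal_divide_self less_top)
          then have "ennpowr (n y / n y) r \<le> ennpowr 1 r" using fin by (intro ennpowr_mono) auto
          also have "ennpowr 1 r = 1" using ennpowr_ennreal[of 1 r] by simp
          finally show "ennpowr (n y / n y) r \<le> 1" .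
        qed auto
        finally show "(\<integral>\<^sup>+ t. (n y / M) * ennpowr (M * (F t y / n y)) r \<partial>lborel) \<le> (n y / M) * ennpowr M r" by simp
      qed
      also have "\<dots> = (M / M) * ennpowr M r"
      proof -
        have "(\<integral>\<^sup>+ y. (n y / M) * ennpowr M r \<partial>lborel) = (\<integral>\<^sup>+ y. n y / M \<partial>lborel) * ennpowr M r"
          by (rule nn_integral_multc) measurable
        also have "(\<integral>\<^sup>+ y. n y / M \<partial>lborel) = (\<integral>\<^sup>+ y. n y \<partial>lborel) / M"
          by (rule nn_integral_divide) measurable
        finally show ?thesis by (simp only: M_def[symmetric])
      qed
      also have "\<dots> = ennpowr M r" using 3 by (simp add: ennreal_divide_self)
      finally have "Lp_norm_1d (ennreal r) (\<lambda>t. \<integral>\<^sup>+ y. F t y \<partial>lborel) \<le> M"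
        by (rule Lp_norm_le_powr[OF fin(1)])
      then show ?thesis by (simp add: fin(2) M_def n_def)
    qed
  qed
qed

text \<open>
  Convolution on the line with \<open>h\<close>, which will be a probability density.
\<close>
definition smear :: "(real \<Rightarrow> ennreal) \<Rightarrow> (real \<Rightarrow> ennreal) \<Rightarrow> real \<Rightarrow> ennreal" where
  "smear h f t = (\<integral>\<^sup>+ s. h s * f (t - s) \<partial>lborel)"

lemma smear_measurable [measurable]:
  assumes [measurable]: "h \<in> borel_measurable borel" "f \<in> borel_measurable borel"
  shows "smear h f \<in> borel_measurable borel"
  unfolding smear_def by measurable

lemma smear_contraction:
  assumes [measurable]: "h \<in> borel_measurable borel" "f \<in> borel_measurable borel"
    and h: "(\<integral>\<^sup>+ s. h s \<partial>lborel) = 1" and p: "1 \<le> p"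
  shows "Lp_norm_1d p (smear h f) \<le> Lp_norm_1d p f"
proof -
  have "Lp_norm_1d p (smear h f) \<le> (\<integral>\<^sup>+ s. Lp_norm_1d p (\<lambda>t. h s * f (t - s)) \<partial>lborel)"
    unfolding smear_def by (rule Lp_minkowski[OF _ p]) measurable
  also have "\<dots> \<le> (\<integral>\<^sup>+ s. h s * Lp_norm_1d p f \<partial>lborel)"
  proof (rule nn_integral_mono)
    fix s
    have "Lp_norm_1d p (\<lambda>t. h s * f (t - s)) \<le> h s * Lp_norm_1d p (\<lambda>t. f (t - s))"
      by (rule Lp_norm_cmult_le[OF _ p]) measurable
    also have "\<dots> \<le> h s * Lp_norm_1d p f"
      by (rule mult_left_mono[OF Lp_norm_shift_le[OF assms(2) p]]) simp
    finally show "Lp_norm_1d p (\<lambda>t. h s * f (t - s)) \<le> h s * Lp_norm_1d p f" .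
  qed
  also have "\<dots> = Lp_norm_1d p f" by (simp add: nn_integral_multc h)
  finally show ?thesis .
qed

text \<open>
  Jensen's inequality for the probability density \<open>h\<close> bounds the \<open>r\<close>-th power of the mean by the mean of
  the \<open>r\<close>-th power, in which \<open>h\<close> is then estimated by its supremum.
\<close>
lemma smear_sup_bound:
  assumes [measurable]: "h \<in> borel_measurable borel" "f \<in> borel_measurable borel"
    and h: "(\<integral>\<^sup>+ s. h s \<partial>lborel) = 1" "\<And>s. h s \<le> ennreal B" and B: "0 < B" and r: "1 \<le> r"
  shows "smear h f t \<le> ennreal (B powr (1 / r)) * Lp_norm_1d (ennreal r) f"
proof -
  let ?P = "density lborel h"
  have "prob_space ?P" by (rule prob_spaceI) (simp add: emeasure_density h(1))
  have "ennpowr (smear h f t) r = ennpowr (\<integral>\<^sup>+ s. f (t - s) \<partial>?P) r"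
    unfolding smear_def by (subst nn_integral_density) auto
  also have "\<dots> \<le> (\<integral>\<^sup>+ s. ennpowr (f (t - s)) r \<partial>?P)"
    by (rule ennpowr_jensen[OF \<open>prob_space ?P\<close> _ r]) auto
  also have "\<dots> = (\<integral>\<^sup>+ s. h s * ennpowr (f (t - s)) r \<partial>lborel)"
    by (subst nn_integral_density) auto
  also have "\<dots> \<le> (\<integral>\<^sup>+ s. ennreal B * ennpowr (f (t - s)) r \<partial>lborel)"
    by (intro nn_integral_mono mult_right_mono h) auto
  also have "\<dots> = ennreal B * ennpowr (Lp_norm_1d (ennreal r) f) r"
    using nn_integral_shift_reflect(2)[of "\<lambda>t. ennpowr (f t) r" t]
    by (simp add: nn_integral_cmult Lp_norm_fin_powr[OF r])
  finally have "ennpowr (ennpowr (smear h f t) r) (1 / r) \<le> ennpowr (ennreal B * ennpowr (Lp_norm_1d (ennreal r) f) r) (1 / r)"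
    using r by (intro ennpowr_mono) auto
  then show ?thesis using r B by (simp add: ennpowr_ennpowr ennpowr_mult ennpowr_ennreal)
qed

text \<open>
  Young's inequality for a bounded probability density.  The case of two finite exponents \<open>r < s\<close>
  interpolates between the two preceding bounds: the factor \<open>g\<^bsup>s - r\<^esup>\<close> of \<open>g\<^sup>s\<close> is estimated by the
  supremum of \<open>g\<close>, and \<open>\<integral> g\<^sup>r\<close> by contraction.
\<close>
lemma smear_young:
  assumes [measurable]: "h \<in> borel_measurable borel" "f \<in> borel_measurable borel"
    and h: "(\<integral>\<^sup>+ s. h s \<partial>lborel) = 1" "\<And>s. h s \<le> ennreal B" and B: "0 < B" and p: "1 \<le> p" and pq: "p \<le> q"
  shows "Lp_norm_1d q (smear h f) \<le> ennreal (B powr (recip p - recip q)) * Lp_norm_1d p f"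
proof -
  have q: "1 \<le> q" using p pq by simp
  show ?thesis
  proof (cases "p = q")
    case True
    then show ?thesis using smear_contraction[OF assms(1,2) h(1) q] B by simp
  next
    case ne: False
    show ?thesis using p
    proof (cases rule: exponent_cases)
      case top
      then show ?thesis using ne pq by (simp add: top_unique)
    next
      case (fin r)
      note bound = smear_sup_bound[OF assms(1,2) h B fin(1)]
      show ?thesis using q
      proof (cases rule: exponent_cases)
        case top
        have "esssup lborel (smear h f) \<le> ennreal (B powr (1 / r)) * Lp_norm_1d (ennreal r) f"
          by (intro esssup_I AE_I2 bound) auto
        then show ?thesis using top fin by (simp add: Lp_norm_top[simplified])
      next
        case (fin s)
        note q' = this
        have rs: "r < s" using ne pq \<open>p = ennreal r\<close> q' \<open>1 \<le> r\<close> by (auto simp: less_le)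
        let ?n = "Lp_norm_1d (ennreal r) f" and ?S = "ennreal (B powr (1 / r)) * Lp_norm_1d (ennreal r) f"
        have "(\<integral>\<^sup>+ t. ennpowr (smear h f t) s \<partial>lborel) \<le> (\<integral>\<^sup>+ t. ennpowr ?S (s - r) * ennpowr (smear h f t) r \<partial>lborel)"
        proof (rule nn_integral_mono)
          fix t
          have "ennpowr (smear h f t) s = ennpowr (smear h f t) (s - r) * ennpowr (smear h f t) r"
            using ennpowr_add[of "s - r" r "smear h f t"] rs \<open>1 \<le> r\<close> by simp
          also have "\<dots> \<le> ennpowr ?S (s - r) * ennpowr (smear h f t) r"
            using rs by (intro mult_right_mono ennpowr_mono bound) auto
          finally show "ennpowr (smear h f t) s \<le> ennpowr ?S (s - r) * ennpowr (smear h f t) r" .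
        qed
        also have "\<dots> = ennpowr ?S (s - r) * ennpowr (Lp_norm_1d (ennreal r) (smear h f)) r"
          by (simp add: nn_integral_cmult Lp_norm_fin_powr[OF \<open>1 \<le> r\<close>])
        also have "\<dots> \<le> ennpowr ?S (s - r) * ennpowr ?n r"
          using smear_contraction[OF assms(1,2) h(1), of "ennreal r"] \<open>1 \<le> r\<close> p \<open>p = ennreal r\<close>
          by (intro mult_left_mono ennpowr_mono) auto
        also have "\<dots> = ennreal (B powr ((s - r) / r)) * ennpowr ?n s"
        proof -
          have "ennpowr ?n (s - r) * ennpowr ?n r = ennpowr ?n s"
            using ennpowr_add[of "s - r" r ?n] rs \<open>1 \<le> r\<close> by simp
          moreover have "ennpowr (ennreal (B powr (1 / r))) (s - r) = ennreal (B powr ((s - r) / r))"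
            by (simp add: ennpowr_ennreal powr_powr)
          ultimately show ?thesis by (simp add: ennpowr_mult mult.assoc)
        qed
        also have "\<dots> = ennpowr (ennreal (B powr (1 / r - 1 / s)) * ?n) s"
        proof -
          have "(1 / r - 1 / s) * s = (s - r) / r" using rs \<open>1 \<le> r\<close> by (simp add: field_simps)
          then show ?thesis by (simp add: ennpowr_mult ennpowr_ennreal powr_powr)
        qed
        finally have "Lp_norm_1d (ennreal s) (smear h f) \<le> ennreal (B powr (1 / r - 1 / s)) * ?n"
          by (rule Lp_norm_le_powr[OF q'(1)])
        then show ?thesis using q' \<open>p = ennreal r\<close> \<open>recip p = 1 / r\<close> by simp
      qed
    qed
  qed
qed

section \<open>Mixed norms of convolutions\<close>

lemma upd_coord_simps [simp]:
  "upd_coord x i t $ i = t" "j \<noteq> i \<Longrightarrow> upd_coord x i t $ j = x $ j"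
  "upd_coord (upd_coord x i s) i t = upd_coord x i t"
  by (auto simp: upd_coord_def vec_eq_iff)

lemma upd_coord_commute: "i \<noteq> j \<Longrightarrow> upd_coord (upd_coord x i s) j t = upd_coord (upd_coord x j t) i s"
  by (auto simp: upd_coord_def vec_eq_iff)

lemma measurable_vec_nth [measurable]:
  fixes f :: "'a \<Rightarrow> real^'n::finite"
  assumes "f \<in> borel_measurable M" shows "(\<lambda>w. f w $ j) \<in> borel_measurable M"
  by (rule measurable_compose[OF assms borel_measurable_continuous_onI]) (intro continuous_intros)

lemma measurable_upd_coord [measurable]:
  fixes f :: "'a \<Rightarrow> real^'n::finite"
  assumes [measurable]: "f \<in> borel_measurable M" "g \<in> borel_measurable M"
  shows "(\<lambda>w. upd_coord (f w) i (g w)) \<in> borel_measurable M"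
proof (subst borel_measurable_euclidean_space, rule ballI)
  fix b :: "real^'n" assume "b \<in> Basis"
  then obtain j where b: "b = axis j 1" by (auto simp: Basis_vec_def)
  have "(\<lambda>w. if j = i then g w else f w $ j) \<in> borel_measurable M"
    by (cases "j = i") simp_all
  then show "(\<lambda>w. upd_coord (f w) i (g w) \<bullet> b) \<in> borel_measurable M"
    unfolding b by (simp add: inner_axis upd_coord_def)
qed

definition Lp_coord :: "ennreal \<Rightarrow> 'n::finite \<Rightarrow> (real^'n \<Rightarrow> ennreal) \<Rightarrow> real^'n \<Rightarrow> ennreal" where
  "Lp_coord p i F x = Lp_norm_1d p (\<lambda>t. F (upd_coord x i t))"

definition conv_coord :: "(real \<Rightarrow> ennreal) \<Rightarrow> 'n::finite \<Rightarrow> (real^'n \<Rightarrow> ennreal) \<Rightarrow> real^'n \<Rightarrow> ennreal" where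
  "conv_coord h i F x = smear h (\<lambda>t. F (upd_coord x i t)) (x $ i)"

text \<open>
  The recursion follows that of \<open>iterated_norm\<close>: the first listed coordinate is treated first.
\<close>
primrec conv_iter :: "(real \<Rightarrow> ennreal) \<Rightarrow> 'n::finite list \<Rightarrow> (real^'n \<Rightarrow> ennreal) \<Rightarrow> real^'n \<Rightarrow> ennreal" where
  "conv_iter h [] F = F"
| "conv_iter h (i # is) F = conv_iter h is (conv_coord h i F)"

lemma iterated_norm_Cons: "iterated_norm p (i # is) F = iterated_norm p is (Lp_coord (p i) i F)"
  by (simp add: Lp_coord_def[abs_def])

lemma Lp_coord_measurable [measurable]:
  assumes [measurable]: "F \<in> borel_measurable borel" and "1 \<le> p"
  shows "Lp_coord p i F \<in> borel_measurable borel"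
  unfolding Lp_coord_def by (rule Lp_norm_measurable[OF _ assms(2)]) measurable

lemma conv_coord_measurable [measurable]:
  assumes [measurable]: "F \<in> borel_measurable borel" "h \<in> borel_measurable borel"
  shows "conv_coord h i F \<in> borel_measurable borel"
  unfolding conv_coord_def smear_def by measurable

lemma conv_iter_measurable [measurable]:
  assumes "F \<in> borel_measurable borel" and [measurable]: "h \<in> borel_measurable borel"
  shows "conv_iter h is F \<in> borel_measurable borel"
  using assms(1) by (induction "is" arbitrary: F) auto

lemma conv_iter_mono: "(\<And>x. F x \<le> G x) \<Longrightarrow> conv_iter h is F x \<le> conv_iter h is G x"
proof (induction "is" arbitrary: F G)
  case (Cons i "is")
  have "conv_coord h i F x \<le> conv_coord h i G x" for x
    unfolding conv_coord_def smear_def by (intro nn_integral_mono mult_left_mono Cons.prems) auto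
  then show ?case using Cons.IH by simp
qed simp

lemma iterated_norm_mono:
  assumes "F \<in> borel_measurable borel" "\<And>x. F x \<le> G x" and p: "\<And>i. 1 \<le> p i"
  shows "iterated_norm p is F \<le> iterated_norm p is G"
  using assms(1,2)
proof (induction "is" arbitrary: F G)
  case (Cons i "is")
  note [measurable] = Cons.prems(1)
  have "Lp_coord (p i) i F x \<le> Lp_coord (p i) i G x" for x
    unfolding Lp_coord_def by (rule Lp_norm_mono[OF _ Cons.prems(2) p]) measurable
  then show ?case unfolding iterated_norm_Cons by (intro Cons.IH Lp_coord_measurable p Cons.prems)
qed simp

lemma iterated_norm_cmult_le:
  assumes "F \<in> borel_measurable borel" and p: "\<And>i. 1 \<le> p i"
  shows "iterated_norm p is (\<lambda>x. c * F x) \<le> c * iterated_norm p is F"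
  using assms(1)
proof (induction "is" arbitrary: F)
  case (Cons i "is")
  note [measurable] = Cons.prems
  have "iterated_norm p (i # is) (\<lambda>x. c * F x) \<le> iterated_norm p is (\<lambda>x. c * Lp_coord (p i) i F x)"
    unfolding iterated_norm_Cons
  proof (rule iterated_norm_mono[OF _ _ p])
    show "Lp_coord (p i) i (\<lambda>x. c * F x) x \<le> c * Lp_coord (p i) i F x" for x
      unfolding Lp_coord_def by (rule Lp_norm_cmult_le[OF _ p]) measurable
    show "Lp_coord (p i) i (\<lambda>x. c * F x) \<in> borel_measurable borel"
      by (rule Lp_coord_measurable[OF _ p]) measurable
  qed
  also have "\<dots> \<le> c * iterated_norm p is (Lp_coord (p i) i F)"
    by (intro Cons.IH Lp_coord_measurable p Cons.prems)
  finally show ?case unfolding iterated_norm_Cons .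
qed simp

text \<open>
  The norm in one coordinate passes under the convolutions in the other coordinates, by Minkowski's
  integral inequality.
\<close>
lemma Lp_coord_conv_iter_le:
  assumes "F \<in> borel_measurable borel" and h [measurable]: "h \<in> borel_measurable borel" and p: "1 \<le> p" and "i \<notin> set is"
  shows "Lp_coord p i (conv_iter h is F) x \<le> conv_iter h is (Lp_coord p i F) x"
  using assms(1,4)
proof (induction "is" arbitrary: F)
  case (Cons j "is")
  note [measurable] = Cons.prems(1)
  have ij: "i \<noteq> j" using Cons.prems by auto
  have "Lp_coord p i (conv_iter h (j # is) F) x \<le> conv_iter h is (Lp_coord p i (conv_coord h j F)) x"
    using Cons.prems by (simp add: Cons.IH)
  also have "\<dots> \<le> conv_iter h is (conv_coord h j (Lp_coord p i F)) x"
  proof (rule conv_iter_mono)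
    fix z
    let ?F = "\<lambda>t s. F (upd_coord (upd_coord z j (z $ j - s)) i t)"
    have "Lp_coord p i (conv_coord h j F) z = Lp_norm_1d p (\<lambda>t. \<integral>\<^sup>+ s. h s * ?F t s \<partial>lborel)"
      using ij by (simp add: Lp_coord_def conv_coord_def smear_def upd_coord_commute)
    also have "\<dots> \<le> (\<integral>\<^sup>+ s. Lp_norm_1d p (\<lambda>t. h s * ?F t s) \<partial>lborel)"
      by (rule Lp_minkowski[OF _ p]) measurable
    also have "\<dots> \<le> (\<integral>\<^sup>+ s. h s * Lp_norm_1d p (\<lambda>t. ?F t s) \<partial>lborel)"
    proof (rule nn_integral_mono)
      fix s show "Lp_norm_1d p (\<lambda>t. h s * ?F t s) \<le> h s * Lp_norm_1d p (\<lambda>t. ?F t s)"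
        by (rule Lp_norm_cmult_le[OF _ p]) measurable
    qed
    also have "\<dots> = conv_coord h j (Lp_coord p i F) z"
      by (simp add: Lp_coord_def conv_coord_def smear_def)
    finally show "Lp_coord p i (conv_coord h j F) z \<le> conv_coord h j (Lp_coord p i F) z" .
  qed
  finally show ?case by simp
qed simp

text \<open>
  In each coordinate the norm is first moved past the convolutions in the coordinates that follow;
  then it meets the convolution in its own coordinate, to which Young's inequality applies.
\<close>
lemma iterated_norm_conv_iter:
  assumes F: "F \<in> borel_measurable borel" and h [measurable]: "h \<in> borel_measurable borel"
    and h1: "(\<integral>\<^sup>+ s. h s \<partial>lborel) = 1" and hB: "\<And>s. h s \<le> ennreal B" and B: "0 < B"
    and p: "\<And>i. 1 \<le> p i" and pq: "\<And>i. p i \<le> q i" and "distinct is"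
  shows "iterated_norm q is (conv_iter h is F)
    \<le> ennreal (\<Prod>i\<in>set is. B powr (recip (p i) - recip (q i))) * iterated_norm p is F"
  using F \<open>distinct is\<close>
proof (induction "is" arbitrary: F)
  case (Cons i "is")
  note [measurable] = Cons.prems(1)
  have q: "1 \<le> q i" for i using p[of i] pq[of i] by simp
  let ?c = "ennreal (B powr (recip (p i) - recip (q i)))"
  let ?C = "ennreal (\<Prod>i\<in>set is. B powr (recip (p i) - recip (q i)))"
  have [measurable]: "Lp_coord (p i) i F \<in> borel_measurable borel" by (intro Lp_coord_measurable p Cons.prems)
  have young: "Lp_coord (q i) i (conv_coord h i F) x \<le> ?c * Lp_coord (p i) i F x" for x
  proof -
    have "Lp_coord (q i) i (conv_coord h i F) x = Lp_norm_1d (q i) (smear h (\<lambda>t. F (upd_coord x i t)))"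
      by (simp add: Lp_coord_def conv_coord_def)
    also have "\<dots> \<le> ?c * Lp_norm_1d (p i) (\<lambda>t. F (upd_coord x i t))"
      by (rule smear_young[OF h _ h1 hB B p pq]) measurable
    finally show ?thesis by (simp add: Lp_coord_def)
  qed
  have "iterated_norm q (i # is) (conv_iter h (i # is) F)
      = iterated_norm q is (Lp_coord (q i) i (conv_iter h is (conv_coord h i F)))"
    unfolding iterated_norm_Cons by simp
  also have "\<dots> \<le> iterated_norm q is (conv_iter h is (\<lambda>x. ?c * Lp_coord (p i) i F x))"
  proof (rule iterated_norm_mono[OF _ _ q])
    show "Lp_coord (q i) i (conv_iter h is (conv_coord h i F)) \<in> borel_measurable borel"
      by (rule Lp_coord_measurable[OF _ q]) measurable
    fix x
    have "Lp_coord (q i) i (conv_iter h is (conv_coord h i F)) x \<le> conv_iter h is (Lp_coord (q i) i (conv_coord h i F)) x"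
      by (rule Lp_coord_conv_iter_le[OF _ h q]) (use Cons.prems in auto)
    also have "\<dots> \<le> conv_iter h is (\<lambda>x. ?c * Lp_coord (p i) i F x) x"
      by (rule conv_iter_mono[OF young])
    finally show "Lp_coord (q i) i (conv_iter h is (conv_coord h i F)) x \<le> conv_iter h is (\<lambda>x. ?c * Lp_coord (p i) i F x) x" .
  qed
  also have "\<dots> \<le> ?C * iterated_norm p is (\<lambda>x. ?c * Lp_coord (p i) i F x)"
    by (rule Cons.IH) (use Cons.prems in auto)
  also have "\<dots> \<le> ?C * (?c * iterated_norm p is (Lp_coord (p i) i F))"
    by (intro mult_left_mono iterated_norm_cmult_le p) auto
  also have "\<dots> = ennreal (\<Prod>i\<in>set (i # is). B powr (recip (p i) - recip (q i))) * iterated_norm p (i # is) F"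
  proof -
    have "?C * ?c = ennreal (\<Prod>i\<in>set (i # is). B powr (recip (p i) - recip (q i)))"
      using Cons.prems by (simp add: ennreal_mult[symmetric] prod_nonneg mult.commute)
    then show ?thesis unfolding iterated_norm_Cons by (simp add: mult.assoc[symmetric])
  qed
  finally show ?case .
qed simp

text \<open>
  Fubini's theorem, one coordinate at a time; coordinates outside the list are not translated.
\<close>
lemma conv_iter_PiM:
  fixes F :: "real^'n::finite \<Rightarrow> ennreal"
  assumes "F \<in> borel_measurable borel" and h [measurable]: "h \<in> borel_measurable borel" and "distinct is"
  shows "conv_iter h is F x = (\<integral>\<^sup>+ y. (\<Prod>i\<in>set is. h (y i)) * F (\<chi> j. if j \<in> set is then x $ j - y j else x $ j) \<partial>(\<Pi>\<^sub>M i\<in>set is. lborel))"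
  using assms(1,3)
proof (induction "is" arbitrary: F)
  case Nil
  interpret product_sigma_finite "\<lambda>i::'n. lborel :: real measure" by standard
  show ?case by (simp add: PiM_empty)
next
  case (Cons i "is")
  note [measurable] = Cons.prems(1)
  interpret product_sigma_finite "\<lambda>i::'n. lborel :: real measure" by standard
  let ?z = "\<lambda>y. \<chi> j. if j \<in> set is then x $ j - y j else x $ j"
  let ?G = "\<lambda>y. (\<Prod>j\<in>set (i # is). h (y j)) * F (\<chi> j. if j \<in> set (i # is) then x $ j - y j else x $ j)"
  have i: "i \<notin> set is" using Cons.prems by simp
  have vec_meas: "(\<lambda>y. \<chi> j. if j \<in> J then x $ j - y j else x $ j) \<in> (\<Pi>\<^sub>M i\<in>J. (lborel :: real measure)) \<rightarrow>\<^sub>M (borel :: (real^'n) measure)" for J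
  proof (subst borel_measurable_euclidean_space, rule ballI)
    fix b :: "real^'n" assume "b \<in> Basis"
    then obtain j where b: "b = axis j 1" by (auto simp: Basis_vec_def)
    show "(\<lambda>y. (\<chi> j. if j \<in> J then x $ j - y j else x $ j) \<bullet> b) \<in> borel_measurable (\<Pi>\<^sub>M i\<in>J. (lborel :: real measure))"
      unfolding b by (cases "j \<in> J") (simp_all add: inner_axis)
  qed
  have h': "(\<lambda>y. h (y j)) \<in> borel_measurable (\<Pi>\<^sub>M i\<in>J. (lborel :: real measure))" if "j \<in> J" for j J
    by (rule measurable_compose[OF _ h]) (use that in measurable)
  have G: "?G \<in> borel_measurable (\<Pi>\<^sub>M i\<in>insert i (set is). (lborel :: real measure))"
    using measurable_compose[OF vec_meas Cons.prems(1), of "insert i (set is)"]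
    by (intro borel_measurable_times_ennreal borel_measurable_prod_ennreal h') auto
  have "conv_iter h (i # is) F x = (\<integral>\<^sup>+ y. (\<Prod>j\<in>set is. h (y j)) * conv_coord h i F (?z y) \<partial>(\<Pi>\<^sub>M i\<in>set is. lborel))"
    using Cons by simp
  also have "\<dots> = (\<integral>\<^sup>+ y. \<integral>\<^sup>+ s. ?G (y(i := s)) \<partial>lborel \<partial>(\<Pi>\<^sub>M i\<in>set is. lborel))"
  proof (intro nn_integral_cong)
    fix y
    have zi: "?z y $ i = x $ i" using i by simp
    have "?G (y(i := s)) = (\<Prod>j\<in>set is. h (y j)) * (h s * F (upd_coord (?z y) i (x $ i - s)))" for s
    proof -
      have "(\<Prod>j\<in>set is. h ((y(i := s)) j)) = (\<Prod>j\<in>set is. h (y j))"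
        using i by (intro prod.cong) auto
      moreover have "(\<chi> j. if j \<in> set (i # is) then x $ j - (y(i := s)) j else x $ j) = upd_coord (?z y) i (x $ i - s)"
        by (auto simp: upd_coord_def vec_eq_iff)
      ultimately show ?thesis using i by (simp add: mult_ac)
    qed
    then have "(\<integral>\<^sup>+ s. ?G (y(i := s)) \<partial>lborel) = (\<integral>\<^sup>+ s. (\<Prod>j\<in>set is. h (y j)) * (h s * F (upd_coord (?z y) i (x $ i - s))) \<partial>lborel)"
      by simp
    also have "\<dots> = (\<Prod>j\<in>set is. h (y j)) * (\<integral>\<^sup>+ s. h s * F (upd_coord (?z y) i (x $ i - s)) \<partial>lborel)"
      by (rule nn_integral_cmult) measurable
    also have "(\<integral>\<^sup>+ s. h s * F (upd_coord (?z y) i (x $ i - s)) \<partial>lborel) = conv_coord h i F (?z y)"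
      unfolding conv_coord_def smear_def zi ..
    finally show "(\<Prod>j\<in>set is. h (y j)) * conv_coord h i F (?z y) = (\<integral>\<^sup>+ s. ?G (y(i := s)) \<partial>lborel)" by simp
  qed
  also have "\<dots> = (\<integral>\<^sup>+ y. ?G y \<partial>(\<Pi>\<^sub>M i\<in>insert i (set is). lborel))"
    by (rule product_nn_integral_insert[symmetric, OF _ i G]) simp
  finally show ?case by simp
qed

lemma conv_iter_eq_integral:
  fixes F :: "real^'n::finite \<Rightarrow> ennreal"
  assumes [measurable]: "F \<in> borel_measurable borel" "h \<in> borel_measurable borel" and "distinct is" "set is = UNIV"
  shows "conv_iter h is F x = (\<integral>\<^sup>+ y. (\<Prod>i\<in>UNIV. h (y $ i)) * F (x - y) \<partial>lborel)"
proof -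
  have [measurable]: "(\<lambda>y :: real^'n. h (y $ i)) \<in> borel_measurable borel" for i
    by (rule measurable_compose[OF _ assms(2)]) measurable
  have "(\<chi> j. x $ j - y j) = x - (\<chi> j. y j)" for y :: "'n \<Rightarrow> real" by (simp add: vec_eq_iff)
  then show ?thesis
    unfolding conv_iter_PiM[OF assms(1-3)] assms(4) by (subst nn_integral_vec) simp_all
qed

text \<open>
  Where the integrand is not integrable, the Bochner integral is 0 and the bound is trivial.
\<close>
lemma convolve_le_conv_iter:
  fixes u k :: "real^'n::finite \<Rightarrow> complex"
  assumes [measurable]: "u \<in> borel_measurable borel" "k \<in> borel_measurable borel" "h \<in> borel_measurable borel"
    and h: "\<And>t. 0 \<le> h t" and A: "0 \<le> A" and k: "\<And>y. norm (k y) \<le> A * (\<Prod>i\<in>UNIV. h (y $ i))"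
    and "distinct is" "set is = UNIV"
  shows "ennreal (norm (convolve u k x)) \<le> ennreal A * conv_iter (\<lambda>t. ennreal (h t)) is (\<lambda>x. ennreal (norm (u x))) x"
proof -
  have [measurable]: "(\<lambda>y :: real^'n. h (y $ i)) \<in> borel_measurable borel" for i
    by (rule measurable_compose[OF _ assms(3)]) measurable
  have "ennreal (norm (convolve u k x)) \<le> (\<integral>\<^sup>+ y. ennreal (norm (u y * k (x - y))) \<partial>lborel)"
  proof (cases "integrable lborel (\<lambda>y. u y * k (x - y))")
    case True
    then show ?thesis unfolding convolve_def by (rule integral_norm_bound_ennreal)
  next
    case False
    then show ?thesis unfolding convolve_def by (simp add: not_integrable_integral_eq)
  qed
  also have "\<dots> = (\<integral>\<^sup>+ y. ennreal (norm (u (x - y) * k y)) \<partial>lborel)"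
    by (subst nn_integral_vec_affine[of _ "- 1" x]) simp_all
  also have "\<dots> \<le> (\<integral>\<^sup>+ y. ennreal A * ((\<Prod>i\<in>UNIV. ennreal (h (y $ i))) * ennreal (norm (u (x - y)))) \<partial>lborel)"
  proof (rule nn_integral_mono)
    fix y
    have "norm (u (x - y) * k y) \<le> norm (u (x - y)) * (A * (\<Prod>i\<in>UNIV. h (y $ i)))"
      unfolding norm_mult by (intro mult_left_mono k) auto
    also have "\<dots> = A * ((\<Prod>i\<in>UNIV. h (y $ i)) * norm (u (x - y)))" by simp
    finally have "ennreal (norm (u (x - y) * k y)) \<le> ennreal (A * ((\<Prod>i\<in>UNIV. h (y $ i)) * norm (u (x - y))))"
      by (rule ennreal_leI)
    also have "\<dots> = ennreal A * ((\<Prod>i\<in>UNIV. ennreal (h (y $ i))) * ennreal (norm (u (x - y))))"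
      using h A by (simp add: ennreal_mult prod_ennreal prod_nonneg)
    finally show "ennreal (norm (u (x - y) * k y)) \<le> ennreal A * ((\<Prod>i\<in>UNIV. ennreal (h (y $ i))) * ennreal (norm (u (x - y))))" .
  qed
  also have "\<dots> = ennreal A * (\<integral>\<^sup>+ y. (\<Prod>i\<in>UNIV. ennreal (h (y $ i))) * ennreal (norm (u (x - y))) \<partial>lborel)"
    by (rule nn_integral_cmult) measurable
  also have "\<dots> = ennreal A * conv_iter (\<lambda>t. ennreal (h t)) is (\<lambda>x. ennreal (norm (u x))) x"
    by (subst conv_iter_eq_integral[OF _ _ assms(7,8)]) auto
  finally show ?thesis .
qed

text \<open>
  The density of the Cauchy distribution with scale \<open>1 / l\<close>.
\<close>
definition cauchy_kernel :: "real \<Rightarrow> real \<Rightarrow> real" where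
  "cauchy_kernel l t = l / (pi * (1 + (l * t)\<^sup>2))"

lemma cauchy_kernel_measurable [measurable]: "cauchy_kernel l \<in> borel_measurable borel"
  unfolding cauchy_kernel_def by measurable

lemma cauchy_kernel_bounds:
  assumes "0 < l" shows "0 \<le> cauchy_kernel l t" "cauchy_kernel l t \<le> l"
proof -
  have "1 \<le> pi * (1 + (l * t)\<^sup>2)"
    using mult_mono[of 1 pi 1 "1 + (l * t)\<^sup>2"] pi_ge_two by simp
  then show "0 \<le> cauchy_kernel l t" "cauchy_kernel l t \<le> l"
    using assms by (auto simp: cauchy_kernel_def divide_le_eq mult_left_mono)
qed

lemma cauchy_kernel_integral:
  assumes l: "0 < l" shows "(\<integral>\<^sup>+ t. ennreal (cauchy_kernel l t) \<partial>lborel) = 1"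
proof -
  have "(\<integral>t. 1 / (1 + t\<^sup>2) \<partial>lborel) = pi"
    using LBINT_inverse_1_plus_square
    by (simp add: interval_lebesgue_integral_def set_lebesgue_integral_def einterval_eq_UNIV inverse_eq_divide)
  then have "(\<integral>\<^sup>+ t. ennreal (1 / (1 + t\<^sup>2)) \<partial>lborel) = ennreal pi"
    by (subst nn_integral_eq_integral[OF integrable_cauchy_density]) auto
  then have "ennreal pi = ennreal \<bar>l\<bar> * (\<integral>\<^sup>+ t. ennreal (1 / (1 + (0 + l * t)\<^sup>2)) \<partial>lborel)"
    using nn_integral_real_affine[of "\<lambda>t. ennreal (1 / (1 + t\<^sup>2))" l 0] l by simp
  moreover have "ennreal (cauchy_kernel l t) = ennreal (l / pi) * ennreal (1 / (1 + (0 + l * t)\<^sup>2))" for t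
    using l by (simp add: cauchy_kernel_def ennreal_mult[symmetric] add_nonneg_nonneg)
  ultimately have "ennreal pi * (\<integral>\<^sup>+ t. ennreal (cauchy_kernel l t) \<partial>lborel) = ennreal pi * (ennreal (l / pi) * (\<integral>\<^sup>+ t. ennreal (1 / (1 + (0 + l * t)\<^sup>2)) \<partial>lborel))"
    by (simp add: nn_integral_cmult)
  also have "\<dots> = ennreal l * (\<integral>\<^sup>+ t. ennreal (1 / (1 + (0 + l * t)\<^sup>2)) \<partial>lborel)"
    using l by (simp add: mult.assoc[symmetric] ennreal_mult[symmetric])
  also have "\<dots> = ennreal pi * 1" using \<open>ennreal pi = _\<close> l by simp
  finally show ?thesis by (subst (asm) ennreal_mult_cancel_left) auto
qed

lemma inverse_fourier_dilate:
  fixes m :: "real^'n::finite \<Rightarrow> complex"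
  assumes m: "m \<in> test_functions UNIV" and l: "0 < l"
  shows "inverse_fourier (\<lambda>\<xi>. m ((1 / l) *\<^sub>R \<xi>)) x = complex_of_real (l ^ CARD('n)) * inverse_fourier m (l *\<^sub>R x)"
proof -
  have "complex_of_real ((1 / l) ^ CARD('n)) * fourier (\<lambda>\<xi>. m ((1 / l) *\<^sub>R \<xi>)) ((1 / l) *\<^sub>R (l *\<^sub>R (- x))) = fourier m (l *\<^sub>R (- x))"
    by (rule fourier_dilate) (use smooth_measurable[OF test_functions_smooth[OF m]] l in auto)
  then have "fourier (\<lambda>\<xi>. m ((1 / l) *\<^sub>R \<xi>)) (- x) = complex_of_real (l ^ CARD('n)) * fourier m (- (l *\<^sub>R x))"
    using l by (simp add: field_simps power_divide)
  then show ?thesis by (simp add: inverse_fourier_def)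
qed

lemma inverse_fourier_dilate_bound:
  fixes m :: "real^'n::finite \<Rightarrow> complex"
  assumes m: "m \<in> test_functions UNIV"
  obtains A where "A > 0" "\<And>l x. 0 < l \<Longrightarrow> norm (inverse_fourier (\<lambda>\<xi>. m ((1 / l) *\<^sub>R \<xi>)) x) \<le> A * (\<Prod>i\<in>UNIV. cauchy_kernel l (x $ i))"
proof -
  obtain C where C: "C > 0" "\<And>x. norm (inverse_fourier m x) \<le> C / (1 + norm x) ^ (2 * CARD('n))"
    using inverse_fourier_decays[OF m] by (metis decaysE)
  show ?thesis
  proof (rule that[of "C * pi ^ CARD('n)"])
    fix l :: real and x :: "real^'n" assume l: "0 < l"
    have "norm (inverse_fourier (\<lambda>\<xi>. m ((1 / l) *\<^sub>R \<xi>)) x) = l ^ CARD('n) * norm (inverse_fourier m (l *\<^sub>R x))"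
      using l by (simp add: inverse_fourier_dilate[OF m l] norm_mult norm_power)
    also have "\<dots> \<le> l ^ CARD('n) * (C * (\<Prod>i\<in>UNIV. 1 / (1 + ((l *\<^sub>R x) $ i)\<^sup>2)))"
    proof (rule mult_left_mono)
      have "norm (inverse_fourier m (l *\<^sub>R x)) \<le> C * (1 / (1 + norm (l *\<^sub>R x)) ^ (2 * CARD('n)))"
        using C(2)[of "l *\<^sub>R x"] by simp
      also have "\<dots> \<le> C * (\<Prod>i\<in>UNIV. 1 / (1 + ((l *\<^sub>R x) $ i)\<^sup>2))"
        by (rule mult_left_mono[OF prod_le_weight]) (use C in auto)
      finally show "norm (inverse_fourier m (l *\<^sub>R x)) \<le> C * (\<Prod>i\<in>UNIV. 1 / (1 + ((l *\<^sub>R x) $ i)\<^sup>2))" .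
    qed (use l in auto)
    also have "\<dots> = C * pi ^ CARD('n) * (\<Prod>i\<in>UNIV. cauchy_kernel l (x $ i))"
    proof -
      have "(\<Prod>i\<in>(UNIV::'n set). cauchy_kernel l (x $ i)) = (\<Prod>i\<in>(UNIV::'n set). (l / pi) * (1 / (1 + (l * x $ i)\<^sup>2)))"
        by (simp add: cauchy_kernel_def)
      also have "\<dots> = (l / pi) ^ CARD('n) * (\<Prod>i\<in>UNIV. 1 / (1 + (l * x $ i)\<^sup>2))"
        by (simp only: prod.distrib prod_constant)
      finally have "pi ^ CARD('n) * (\<Prod>i\<in>(UNIV::'n set). cauchy_kernel l (x $ i)) = l ^ CARD('n) * (\<Prod>i\<in>UNIV. 1 / (1 + (l * x $ i)\<^sup>2))"
        by (simp add: power_divide)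
      then show ?thesis by (simp add: mult_ac)
    qed
    finally show "norm (inverse_fourier (\<lambda>\<xi>. m ((1 / l) *\<^sub>R \<xi>)) x) \<le> C * pi ^ CARD('n) * (\<Prod>i\<in>UNIV. cauchy_kernel l (x $ i))" .
  qed (use C in auto)
qed

text \<open>
  The dilated kernel is dominated by a multiple of a product of probability densities, for which
  Young's inequality holds with the power of \<open>l\<close> as its only constant.  So \<open>A\<close> depends on \<open>m\<close> alone.
\<close>
lemma mixed_norm_convolve:
  fixes m :: "real^'n::{finite,linorder} \<Rightarrow> complex"
  assumes m: "m \<in> test_functions UNIV"
  obtains A where "A > 0" "\<And>l p q u. 0 < l \<Longrightarrow> (\<And>i. 1 \<le> p i) \<Longrightarrow> (\<And>i. p i \<le> q i) \<Longrightarrow> u \<in> borel_measurable borel \<Longrightarrow>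
    mixed_norm q (convolve u (inverse_fourier (\<lambda>\<xi>. m ((1 / l) *\<^sub>R \<xi>))))
      \<le> ennreal (A * l powr (\<Sum>i\<in>UNIV. recip (p i) - recip (q i))) * mixed_norm p u"
proof -
  obtain A where A: "A > 0" "\<And>l x. 0 < l \<Longrightarrow> norm (inverse_fourier (\<lambda>\<xi>. m ((1 / l) *\<^sub>R \<xi>)) x) \<le> A * (\<Prod>i\<in>UNIV. cauchy_kernel l (x $ i))"
    by (rule inverse_fourier_dilate_bound[OF m]) blast
  show ?thesis
  proof (rule that[OF A(1)])
    fix l :: real and p q :: "'n \<Rightarrow> ennreal" and u :: "real^'n::_ \<Rightarrow> complex"
    assume l: "0 < l" and p: "\<And>i. 1 \<le> p i" and pq: "\<And>i. p i \<le> q i" and u [measurable]: "u \<in> borel_measurable borel"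
    let ?k = "inverse_fourier (\<lambda>\<xi>. m ((1 / l) *\<^sub>R \<xi>))" and ?L = "sorted_list_of_set (UNIV :: 'n set)"
    let ?h = "\<lambda>t. ennreal (cauchy_kernel l t)" and ?F = "\<lambda>x. ennreal (norm (u x))"
    have q: "1 \<le> q i" for i using p[of i] pq[of i] by simp
    have k [measurable]: "?k \<in> borel_measurable borel"
      by (intro inverse_fourier_measurable test_functions_scale m) (use l in auto)
    have c [measurable]: "convolve u ?k \<in> borel_measurable borel" by (rule convolve_measurable[OF u k])
    have "mixed_norm q (convolve u ?k) \<le> iterated_norm q ?L (\<lambda>x. ennreal A * conv_iter ?h ?L ?F x)"
      unfolding mixed_norm_def
    proof (rule iterated_norm_mono[OF _ _ q])
      show "ennreal (norm (convolve u ?k x)) \<le> ennreal A * conv_iter ?h ?L ?F x" for x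
        by (rule convolve_le_conv_iter[OF u k]) (use A l cauchy_kernel_bounds(1) in auto)
    qed measurable
    also have "\<dots> \<le> ennreal A * iterated_norm q ?L (conv_iter ?h ?L ?F)"
      by (rule iterated_norm_cmult_le[OF _ q]) measurable
    also have "\<dots> \<le> ennreal A * (ennreal (\<Prod>i\<in>set ?L. l powr (recip (p i) - recip (q i))) * iterated_norm p ?L ?F)"
      by (intro mult_left_mono iterated_norm_conv_iter cauchy_kernel_integral l p pq)
        (use cauchy_kernel_bounds(2)[OF l] in \<open>auto intro: ennreal_leI\<close>)
    also have "\<dots> = ennreal (A * l powr (\<Sum>i\<in>UNIV. recip (p i) - recip (q i))) * mixed_norm p u"
      using l A by (simp add: powr_sum ennreal_mult mixed_norm_def mult.assoc prod_nonneg)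
    finally show "mixed_norm q (convolve u ?k) \<le> ennreal (A * l powr (\<Sum>i\<in>UNIV. recip (p i) - recip (q i))) * mixed_norm p u" .
  qed
qed

lemma iterated_norm_top: "(\<And>i. 1 \<le> p i) \<Longrightarrow> iterated_norm p is (\<lambda>x. \<top>) = \<top>"
proof (induction "is")
  case (Cons i "is")
  have "Lp_coord (p i) i (\<lambda>x. \<top>) = (\<lambda>x. \<top>)" by (auto simp: Lp_coord_def Lp_norm_top_const Cons.prems)
  then show ?case using Cons by (simp only: iterated_norm_Cons)
qed simp

text \<open>
  A convolution of \<open>|u|\<close> with a product of Cauchy densities has finite mixed norm, so it is finite at
  some point \<open>x\<close>.  This is the claim with a weight centred at \<open>x\<close>, which Peetre's inequality moves to the
  origin.
\<close>
lemma mixed_Lebesgue_slow: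
  fixes u :: "real^'n::{finite,linorder} \<Rightarrow> complex"
  assumes u: "u \<in> mixed_Lebesgue p" and p: "\<And>i. 1 \<le> p i"
  shows "slow u"
proof -
  have [measurable]: "u \<in> borel_measurable borel" and fin: "mixed_norm p u < \<infinity>"
    using u by (auto simp: mixed_Lebesgue_def)
  let ?L = "sorted_list_of_set (UNIV :: 'n set)" and ?h = "\<lambda>t. ennreal (cauchy_kernel 1 t)" and ?F = "\<lambda>x. ennreal (norm (u x))"
  have "iterated_norm p ?L (conv_iter ?h ?L ?F) \<le> ennreal (\<Prod>i\<in>set ?L. 1 powr (recip (p i) - recip (p i))) * iterated_norm p ?L ?F"
    by (intro iterated_norm_conv_iter cauchy_kernel_integral p)
        (use cauchy_kernel_bounds(2)[of 1] in \<open>auto intro: ennreal_leI\<close>)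
  also have "\<dots> < \<infinity>" using fin by (simp add: mixed_norm_def)
  finally have *: "iterated_norm p ?L (conv_iter ?h ?L ?F) < \<infinity>" .
  \<comment> \<open>The constant \<open>\<infinity>\<close> has infinite norm for every exponent, as the line has infinite measure.\<close>
  have "\<exists>x. conv_iter ?h ?L ?F x \<noteq> \<top>"
  proof (rule ccontr)
    assume "\<nexists>x. conv_iter ?h ?L ?F x \<noteq> \<top>"
    then have "conv_iter ?h ?L ?F = (\<lambda>x. \<top>)" by auto
    moreover have "iterated_norm p ?L (\<lambda>x. \<top>) = \<top>" by (rule iterated_norm_top[OF p])
    ultimately show False using * by simp
  qed
  then obtain x where x: "conv_iter ?h ?L ?F x < \<top>" by (auto simp: less_top)
  have [measurable]: "(\<lambda>y :: real^'n::_. cauchy_kernel 1 (y $ i)) \<in> borel_measurable borel" for i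
    by (rule measurable_compose[OF _ cauchy_kernel_measurable]) measurable
  let ?M = "2 * CARD('n)" and ?K = "pi ^ CARD('n) * (1 + norm x) ^ (2 * CARD('n))"
  have "(\<integral>\<^sup>+ z. ennreal (norm (u z) / (1 + norm z) ^ ?M) \<partial>lborel)
      = (\<integral>\<^sup>+ y. ennreal (norm (u (x - y)) / (1 + norm (x - y)) ^ ?M) \<partial>lborel)"
    by (subst nn_integral_vec_affine[of _ "- 1" x]) simp_all
  also have "\<dots> \<le> (\<integral>\<^sup>+ y. ennreal ?K * ((\<Prod>i\<in>UNIV. ?h (y $ i)) * ?F (x - y)) \<partial>lborel)"
  proof (rule nn_integral_mono)
    fix y :: "real^'n::_"
    have pr: "(\<Prod>i\<in>UNIV. 1 / (1 + (y $ i)\<^sup>2)) = pi ^ CARD('n) * (\<Prod>i\<in>UNIV. cauchy_kernel 1 (y $ i))"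
    proof -
      have "(\<Prod>i\<in>(UNIV::'n set). 1 / (1 + (y $ i)\<^sup>2)) = (\<Prod>i\<in>(UNIV::'n set). pi * cauchy_kernel 1 (y $ i))"
        by (simp add: cauchy_kernel_def)
      then show ?thesis by (simp only: prod.distrib prod_constant)
    qed
    have "1 + norm y \<le> (1 + norm x) * (1 + norm (x - y))"
      using peetre[of y "x - y"] peetre[of "- y" "x - y"] by simp
    then have "(1 + norm y) ^ ?M \<le> (1 + norm x) ^ ?M * (1 + norm (x - y)) ^ ?M"
      by (subst power_mult_distrib[symmetric]) (intro power_mono, auto)
    then have "1 / (1 + norm (x - y)) ^ ?M \<le> (1 + norm x) ^ ?M * (1 / (1 + norm y) ^ ?M)"
      using weight_pos[of y ?M] weight_pos[of "x - y" ?M] by (simp add: divide_le_eq le_divide_eq mult_ac)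
    also have "\<dots> \<le> (1 + norm x) ^ ?M * (\<Prod>i\<in>UNIV. 1 / (1 + (y $ i)\<^sup>2))"
      by (rule mult_left_mono[OF prod_le_weight]) auto
    also have "\<dots> = ?K * (\<Prod>i\<in>UNIV. cauchy_kernel 1 (y $ i))" unfolding pr by simp
    finally have "norm (u (x - y)) * (1 / (1 + norm (x - y)) ^ ?M) \<le> norm (u (x - y)) * (?K * (\<Prod>i\<in>UNIV. cauchy_kernel 1 (y $ i)))"
      by (rule mult_left_mono) simp
    then have "ennreal (norm (u (x - y)) / (1 + norm (x - y)) ^ ?M) \<le> ennreal (?K * ((\<Prod>i\<in>UNIV. cauchy_kernel 1 (y $ i)) * norm (u (x - y))))"
      by (intro ennreal_leI) (simp add: mult_ac)
    also have "\<dots> = ennreal ?K * ((\<Prod>i\<in>UNIV. ?h (y $ i)) * ?F (x - y))"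
    proof -
      have "0 \<le> (\<Prod>i\<in>(UNIV::'n set). cauchy_kernel 1 (y $ i))" by (intro prod_nonneg cauchy_kernel_bounds ballI) auto
      moreover have "(\<Prod>i\<in>(UNIV::'n set). ?h (y $ i)) = ennreal (\<Prod>i\<in>UNIV. cauchy_kernel 1 (y $ i))"
        by (intro prod_ennreal cauchy_kernel_bounds) auto
      ultimately show ?thesis by (simp add: ennreal_mult)
    qed
    finally show "ennreal (norm (u (x - y)) / (1 + norm (x - y)) ^ ?M) \<le> ennreal ?K * ((\<Prod>i\<in>UNIV. ?h (y $ i)) * ?F (x - y))" .
  qed
  also have "\<dots> = ennreal ?K * (\<integral>\<^sup>+ y. (\<Prod>i\<in>UNIV. ?h (y $ i)) * ?F (x - y) \<partial>lborel)"
    by (rule nn_integral_cmult) measurable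
  also have "\<dots> = ennreal ?K * conv_iter ?h ?L ?F x"
    by (subst conv_iter_eq_integral) auto
  also have "\<dots> < \<infinity>" using x by (simp add: ennreal_mult_less_top)
  finally have "(\<integral>\<^sup>+ z. ennreal (norm (u z) / (1 + norm z) ^ ?M) \<partial>lborel) < \<infinity>" .
  then have "integrable lborel (\<lambda>z. norm (u z) / (1 + norm z) ^ ?M)"
    by (intro integrableI_bounded) auto
  then show ?thesis by (simp add: slow_def)
qed

text \<open>
  The function \<open>H\<close> marks the points where the inequality between \<open>F\<close> and \<open>G\<close> fails.  In every coordinate
  its norm is again 0 or \<open>\<infinity>\<close>, for any exponent, so that it may be computed with the exponent 1, that is,
  as an integral.
\<close>
lemma iterated_norm_le_add_null:
  assumes "F \<in> borel_measurable borel" "G \<in> borel_measurable borel" "H \<in> borel_measurable borel"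
    and "\<And>x. F x \<le> G x + H x" "\<And>x. H x = 0 \<or> H x = \<top>" and p: "\<And>i. 1 \<le> p i"
  shows "iterated_norm p is F \<le> iterated_norm p is G + iterated_norm (\<lambda>_. 1) is H"
  using assms(1-5)
proof (induction "is" arbitrary: F G H)
  case (Cons i "is")
  note [measurable] = Cons.prems(1-3)
  have 01: "Lp_coord 1 i H x = 0 \<or> Lp_coord 1 i H x = \<top>" for x
  proof -
    have "H y = \<top> * H y" for y using Cons.prems(5)[of y] by (auto simp: ennreal_top_mult)
    then have "Lp_coord 1 i H x = (\<integral>\<^sup>+ t. \<top> * H (upd_coord x i t) \<partial>lborel)" by (simp add: Lp_coord_def Lp_norm_1)
    also have "\<dots> = \<top> * (\<integral>\<^sup>+ t. H (upd_coord x i t) \<partial>lborel)" by (rule nn_integral_cmult) measurable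
    finally show ?thesis by (simp add: ennreal_top_mult)
  qed
  have "Lp_coord (p i) i F x \<le> Lp_coord (p i) i G x + Lp_coord 1 i H x" for x
  proof (cases "Lp_coord 1 i H x = 0")
    case True
    then have "AE t in lborel. H (upd_coord x i t) = 0"
      unfolding Lp_coord_def Lp_norm_1 by (subst (asm) nn_integral_0_iff_AE) auto
    then have "AE t in lborel. F (upd_coord x i t) \<le> G (upd_coord x i t)"
      by eventually_elim (metis Cons.prems(4) add.right_neutral)
    then have "Lp_coord (p i) i F x \<le> Lp_coord (p i) i G x"
      unfolding Lp_coord_def by (intro Lp_norm_mono_AE p) measurable
    then show ?thesis by (simp add: add_increasing2)
  qed (use 01[of x] in simp)
  then show ?case unfolding iterated_norm_Cons
    by (intro Cons.IH Lp_coord_measurable Cons.prems 01 p) auto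
qed simp

lemma iterated_norm_1: "iterated_norm (\<lambda>_. 1) is F = conv_iter (\<lambda>_. 1) is F 0" if "F \<in> borel_measurable borel" "distinct is" for F
proof -
  have "iterated_norm (\<lambda>_. 1) is F = conv_iter (\<lambda>_. 1) is F 0" if "F \<in> borel_measurable borel" for F
    using that
  proof (induction "is" arbitrary: F)
    case (Cons i "is")
    note [measurable] = Cons.prems
    have "Lp_coord 1 i F = conv_coord (\<lambda>_. 1) i F"
    proof
      fix x
      show "Lp_coord 1 i F x = conv_coord (\<lambda>_. 1) i F x"
        using nn_integral_shift_reflect(2)[of "\<lambda>t. F (upd_coord x i t)" "x $ i"]
        by (simp add: Lp_coord_def Lp_norm_1 conv_coord_def smear_def)
    qed
    then show ?case using Cons by (simp only: iterated_norm_Cons conv_iter.simps) simp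
  qed simp
  then show ?thesis using that by simp
qed

lemma mixed_norm_mono_AE:
  fixes f g :: "real^'n::{finite,linorder} \<Rightarrow> complex"
  assumes f [measurable]: "f \<in> borel_measurable borel" and g [measurable]: "g \<in> borel_measurable borel"
    and le: "AE x in lborel. norm (f x) \<le> norm (g x)" and p: "\<And>i. 1 \<le> p i"
  shows "mixed_norm p f \<le> mixed_norm p g"
proof -
  let ?L = "sorted_list_of_set (UNIV :: 'n set)"
  define H where "H x = (if norm (f x) \<le> norm (g x) then 0 else \<top> :: ennreal)" for x
  have H [measurable]: "H \<in> borel_measurable borel" unfolding H_def by measurable
  have "iterated_norm (\<lambda>_. 1) ?L H = (\<integral>\<^sup>+ y. (\<Prod>i\<in>(UNIV::'n set). 1) * H (0 - y) \<partial>lborel)"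
    unfolding iterated_norm_1[OF H distinct_sorted_list_of_set] by (subst conv_iter_eq_integral) auto
  also have "\<dots> = (\<integral>\<^sup>+ y. H y \<partial>lborel)"
    by (subst (2) nn_integral_vec_affine[of _ "- 1" 0]) simp_all
  also have "\<dots> = 0"
    using le by (subst nn_integral_0_iff_AE) (auto simp: H_def elim: eventually_mono)
  finally have 0: "iterated_norm (\<lambda>_. 1) ?L H = 0" .
  have "mixed_norm p f \<le> mixed_norm p g + iterated_norm (\<lambda>_. 1) ?L H"
    unfolding mixed_norm_def by (rule iterated_norm_le_add_null) (auto simp: H_def p intro: ennreal_leI)
  then show ?thesis using 0 by simp
qed

section \<open>Triangle inequality for mixed norms\<close>

text \<open>
  This is Minkowski's integral inequality for the integrand that equals \<open>f\<close> for \<open>y\<close> in \<open>[0, 1)\<close> and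
  \<open>g\<close> for \<open>y\<close> in \<open>[1, 2)\<close>.
\<close>
lemma Lp_norm_triangle:
  assumes [measurable]: "f \<in> borel_measurable borel" "g \<in> borel_measurable borel" and p: "1 \<le> p"
  shows "Lp_norm_1d p (\<lambda>t. f t + g t) \<le> Lp_norm_1d p f + Lp_norm_1d p g"
proof -
  let ?a = "indicator {0..<1::real} :: real \<Rightarrow> ennreal" and ?b = "indicator {1..<2::real} :: real \<Rightarrow> ennreal"
  have zero: "Lp_norm_1d p (\<lambda>t. 0) \<le> 0"
    using Lp_norm_cmult_le[of f p 0] p by simp
  have "(\<integral>\<^sup>+ y. ?a y * c + ?b y * d \<partial>lborel) = c + d" for c d :: ennreal
    by (subst nn_integral_add) (auto simp: nn_integral_multc)
  note ab = this
  have "Lp_norm_1d p (\<lambda>t. f t + g t) = Lp_norm_1d p (\<lambda>t. \<integral>\<^sup>+ y. ?a y * f t + ?b y * g t \<partial>lborel)"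
    unfolding ab ..
  also have "\<dots> \<le> (\<integral>\<^sup>+ y. Lp_norm_1d p (\<lambda>t. ?a y * f t + ?b y * g t) \<partial>lborel)"
    by (rule Lp_minkowski[OF _ p]) measurable
  also have "\<dots> \<le> (\<integral>\<^sup>+ y. ?a y * Lp_norm_1d p f + ?b y * Lp_norm_1d p g \<partial>lborel)"
  proof (rule nn_integral_mono)
    fix y :: real
    consider "y \<in> {0..<1}" "y \<notin> {1..<2}" | "y \<notin> {0..<1}" "y \<in> {1..<2}" | "y \<notin> {0..<1}" "y \<notin> {1..<2}" by fastforce
    then show "Lp_norm_1d p (\<lambda>t. ?a y * f t + ?b y * g t) \<le> ?a y * Lp_norm_1d p f + ?b y * Lp_norm_1d p g"
      by cases (use zero in simp_all)
  qed
  also have "\<dots> = Lp_norm_1d p f + Lp_norm_1d p g" by (rule ab)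
  finally show ?thesis .
qed

lemma iterated_norm_triangle:
  assumes "F \<in> borel_measurable borel" "G \<in> borel_measurable borel" and p: "\<And>i. 1 \<le> p i"
  shows "iterated_norm p is (\<lambda>x. F x + G x) \<le> iterated_norm p is F + iterated_norm p is G"
  using assms(1,2)
proof (induction "is" arbitrary: F G)
  case (Cons i "is")
  note [measurable] = Cons.prems
  have "iterated_norm p (i # is) (\<lambda>x. F x + G x) \<le> iterated_norm p is (\<lambda>x. Lp_coord (p i) i F x + Lp_coord (p i) i G x)"
    unfolding iterated_norm_Cons
  proof (rule iterated_norm_mono[OF _ _ p])
    show "Lp_coord (p i) i (\<lambda>x. F x + G x) \<in> borel_measurable borel"
      by (rule Lp_coord_measurable[OF _ p]) measurable
    show "Lp_coord (p i) i (\<lambda>x. F x + G x) x \<le> Lp_coord (p i) i F x + Lp_coord (p i) i G x" for x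
      unfolding Lp_coord_def by (rule Lp_norm_triangle[OF _ _ p]) measurable
  qed
  also have "\<dots> \<le> iterated_norm p is (Lp_coord (p i) i F) + iterated_norm p is (Lp_coord (p i) i G)"
    by (intro Cons.IH Lp_coord_measurable p Cons.prems)
  finally show ?case unfolding iterated_norm_Cons .
qed simp

lemma mixed_norm_cmult_le:
  assumes [measurable]: "f \<in> borel_measurable borel" and p: "\<And>i. 1 \<le> p i"
  shows "mixed_norm p (\<lambda>x. c * f x) \<le> ennreal (norm c) * mixed_norm p f"
  using iterated_norm_cmult_le[of "\<lambda>x. ennreal (norm (f x))" p _ "ennreal (norm c)"] p
  by (simp add: mixed_norm_def norm_mult ennreal_mult)

lemma mixed_norm_sum_le:
  fixes f :: "'i \<Rightarrow> real^'n::{finite,linorder} \<Rightarrow> complex"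
  assumes "finite I" and f: "\<And>j. f j \<in> borel_measurable borel" and p: "\<And>i. 1 \<le> p i"
  shows "mixed_norm p (\<lambda>x. \<Sum>j\<in>I. f j x) \<le> (\<Sum>j\<in>I. mixed_norm p (f j))"
  using assms(1)
proof (induction I)
  case empty
  have "mixed_norm p (\<lambda>x. 0 * f undefined x) \<le> ennreal (norm (0::complex)) * mixed_norm p (f undefined)"
    by (rule mixed_norm_cmult_le[OF f p])
  then show ?case by simp
next
  case (insert j I)
  note [measurable] = f
  let ?L = "sorted_list_of_set (UNIV :: 'n set)"
  have "mixed_norm p (\<lambda>x. \<Sum>j\<in>insert j I. f j x)
      \<le> iterated_norm p ?L (\<lambda>x. ennreal (norm (f j x)) + ennreal (norm (\<Sum>j\<in>I. f j x)))"
    unfolding mixed_norm_def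
  proof (rule iterated_norm_mono[OF _ _ p])
    fix x
    show "ennreal (norm (\<Sum>j\<in>insert j I. f j x)) \<le> ennreal (norm (f j x)) + ennreal (norm (\<Sum>j\<in>I. f j x))"
      using insert.hyps norm_triangle_ineq[of "f j x" "\<Sum>j\<in>I. f j x"]
      by (simp add: ennreal_leI flip: ennreal_plus)
  qed measurable
  also have "\<dots> \<le> mixed_norm p (f j) + mixed_norm p (\<lambda>x. \<Sum>j\<in>I. f j x)"
    unfolding mixed_norm_def by (rule iterated_norm_triangle[OF _ _ p]) measurable
  also have "\<dots> \<le> mixed_norm p (f j) + (\<Sum>j\<in>I. mixed_norm p (f j))"
    by (intro add_left_mono insert.IH)
  finally show ?case using insert.hyps by simp
qed

section \<open>One-step estimates\<close>

lemma convolve_cmult: "convolve u (\<lambda>x. c * k x) = (\<lambda>x. c * convolve u k x)"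
  by (auto simp: convolve_def mult.left_commute)

lemma inverse_fourier_cmult: "inverse_fourier (\<lambda>\<xi>. c * m \<xi>) = (\<lambda>x. c * inverse_fourier m x)"
  by (simp add: inverse_fourier_def[abs_def] fourier_cmult)

lemma low_pass_exists:
  fixes R :: real
  assumes "0 < R"
  obtains m :: "real^'n::finite \<Rightarrow> complex" where "m \<in> test_functions UNIV" "\<And>\<xi>. norm \<xi> < 2 * R \<Longrightarrow> m \<xi> = 1"
proof -
  obtain \<beta> :: "real^'n \<Rightarrow> real" where \<beta>: "smooth (\<lambda>x. complex_of_real (\<beta> x))"
    "\<And>x. norm (x - 0) \<le> 2 * R \<Longrightarrow> \<beta> x = 1" "\<And>x. 3 * R \<le> norm (x - 0) \<Longrightarrow> \<beta> x = 0"
    by (rule smooth_bump_exists[of "2 * R" "3 * R" 0]) (use assms in auto)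
  show ?thesis
  proof (rule that)
    show "(\<lambda>x. complex_of_real (\<beta> x)) \<in> test_functions UNIV"
      by (rule test_functionsI[OF \<beta>(1), of "3 * R"]) (use \<beta>(3) in \<open>force simp: not_le[symmetric]\<close>)
  qed (use \<beta>(2) in auto)
qed

lemma dilated_ball:
  fixes m :: "real^'n::finite \<Rightarrow> complex"
  assumes m: "\<And>\<xi>. norm \<xi> < 2 * R \<Longrightarrow> m \<xi> = 1" and "0 < R" "0 < l" "S \<subseteq> {\<xi>. norm \<xi> \<le> l * R}"
  shows "open (ball (0 :: real^'n) (2 * l * R))" "S \<subseteq> ball 0 (2 * l * R)"
    "\<And>\<xi>. \<xi> \<in> ball 0 (2 * l * R) \<Longrightarrow> m ((1 / l) *\<^sub>R \<xi>) = 1"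
proof -
  show "S \<subseteq> ball 0 (2 * l * R)"
  proof
    fix \<xi> assume "\<xi> \<in> S"
    then have "norm \<xi> \<le> l * R" using assms(4) by auto
    moreover have "0 < l * R" using assms by simp
    ultimately show "\<xi> \<in> ball 0 (2 * l * R)" by simp
  qed
  show "m ((1 / l) *\<^sub>R \<xi>) = 1" if "\<xi> \<in> ball 0 (2 * l * R)" for \<xi>
    using that assms(3) by (intro m) (simp add: field_simps)
qed simp

text \<open>
  The kernel that reproduces \<open>u\<close> also maps into the space with the larger exponents.
\<close>
lemma band_limited_embedding:
  assumes R: "0 < R"
  obtains A where "A > 0" "\<And>l (p :: 'n::{finite,linorder} \<Rightarrow> ennreal) q u. 0 < l \<Longrightarrow> (\<And>i. 1 \<le> p i) \<Longrightarrow> (\<And>i. p i \<le> q i) \<Longrightarrow>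
    u \<in> mixed_Lebesgue p \<Longrightarrow> spectrum u \<subseteq> {\<xi>. norm \<xi> \<le> l * R} \<Longrightarrow>
    mixed_norm q u \<le> ennreal (A * l powr (\<Sum>i\<in>UNIV. recip (p i) - recip (q i))) * mixed_norm p u"
proof -
  obtain m :: "real^'n::_ \<Rightarrow> complex" where m: "m \<in> test_functions UNIV" "\<And>\<xi>. norm \<xi> < 2 * R \<Longrightarrow> m \<xi> = 1"
    using low_pass_exists[OF R] by blast
  obtain A where A: "A > 0" "\<And>l p q u. 0 < l \<Longrightarrow> (\<And>i. 1 \<le> p i) \<Longrightarrow> (\<And>i. p i \<le> q i) \<Longrightarrow> u \<in> borel_measurable borel \<Longrightarrow>
    mixed_norm q (convolve u (inverse_fourier (\<lambda>\<xi>. m ((1 / l) *\<^sub>R \<xi>))))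
      \<le> ennreal (A * l powr (\<Sum>i\<in>UNIV. recip (p i) - recip (q i))) * mixed_norm p u"
    by (rule mixed_norm_convolve[OF m(1)]) blast
  show ?thesis
  proof (rule that[OF A(1)])
    fix l and p q :: "'n \<Rightarrow> ennreal" and u :: "real^'n::_ \<Rightarrow> complex"
    assume l: "0 < l" and p: "\<And>i. 1 \<le> p i" and pq: "\<And>i. p i \<le> q i" and u: "u \<in> mixed_Lebesgue p"
      and sp: "spectrum u \<subseteq> {\<xi>. norm \<xi> \<le> l * R}"
    have q: "1 \<le> q i" for i using p[of i] pq[of i] by simp
    have mu: "u \<in> borel_measurable borel" using u by (simp add: mixed_Lebesgue_def)
    have ml: "(\<lambda>\<xi>. m ((1 / l) *\<^sub>R \<xi>)) \<in> test_functions UNIV" by (rule test_functions_scale[OF m(1)]) (use l in simp)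
    have db: "open (ball (0 :: real^'n::_) (2 * l * R))" "spectrum u \<subseteq> ball 0 (2 * l * R)"
      "\<And>\<xi>. \<xi> \<in> ball 0 (2 * l * R) \<Longrightarrow> m ((1 / l) *\<^sub>R \<xi>) = 1"
      using dilated_ball[of R m l "spectrum u"] m(2) R l sp by blast+
    have ae: "AE x in lborel. u x = convolve u (inverse_fourier (\<lambda>\<xi>. m ((1 / l) *\<^sub>R \<xi>))) x"
      by (rule spectrum_reproduce[OF mixed_Lebesgue_slow[OF u p] ml db(1,2)]) (rule db(3))
    have "mixed_norm q u \<le> mixed_norm q (convolve u (inverse_fourier (\<lambda>\<xi>. m ((1 / l) *\<^sub>R \<xi>))))"
    proof (rule mixed_norm_mono_AE[OF mu convolve_measurable[OF mu inverse_fourier_measurable[OF ml]] _ q])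
      show "AE x in lborel. norm (u x) \<le> norm (convolve u (inverse_fourier (\<lambda>\<xi>. m ((1 / l) *\<^sub>R \<xi>))) x)"
        using ae by eventually_elim simp
    qed
    also have "\<dots> \<le> ennreal (A * l powr (\<Sum>i\<in>UNIV. recip (p i) - recip (q i))) * mixed_norm p u"
      by (rule A(2)[OF l p pq mu])
    finally show "mixed_norm q u \<le> ennreal (A * l powr (\<Sum>i\<in>UNIV. recip (p i) - recip (q i))) * mixed_norm p u" .
  qed
qed

lemma uniform_convolve_bound:
  fixes m :: "'n \<Rightarrow> real^'n::{finite,linorder} \<Rightarrow> complex"
  assumes m: "\<And>j. m j \<in> test_functions UNIV"
  obtains A where "A > 0" "\<And>j l p u. 0 < l \<Longrightarrow> (\<And>i. 1 \<le> p i) \<Longrightarrow> u \<in> borel_measurable borel \<Longrightarrow>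
    mixed_norm p (convolve u (inverse_fourier (\<lambda>\<xi>. m j ((1 / l) *\<^sub>R \<xi>)))) \<le> ennreal A * mixed_norm p u"
proof -
  have "\<exists>A>0. \<forall>l p u. 0 < l \<longrightarrow> (\<forall>i. 1 \<le> p i) \<longrightarrow> u \<in> borel_measurable borel \<longrightarrow>
    mixed_norm p (convolve u (inverse_fourier (\<lambda>\<xi>. m j ((1 / l) *\<^sub>R \<xi>)))) \<le> ennreal A * mixed_norm p u" for j
  proof -
    obtain A where A: "A > 0" "\<And>l p q u. 0 < l \<Longrightarrow> (\<And>i. 1 \<le> p i) \<Longrightarrow> (\<And>i. p i \<le> q i) \<Longrightarrow> u \<in> borel_measurable borel \<Longrightarrow>
      mixed_norm q (convolve u (inverse_fourier (\<lambda>\<xi>. m j ((1 / l) *\<^sub>R \<xi>))))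
        \<le> ennreal (A * l powr (\<Sum>i\<in>UNIV. recip (p i) - recip (q i))) * mixed_norm p u"
      by (rule mixed_norm_convolve[OF m]) blast
    show ?thesis
    proof (intro exI[of _ A] conjI allI impI A(1))
      fix l :: real and p :: "'n \<Rightarrow> ennreal" and u :: "real^'n::_ \<Rightarrow> complex"
      assume "0 < l" "\<forall>i. 1 \<le> p i" "u \<in> borel_measurable borel"
      then show "mixed_norm p (convolve u (inverse_fourier (\<lambda>\<xi>. m j ((1 / l) *\<^sub>R \<xi>)))) \<le> ennreal A * mixed_norm p u"
        using A(2)[of l p p u] by simp
    qed
  qed
  then obtain A where A: "\<And>j. A j > 0" "\<And>j l p u. 0 < l \<Longrightarrow> (\<And>i. 1 \<le> p i) \<Longrightarrow> u \<in> borel_measurable borel \<Longrightarrow>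
    mixed_norm p (convolve u (inverse_fourier (\<lambda>\<xi>. m j ((1 / l) *\<^sub>R \<xi>)))) \<le> ennreal (A j) * mixed_norm p u"
    by metis
  show ?thesis
  proof (rule that)
    show "0 < (\<Sum>j\<in>UNIV. A j)" by (rule sum_pos) (use A in auto)
    fix j and l :: real and p :: "'n \<Rightarrow> ennreal" and u :: "real^'n::_ \<Rightarrow> complex"
    assume a: "0 < l" "\<And>i. 1 \<le> p i" "u \<in> borel_measurable borel"
    have "A j \<le> (\<Sum>j\<in>UNIV. A j)" by (rule member_le_sum) (use A(1) in \<open>auto intro: less_imp_le\<close>)
    then have "ennreal (A j) * mixed_norm p u \<le> ennreal (\<Sum>j\<in>UNIV. A j) * mixed_norm p u"
      by (intro mult_right_mono ennreal_leI) auto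
    with A(2)[OF a] show "mixed_norm p (convolve u (inverse_fourier (\<lambda>\<xi>. m j ((1 / l) *\<^sub>R \<xi>)))) \<le> ennreal (\<Sum>j\<in>UNIV. A j) * mixed_norm p u"
      by (rule order_trans)
  qed
qed

text \<open>
  The multiplier \<open>\<i> \<xi>\<^sub>j m (\<xi> / l)\<close> is \<open>l\<close> times the dilation of the fixed test function \<open>\<i> \<xi>\<^sub>j m \<xi>\<close>.
\<close>
lemma band_limited_derivative:
  assumes R: "0 < R"
  obtains A where "A > 0" "\<And>l (p :: 'n::{finite,linorder} \<Rightarrow> ennreal) u j. 0 < l \<Longrightarrow> (\<And>i. 1 \<le> p i) \<Longrightarrow>
    u \<in> mixed_Lebesgue p \<Longrightarrow> spectrum u \<subseteq> {\<xi>. norm \<xi> \<le> l * R} \<Longrightarrow>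
    \<exists>g\<in>mixed_Lebesgue p. weak_partial j u g \<and> mixed_norm p g \<le> ennreal (A * l) * mixed_norm p u"
proof -
  obtain m :: "real^'n::_ \<Rightarrow> complex" where m: "m \<in> test_functions UNIV" "\<And>\<xi>. norm \<xi> < 2 * R \<Longrightarrow> m \<xi> = 1"
    using low_pass_exists[OF R] by blast
  define \<mu> where "\<mu> j \<xi> = \<i> * complex_of_real (\<xi> $ j) * m \<xi>" for j \<xi>
  have \<mu>: "\<mu> j \<in> test_functions UNIV" for j
    unfolding \<mu>_def by (rule test_functions_coord_mult[OF m(1)])
  obtain A where A: "A > 0" "\<And>j l p u. 0 < l \<Longrightarrow> (\<And>i. 1 \<le> p i) \<Longrightarrow> u \<in> borel_measurable borel \<Longrightarrow>
    mixed_norm p (convolve u (inverse_fourier (\<lambda>\<xi>. \<mu> j ((1 / l) *\<^sub>R \<xi>)))) \<le> ennreal A * mixed_norm p u"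
    by (rule uniform_convolve_bound[of \<mu>]) (auto intro: \<mu>)
  show ?thesis
  proof (rule that[OF A(1)])
    fix l and p :: "'n \<Rightarrow> ennreal" and u :: "real^'n::_ \<Rightarrow> complex" and j
    assume l: "0 < l" and p: "\<And>i. 1 \<le> p i" and u: "u \<in> mixed_Lebesgue p"
      and sp: "spectrum u \<subseteq> {\<xi>. norm \<xi> \<le> l * R}"
    have mu: "u \<in> borel_measurable borel" and fin: "mixed_norm p u < \<infinity>" using u by (auto simp: mixed_Lebesgue_def)
    have ml: "(\<lambda>\<xi>. m ((1 / l) *\<^sub>R \<xi>)) \<in> test_functions UNIV" by (rule test_functions_scale[OF m(1)]) (use l in simp)
    let ?k = "inverse_fourier (\<lambda>\<xi>. \<mu> j ((1 / l) *\<^sub>R \<xi>))"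
    define g where "g = convolve u (inverse_fourier (\<lambda>\<xi>. \<i> * complex_of_real (\<xi> $ j) * m ((1 / l) *\<^sub>R \<xi>)))"
    have k: "?k \<in> borel_measurable borel"
      by (intro inverse_fourier_measurable test_functions_scale \<mu>) (use l in simp)
    have db: "open (ball (0 :: real^'n::_) (2 * l * R))" "spectrum u \<subseteq> ball 0 (2 * l * R)"
      "\<And>\<xi>. \<xi> \<in> ball 0 (2 * l * R) \<Longrightarrow> m ((1 / l) *\<^sub>R \<xi>) = 1"
      using dilated_ball[of R m l "spectrum u"] m(2) R l sp by blast+
    have w: "weak_partial j u g"
      unfolding g_def by (rule spectrum_weak_partial[OF mixed_Lebesgue_slow[OF u p] ml db(1,2)]) (rule db(3))
    have e: "(\<lambda>\<xi>. \<i> * complex_of_real (\<xi> $ j) * m ((1 / l) *\<^sub>R \<xi>)) = (\<lambda>\<xi>. complex_of_real l * \<mu> j ((1 / l) *\<^sub>R \<xi>))"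
      using l by (auto simp: \<mu>_def)
    have g: "g = (\<lambda>x. complex_of_real l * convolve u ?k x)"
      unfolding g_def e inverse_fourier_cmult convolve_cmult ..
    have c: "convolve u ?k \<in> borel_measurable borel" by (rule convolve_measurable[OF mu k])
    have "mixed_norm p g \<le> ennreal l * mixed_norm p (convolve u ?k)"
      using mixed_norm_cmult_le[OF c p, where c="complex_of_real l"] l by (simp add: g)
    also have "\<dots> \<le> ennreal l * (ennreal A * mixed_norm p u)"
      by (intro mult_left_mono A(2) l p mu) auto
    also have "\<dots> = ennreal (A * l) * mixed_norm p u"
      using A(1) l by (simp add: ennreal_mult mult_ac)
    finally have le: "mixed_norm p g \<le> ennreal (A * l) * mixed_norm p u" .
    also have "\<dots> < \<infinity>" using fin by (simp add: ennreal_mult_less_top)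
    finally have "g \<in> mixed_Lebesgue p" using c by (simp add: mixed_Lebesgue_def g)
    with w le show "\<exists>g\<in>mixed_Lebesgue p. weak_partial j u g \<and> mixed_norm p g \<le> ennreal (A * l) * mixed_norm p u" by blast
  qed
qed

text \<open>
  The multipliers are \<open>- \<i> \<xi>\<^sub>j / |\<xi>|\<^sup>2\<close>, multiplied by a cutoff for large \<open>\<xi>\<close> and made smooth at the origin
  by a bump that is added to the denominator.  In the annulus cutoff and bump are 1 and 0, and the
  sum is \<open>(\<Sum>j. \<xi>\<^sub>j\<^sup>2) / |\<xi>|\<^sup>2\<close>.
\<close>
lemma annulus_multipliers_exist:
  fixes r1 r2 :: real
  assumes r: "0 < r1" "r1 < r2"
  obtains m :: "'n::finite \<Rightarrow> real^'n \<Rightarrow> complex" where "\<And>j. m j \<in> test_functions UNIV"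
    "\<And>\<xi>. r1 / 2 < norm \<xi> \<Longrightarrow> norm \<xi> < 2 * r2 \<Longrightarrow> (\<Sum>j\<in>UNIV. \<i> * complex_of_real (\<xi> $ j) * m j \<xi>) = 1"
proof -
  obtain \<chi>' :: "real^'n \<Rightarrow> complex" where \<chi>': "\<chi>' \<in> test_functions UNIV" "\<And>\<xi>. norm \<xi> < 2 * r2 \<Longrightarrow> \<chi>' \<xi> = 1"
    using low_pass_exists[of r2] r by auto
  obtain b :: "real^'n \<Rightarrow> real" where b: "smooth (\<lambda>x. complex_of_real (b x))"
    "\<And>x. norm (x - 0) \<le> r1 / 4 \<Longrightarrow> b x = 1" "\<And>x. r1 / 2 \<le> norm (x - 0) \<Longrightarrow> b x = 0" "\<And>x. 0 \<le> b x"
    by (rule smooth_bump_exists[of "r1 / 4" "r1 / 2" 0]) (use r in auto)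
  let ?D = "\<lambda>\<xi>. complex_of_real ((norm (\<xi> - 0))\<^sup>2) + complex_of_real (b \<xi>)"
  have D: "?D \<xi> \<noteq> 0" for \<xi>
  proof -
    have "(norm \<xi>)\<^sup>2 + b \<xi> > 0"
    proof (cases "\<xi> = 0")
      case True then show ?thesis using b(2)[of 0] r by simp
    next
      case False then show ?thesis using b(4)[of \<xi>] by (simp add: add_pos_nonneg)
    qed
    then have "complex_of_real ((norm \<xi>)\<^sup>2 + b \<xi>) \<noteq> 0" by (simp only: of_real_eq_0_iff)
    then show ?thesis by simp
  qed
  have sD: "smooth (\<lambda>\<xi>. inverse (?D \<xi>))" by (intro smooth_inverse smooth_add smooth_norm_diff_sq b D)
  show ?thesis
  proof (rule that)
    show "(\<lambda>\<xi>. (- \<i> * complex_of_real (\<xi> $ j)) * (inverse (?D \<xi>) * \<chi>' \<xi>)) \<in> test_functions UNIV" for j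
      by (intro test_functions_mult smooth_cmult smooth_coord sD \<chi>')
    fix \<xi> :: "real^'n" assume \<xi>: "r1 / 2 < norm \<xi>" "norm \<xi> < 2 * r2"
    have n0: "complex_of_real ((norm \<xi>)\<^sup>2) \<noteq> 0" using \<xi> r by auto
    have "(norm \<xi>)\<^sup>2 = (\<Sum>j\<in>UNIV. (\<xi> $ j)\<^sup>2)" by (simp add: norm_vec_def L2_set_def sum_nonneg)
    then have n: "complex_of_real ((norm \<xi>)\<^sup>2) = (\<Sum>j\<in>UNIV. (complex_of_real (\<xi> $ j))\<^sup>2)" by simp
    have D\<xi>: "?D \<xi> = complex_of_real ((norm \<xi>)\<^sup>2)" using b(3)[of \<xi>] \<xi> by simp
    have "(\<Sum>j\<in>UNIV. \<i> * complex_of_real (\<xi> $ j) * ((- \<i> * complex_of_real (\<xi> $ j)) * (inverse (?D \<xi>) * \<chi>' \<xi>)))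
        = (\<Sum>j\<in>UNIV. (complex_of_real (\<xi> $ j))\<^sup>2 * inverse (complex_of_real ((norm \<xi>)\<^sup>2)))"
    proof (rule sum.cong[OF refl])
      fix j
      have "\<i> * complex_of_real (\<xi> $ j) * ((- \<i> * complex_of_real (\<xi> $ j)) * (inverse (?D \<xi>) * \<chi>' \<xi>))
          = (- (\<i> * \<i>)) * (complex_of_real (\<xi> $ j) * complex_of_real (\<xi> $ j)) * (inverse (?D \<xi>) * \<chi>' \<xi>)"
        by (simp only: mult_ac mult_minus_left mult_minus_right)
      then show "\<i> * complex_of_real (\<xi> $ j) * ((- \<i> * complex_of_real (\<xi> $ j)) * (inverse (?D \<xi>) * \<chi>' \<xi>))
          = (complex_of_real (\<xi> $ j))\<^sup>2 * inverse (complex_of_real ((norm \<xi>)\<^sup>2))"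
        unfolding D\<xi> \<chi>'(2)[OF \<xi>(2)] by (simp add: power2_eq_square)
    qed
    also have "\<dots> = 1" unfolding sum_distrib_right[symmetric] n[symmetric] using n0 by simp
    finally show "(\<Sum>j\<in>UNIV. \<i> * complex_of_real (\<xi> $ j) * ((- \<i> * complex_of_real (\<xi> $ j)) * (inverse (?D \<xi>) * \<chi>' \<xi>))) = 1" .
  qed
qed

text \<open>
  After dilation by \<open>l\<close> the multipliers have to be divided by \<open>l\<close>, because the symbols \<open>\<i> \<xi>\<^sub>j\<close> of the
  derivatives are not dilated.
\<close>
lemma annulus_recovery:
  assumes r: "0 < r1" "r1 < r2"
  obtains A where "A > 0" "\<And>l (p :: 'n::{finite,linorder} \<Rightarrow> ennreal) u g. 0 < l \<Longrightarrow> (\<And>i. 1 \<le> p i) \<Longrightarrow>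
    u \<in> mixed_Lebesgue p \<Longrightarrow> spectrum u \<subseteq> {\<xi>. l * r1 \<le> norm \<xi> \<and> norm \<xi> \<le> l * r2} \<Longrightarrow>
    (\<And>j. g j \<in> mixed_Lebesgue p) \<Longrightarrow> (\<And>j. weak_partial j u (g j)) \<Longrightarrow>
    mixed_norm p u \<le> ennreal (A / l) * (\<Sum>j\<in>UNIV. mixed_norm p (g j))"
proof -
  obtain m :: "'n \<Rightarrow> real^'n::_ \<Rightarrow> complex" where m: "\<And>j. m j \<in> test_functions UNIV"
    "\<And>\<xi>. r1 / 2 < norm \<xi> \<Longrightarrow> norm \<xi> < 2 * r2 \<Longrightarrow> (\<Sum>j\<in>UNIV. \<i> * complex_of_real (\<xi> $ j) * m j \<xi>) = 1"
    using annulus_multipliers_exist[OF r] by blast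
  obtain A where A: "A > 0" "\<And>j l p u. 0 < l \<Longrightarrow> (\<And>i. 1 \<le> p i) \<Longrightarrow> u \<in> borel_measurable borel \<Longrightarrow>
    mixed_norm p (convolve u (inverse_fourier (\<lambda>\<xi>. m j ((1 / l) *\<^sub>R \<xi>)))) \<le> ennreal A * mixed_norm p u"
    by (rule uniform_convolve_bound[of m]) (auto intro: m)
  show ?thesis
  proof (rule that[OF A(1)])
    fix l and p :: "'n \<Rightarrow> ennreal" and u :: "real^'n::_ \<Rightarrow> complex" and g :: "'n \<Rightarrow> real^'n::_ \<Rightarrow> complex"
    assume l: "0 < l" and p: "\<And>i. 1 \<le> p i" and u: "u \<in> mixed_Lebesgue p"
      and sp: "spectrum u \<subseteq> {\<xi>. l * r1 \<le> norm \<xi> \<and> norm \<xi> \<le> l * r2}"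
      and g: "\<And>j. g j \<in> mixed_Lebesgue p" "\<And>j. weak_partial j u (g j)"
    have mu: "u \<in> borel_measurable borel" using u by (simp add: mixed_Lebesgue_def)
    have mg: "g j \<in> borel_measurable borel" for j using g(1)[of j] by (simp add: mixed_Lebesgue_def)
    define M where "M j \<xi> = complex_of_real (1 / l) * m j ((1 / l) *\<^sub>R \<xi>)" for j \<xi>
    have ml: "(\<lambda>\<xi>. m j ((1 / l) *\<^sub>R \<xi>)) \<in> test_functions UNIV" for j by (rule test_functions_scale[OF m(1)]) (use l in simp)
    have M: "M j \<in> test_functions UNIV" for j unfolding M_def by (rule test_functions_cmult[OF ml])
    let ?V = "{\<xi> :: real^'n::_. l * (r1 / 2) < norm \<xi> \<and> norm \<xi> < l * (2 * r2)}"
    have V: "open ?V" by (intro open_Collect_conj open_Collect_less continuous_intros)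
    have "l * (r1 / 2) < l * r1" "l * r2 < l * (2 * r2)" using l r by auto
    then have spV: "spectrum u \<subseteq> ?V" using sp by force
    have M1: "(\<Sum>j\<in>UNIV. \<i> * complex_of_real (\<xi> $ j) * M j \<xi>) = 1" if "\<xi> \<in> ?V" for \<xi>
    proof -
      have "(\<Sum>j\<in>UNIV. \<i> * complex_of_real (((1 / l) *\<^sub>R \<xi>) $ j) * m j ((1 / l) *\<^sub>R \<xi>)) = 1"
        using that l by (intro m(2)) (auto simp: field_simps)
      then show ?thesis by (simp add: M_def mult_ac)
    qed
    let ?k = "\<lambda>j. inverse_fourier (\<lambda>\<xi>. m j ((1 / l) *\<^sub>R \<xi>))"
    have mk: "convolve (g j) (?k j) \<in> borel_measurable borel" for j
      by (intro convolve_measurable mg inverse_fourier_measurable ml)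
    have kM: "convolve (g j) (inverse_fourier (M j)) = (\<lambda>x. complex_of_real (1 / l) * convolve (g j) (?k j) x)" for j
      unfolding M_def inverse_fourier_cmult convolve_cmult ..
    have mkM: "convolve (g j) (inverse_fourier (M j)) \<in> borel_measurable borel" for j
      by (intro convolve_measurable mg inverse_fourier_measurable M)
    have ae: "AE x in lborel. u x = (\<Sum>j\<in>UNIV. convolve (g j) (inverse_fourier (M j)) x)"
      by (rule spectrum_reconstruct[OF mixed_Lebesgue_slow[OF u p] M V spV M1 mixed_Lebesgue_slow[OF g(1) p] g(2)])
    have "mixed_norm p u \<le> mixed_norm p (\<lambda>x. \<Sum>j\<in>UNIV. convolve (g j) (inverse_fourier (M j)) x)"
    proof (rule mixed_norm_mono_AE[OF mu _ _ p])
      show "(\<lambda>x. \<Sum>j\<in>UNIV. convolve (g j) (inverse_fourier (M j)) x) \<in> borel_measurable borel"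
        by (intro borel_measurable_sum mkM)
      show "AE x in lborel. norm (u x) \<le> norm (\<Sum>j\<in>UNIV. convolve (g j) (inverse_fourier (M j)) x)"
        using ae by eventually_elim simp
    qed
    also have "\<dots> \<le> (\<Sum>j\<in>UNIV. mixed_norm p (convolve (g j) (inverse_fourier (M j))))"
      by (rule mixed_norm_sum_le[OF _ mkM p]) simp
    also have "\<dots> \<le> (\<Sum>j\<in>UNIV. ennreal (1 / l) * (ennreal A * mixed_norm p (g j)))"
    proof (rule sum_mono)
      fix j
      have "mixed_norm p (convolve (g j) (inverse_fourier (M j))) \<le> ennreal (1 / l) * mixed_norm p (convolve (g j) (?k j))"
        unfolding kM using mixed_norm_cmult_le[OF mk p, where c="complex_of_real (1 / l)"] l by (simp add: norm_divide)
      also have "\<dots> \<le> ennreal (1 / l) * (ennreal A * mixed_norm p (g j))"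
        by (intro mult_left_mono A(2) l p mg) auto
      finally show "mixed_norm p (convolve (g j) (inverse_fourier (M j))) \<le> ennreal (1 / l) * (ennreal A * mixed_norm p (g j))" .
    qed
    also have "\<dots> = ennreal (A / l) * (\<Sum>j\<in>UNIV. mixed_norm p (g j))"
    proof -
      have "ennreal (1 / l) * ennreal A = ennreal (A / l)" using l A(1) by (simp add: ennreal_mult[symmetric])
      then show ?thesis by (simp add: sum_distrib_left mult.assoc[symmetric])
    qed
    finally show "mixed_norm p u \<le> ennreal (A / l) * (\<Sum>j\<in>UNIV. mixed_norm p (g j))" .
  qed
qed

section \<open>Derivatives of arbitrary order\<close>

lemma distr_deriv_of: "distr_deriv \<alpha> (distr_of u) \<phi> = (-1) ^ multi_order \<alpha> * (\<integral>x. u x * multi_deriv \<alpha> \<phi> x \<partial>lborel)"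
  by (simp add: distr_deriv_def distr_of_def)

lemma represents_derivI:
  assumes "slow f" "\<And>\<phi>. \<phi> \<in> schwartz \<Longrightarrow> (\<integral>x. f x * \<phi> x \<partial>lborel) = T \<phi>"
  shows "represents f T"
  unfolding represents_def distr_of_def
  using assms(2) by (auto intro: slow_measurable[OF assms(1)] slow_mult_integrable[OF assms(1)] schwartz_decays schwartz_measurable)

lemma multi_order_Suc_cases:
  assumes "multi_order \<alpha> = Suc k"
  obtains j \<beta> where "\<alpha> = \<beta>(j := Suc (\<beta> j))" "multi_order \<beta> = k"
proof -
  have "\<exists>j. \<alpha> j \<noteq> 0"
  proof (rule ccontr)
    assume "\<nexists>j. \<alpha> j \<noteq> 0"
    then show False using assms by (simp add: multi_order_def)
  qed
  then obtain j where j: "\<alpha> j \<noteq> 0" by blast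
  let ?\<beta> = "\<alpha>(j := \<alpha> j - 1)"
  have e: "\<alpha> = ?\<beta>(j := Suc (?\<beta> j))" using j by auto
  have "multi_order \<alpha> = Suc (multi_order ?\<beta>)" using multi_order_Suc[of ?\<beta> j] e by simp
  then show ?thesis using that[OF e] assms by simp
qed

text \<open>
  This reduces the order of a derivative by one: the missing first derivative has been carried out on
  the side of the function.
\<close>
lemma distr_deriv_weak_partial:
  assumes w: "weak_partial j u g" and \<phi>: "\<phi> \<in> schwartz"
  shows "distr_deriv \<beta> (distr_of g) \<phi> = distr_deriv (\<beta>(j := Suc (\<beta> j))) (distr_of u) \<phi>"
proof -
  have "(\<integral>x. g x * multi_deriv \<beta> \<phi> x \<partial>lborel) = - (\<integral>x. u x * partial j (multi_deriv \<beta> \<phi>) x \<partial>lborel)"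
    using w schwartz_multi_deriv[OF \<phi>] by (simp add: weak_partial_def)
  then show ?thesis
    unfolding distr_deriv_of multi_order_Suc multi_deriv_partial[OF schwartz_smooth[OF \<phi>]] by simp
qed

lemma distr_mixed_norm_cong:
  assumes "\<And>\<phi>. \<phi> \<in> schwartz \<Longrightarrow> S \<phi> = T \<phi>"
  shows "distr_mixed_norm p S = distr_mixed_norm p T"
proof -
  have "represents f S \<longleftrightarrow> represents f T" for f
    using assms by (auto simp: represents_def)
  then show ?thesis by (simp add: distr_mixed_norm_def)
qed

lemma band_limited_derivatives:
  assumes R: "0 < R"
  obtains A where "A > 0" "\<And>l (p :: 'n::{finite,linorder} \<Rightarrow> ennreal) u \<alpha>. 0 < l \<Longrightarrow> (\<And>i. 1 \<le> p i) \<Longrightarrow>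
    u \<in> mixed_Lebesgue p \<Longrightarrow> spectrum u \<subseteq> {\<xi>. norm \<xi> \<le> l * R} \<Longrightarrow>
    distr_mixed_norm p (distr_deriv \<alpha> (distr_of u)) \<le> ennreal ((A * l) ^ multi_order \<alpha>) * mixed_norm p u"
proof -
  obtain A where A: "A > 0" "\<And>l (p :: 'n \<Rightarrow> ennreal) u j. 0 < l \<Longrightarrow> (\<And>i. 1 \<le> p i) \<Longrightarrow>
    u \<in> mixed_Lebesgue p \<Longrightarrow> spectrum u \<subseteq> {\<xi>. norm \<xi> \<le> l * R} \<Longrightarrow>
    \<exists>g\<in>mixed_Lebesgue p. weak_partial j u g \<and> mixed_norm p g \<le> ennreal (A * l) * mixed_norm p u"
    by (rule band_limited_derivative[OF R]) blast
  show ?thesis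
  proof (rule that[OF A(1)])
    fix l and p :: "'n \<Rightarrow> ennreal" and u :: "real^'n::_ \<Rightarrow> complex" and \<alpha> :: "'n \<Rightarrow> nat"
    assume l: "0 < l" and p: "\<And>i. 1 \<le> p i" and u: "u \<in> mixed_Lebesgue p"
      and sp: "spectrum u \<subseteq> {\<xi>. norm \<xi> \<le> l * R}"
    have "multi_order \<alpha> = k \<Longrightarrow> distr_mixed_norm p (distr_deriv \<alpha> (distr_of u)) \<le> ennreal ((A * l) ^ k) * mixed_norm p u" for k
      using u sp
    proof (induction k arbitrary: \<alpha> u)
      case 0
      then have "\<alpha> = (\<lambda>_. 0)" by (auto simp: multi_order_def)
      then have "represents u (distr_deriv \<alpha> (distr_of u))"
        by (intro represents_derivI mixed_Lebesgue_slow[OF "0.prems"(2) p])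
          (simp add: distr_deriv_of multi_deriv_0 multi_order_def)
      then have "distr_mixed_norm p (distr_deriv \<alpha> (distr_of u)) \<le> mixed_norm p u"
        unfolding distr_mixed_norm_def by (intro INF_lower) simp
      then show ?case by simp
    next
      case (Suc k)
      obtain j \<beta> where j: "\<alpha> = \<beta>(j := Suc (\<beta> j))" "multi_order \<beta> = k"
        using multi_order_Suc_cases[OF Suc.prems(1)] by blast
      obtain g where g: "g \<in> mixed_Lebesgue p" "weak_partial j u g" "mixed_norm p g \<le> ennreal (A * l) * mixed_norm p u"
        using A(2)[OF l p Suc.prems(2,3)] by blast
      have "distr_mixed_norm p (distr_deriv \<alpha> (distr_of u)) = distr_mixed_norm p (distr_deriv \<beta> (distr_of g))"
        unfolding j(1) by (rule distr_mixed_norm_cong[OF distr_deriv_weak_partial[OF g(2), symmetric]])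
      also have "\<dots> \<le> ennreal ((A * l) ^ k) * mixed_norm p g"
        by (rule Suc.IH[OF j(2) g(1)]) (use spectrum_weak_partial_subset[OF g(2)] Suc.prems(3) in auto)
      also have "\<dots> \<le> ennreal ((A * l) ^ k) * (ennreal (A * l) * mixed_norm p u)"
        by (intro mult_left_mono g(3)) auto
      also have "\<dots> = ennreal ((A * l) ^ Suc k) * mixed_norm p u"
      proof -
        have "ennreal ((A * l) ^ k) * ennreal (A * l) = ennreal ((A * l) ^ k * (A * l))"
          using A(1) l by (intro ennreal_mult[symmetric]) auto
        then show ?thesis by (simp only: mult.assoc[symmetric] power_Suc2)
      qed
      finally show ?case .
    qed
    then show "distr_mixed_norm p (distr_deriv \<alpha> (distr_of u)) \<le> ennreal ((A * l) ^ multi_order \<alpha>) * mixed_norm p u" by simp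
  qed
qed

text \<open>
  Induction on \<open>k\<close>, with \<open>u\<close> replaced by its first derivatives, which are functions with spectrum in the
  same annulus.  The sum over \<open>j\<close> is estimated by \<open>n\<close> times the supremum, whence the factor \<open>n\<close>.  For
  \<open>k = 0\<close> it has to be seen that a function of finite norm that represents \<open>u\<close> agrees with \<open>u\<close> almost
  everywhere.
\<close>
lemma annulus_recovery_iterated:
  assumes r: "0 < r1" "r1 < r2"
  obtains A where "A > 0" "\<And>l (p :: 'n::{finite,linorder} \<Rightarrow> ennreal) u k. 0 < l \<Longrightarrow> (\<And>i. 1 \<le> p i) \<Longrightarrow>
    u \<in> mixed_Lebesgue p \<Longrightarrow> spectrum u \<subseteq> {\<xi>. l * r1 \<le> norm \<xi> \<and> norm \<xi> \<le> l * r2} \<Longrightarrow>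
    mixed_norm p u \<le> ennreal ((A / l) ^ k) * (SUP \<alpha>\<in>{\<alpha>. multi_order \<alpha> = k}. distr_mixed_norm p (distr_deriv \<alpha> (distr_of u)))"
proof -
  have r2: "0 < r2" using r by simp
  obtain B where B: "B > 0" "\<And>l (p :: 'n \<Rightarrow> ennreal) u j. 0 < l \<Longrightarrow> (\<And>i. 1 \<le> p i) \<Longrightarrow>
    u \<in> mixed_Lebesgue p \<Longrightarrow> spectrum u \<subseteq> {\<xi>. norm \<xi> \<le> l * r2} \<Longrightarrow>
    \<exists>g\<in>mixed_Lebesgue p. weak_partial j u g \<and> mixed_norm p g \<le> ennreal (B * l) * mixed_norm p u"
    by (rule band_limited_derivative[OF r2]) blast
  obtain A where A: "A > 0" "\<And>l (p :: 'n \<Rightarrow> ennreal) u g. 0 < l \<Longrightarrow> (\<And>i. 1 \<le> p i) \<Longrightarrow>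
    u \<in> mixed_Lebesgue p \<Longrightarrow> spectrum u \<subseteq> {\<xi>. l * r1 \<le> norm \<xi> \<and> norm \<xi> \<le> l * r2} \<Longrightarrow>
    (\<And>j. g j \<in> mixed_Lebesgue p) \<Longrightarrow> (\<And>j. weak_partial j u (g j)) \<Longrightarrow>
    mixed_norm p u \<le> ennreal (A / l) * (\<Sum>j\<in>UNIV. mixed_norm p (g j))"
    by (rule annulus_recovery[OF r]) blast
  let ?n = "real CARD('n)"
  show ?thesis
  proof (rule that)
    show "0 < ?n * A" using A(1) by simp
    fix l and p :: "'n \<Rightarrow> ennreal" and u :: "real^'n::_ \<Rightarrow> complex" and k
    assume l: "0 < l" and p: "\<And>i. 1 \<le> p i" and u: "u \<in> mixed_Lebesgue p"
      and sp: "spectrum u \<subseteq> {\<xi>. l * r1 \<le> norm \<xi> \<and> norm \<xi> \<le> l * r2}"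
    let ?S = "\<lambda>k u. SUP \<alpha>\<in>{\<alpha>. multi_order \<alpha> = k}. distr_mixed_norm p (distr_deriv \<alpha> (distr_of u))"
    show "mixed_norm p u \<le> ennreal ((?n * A / l) ^ k) * ?S k u"
      using u sp
    proof (induction k arbitrary: u)
      case 0
      note su = mixed_Lebesgue_slow[OF "0.prems"(1) p]
      have "mixed_norm p u \<le> distr_mixed_norm p (distr_deriv (\<lambda>_. 0) (distr_of u))"
        unfolding distr_mixed_norm_def
      proof (rule INF_greatest)
        fix f assume "f \<in> {f. represents f (distr_deriv (\<lambda>_. 0) (distr_of u))}"
        then have f: "f \<in> borel_measurable borel" "\<And>\<phi>. \<phi> \<in> schwartz \<Longrightarrow> (\<integral>x. u x * \<phi> x \<partial>lborel) = (\<integral>x. f x * \<phi> x \<partial>lborel)"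
          by (auto simp: represents_def distr_deriv_of multi_deriv_0 multi_order_def) (simp add: distr_of_def)
        show "mixed_norm p u \<le> mixed_norm p f"
        proof (cases "mixed_norm p f < \<infinity>")
          case True
          then have "slow f" using f(1) by (intro mixed_Lebesgue_slow[OF _ p]) (simp add: mixed_Lebesgue_def)
          then have "AE x in lborel. u x = f x"
            by (intro slow_eq_AE su f(2) fourier_schwartz)
          then have "AE x in lborel. norm (u x) \<le> norm (f x)" by eventually_elim simp
          then show ?thesis using f(1) slow_measurable[OF su] by (intro mixed_norm_mono_AE p)
        next
          case False
          then show ?thesis by (simp add: not_less top_unique)
        qed
      qed
      also have "\<dots> \<le> ?S 0 u" by (rule SUP_upper) (simp add: multi_order_def)
      finally show ?case by simp
    next
      case (Suc k)
      have "spectrum u \<subseteq> {\<xi>. norm \<xi> \<le> l * r2}" using Suc.prems(2) by auto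
      then have "\<forall>j. \<exists>g. g \<in> mixed_Lebesgue p \<and> weak_partial j u g"
        using B(2)[OF l p Suc.prems(1)] by blast
      then obtain g where g: "\<And>j. g j \<in> mixed_Lebesgue p" "\<And>j. weak_partial j u (g j)" by metis
      have gj: "mixed_norm p (g j) \<le> ennreal ((?n * A / l) ^ k) * ?S (Suc k) u" for j
      proof -
        have "mixed_norm p (g j) \<le> ennreal ((?n * A / l) ^ k) * ?S k (g j)"
          by (rule Suc.IH[OF g(1)]) (use spectrum_weak_partial_subset[OF g(2)] Suc.prems(2) in blast)
        also have "\<dots> \<le> ennreal ((?n * A / l) ^ k) * ?S (Suc k) u"
        proof (intro mult_left_mono SUP_least)
          fix \<beta> assume "\<beta> \<in> {\<beta> :: 'n \<Rightarrow> nat. multi_order \<beta> = k}"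
          then have \<beta>: "multi_order (\<beta>(j := Suc (\<beta> j))) = Suc k" by (simp only: multi_order_Suc mem_Collect_eq)
          have "distr_mixed_norm p (distr_deriv \<beta> (distr_of (g j))) = distr_mixed_norm p (distr_deriv (\<beta>(j := Suc (\<beta> j))) (distr_of u))"
            by (rule distr_mixed_norm_cong[OF distr_deriv_weak_partial[OF g(2)]])
          also have "\<dots> \<le> ?S (Suc k) u" by (rule SUP_upper) (simp only: mem_Collect_eq \<beta>)
          finally show "distr_mixed_norm p (distr_deriv \<beta> (distr_of (g j))) \<le> ?S (Suc k) u" .
        qed simp
        finally show ?thesis .
      qed
      have "mixed_norm p u \<le> ennreal (A / l) * (\<Sum>j\<in>UNIV. mixed_norm p (g j))"
        by (rule A(2)[OF l p Suc.prems g])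
      also have "\<dots> \<le> ennreal (A / l) * (\<Sum>j\<in>(UNIV :: 'n set). ennreal ((?n * A / l) ^ k) * ?S (Suc k) u)"
        by (intro mult_left_mono sum_mono gj) auto
      also have "\<dots> = ennreal (A / l) * (ennreal ?n * (ennreal ((?n * A / l) ^ k) * ?S (Suc k) u))"
        by (simp add: ennreal_of_nat_eq_real_of_nat)
      also have "\<dots> = ennreal ((?n * A / l) ^ Suc k) * ?S (Suc k) u"
      proof -
        have "ennreal (A / l) * (ennreal ?n * ennreal ((?n * A / l) ^ k)) = ennreal (A / l * (?n * (?n * A / l) ^ k))"
          using A(1) l by (subst ennreal_mult, simp, simp)+ simp
        also have "A / l * (?n * (?n * A / l) ^ k) = (?n * A / l) ^ Suc k" by simp
        finally show ?thesis by (simp only: mult.assoc[symmetric])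
      qed
      finally show ?case .
    qed
  qed
qed

theorem lemma2p1:
  fixes R r1 r2 :: real
  assumes "0 < R" and "0 < r1" and "r1 < r2"
  shows "\<exists>C::real. C > 1 \<and>
    (\<forall>(k::nat) (p :: 'n::{finite,linorder} \<Rightarrow> ennreal) (q :: 'n \<Rightarrow> ennreal) (lam::real)
        (u :: real ^ 'n::_ \<Rightarrow> complex).
      (\<forall>i. 1 \<le> p i \<and> p i \<le> q i) \<and> 0 < lam \<and> u \<in> mixed_Lebesgue p \<longrightarrow>
        (distr_supp (distr_fourier (distr_of u)) \<subseteq> {\<xi>. norm \<xi> \<le> lam * R} \<longrightarrow>
          (SUP \<alpha>\<in>{\<alpha>. multi_order \<alpha> = k}. distr_mixed_norm q (distr_deriv \<alpha> (distr_of u)))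
            \<le> ennreal (C ^ (k + 1) * lam powr (real k + (\<Sum>i\<in>UNIV. recip (p i) - recip (q i))))
              * mixed_norm p u) \<and>
        (distr_supp (distr_fourier (distr_of u)) \<subseteq> {\<xi>. lam * r1 \<le> norm \<xi> \<and> norm \<xi> \<le> lam * r2} \<longrightarrow>
          ennreal (inverse (C ^ (k + 1)) * lam ^ k) * mixed_norm p u
            \<le> (SUP \<alpha>\<in>{\<alpha>. multi_order \<alpha> = k}. distr_mixed_norm p (distr_deriv \<alpha> (distr_of u))) \<and>
          (SUP \<alpha>\<in>{\<alpha>. multi_order \<alpha> = k}. distr_mixed_norm p (distr_deriv \<alpha> (distr_of u)))
            \<le> ennreal (C ^ (k + 1) * lam ^ k) * mixed_norm p u))"
proof -
  have r2: "0 < r2" using assms by simp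
  obtain A0 where A0: "A0 > 0" "\<And>l (p :: 'n \<Rightarrow> ennreal) q u. 0 < l \<Longrightarrow> (\<And>i. 1 \<le> p i) \<Longrightarrow> (\<And>i. p i \<le> q i) \<Longrightarrow>
    u \<in> mixed_Lebesgue p \<Longrightarrow> spectrum u \<subseteq> {\<xi>. norm \<xi> \<le> l * R} \<Longrightarrow>
    mixed_norm q u \<le> ennreal (A0 * l powr (\<Sum>i\<in>UNIV. recip (p i) - recip (q i))) * mixed_norm p u"
    by (rule band_limited_embedding[OF assms(1)]) blast
  obtain A1 where A1: "A1 > 0" "\<And>l (p :: 'n \<Rightarrow> ennreal) u \<alpha>. 0 < l \<Longrightarrow> (\<And>i. 1 \<le> p i) \<Longrightarrow>
    u \<in> mixed_Lebesgue p \<Longrightarrow> spectrum u \<subseteq> {\<xi>. norm \<xi> \<le> l * R} \<Longrightarrow>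
    distr_mixed_norm p (distr_deriv \<alpha> (distr_of u)) \<le> ennreal ((A1 * l) ^ multi_order \<alpha>) * mixed_norm p u"
    by (rule band_limited_derivatives[OF assms(1)]) blast
  obtain A2 where A2: "A2 > 0" "\<And>l (p :: 'n \<Rightarrow> ennreal) u \<alpha>. 0 < l \<Longrightarrow> (\<And>i. 1 \<le> p i) \<Longrightarrow>
    u \<in> mixed_Lebesgue p \<Longrightarrow> spectrum u \<subseteq> {\<xi>. norm \<xi> \<le> l * r2} \<Longrightarrow>
    distr_mixed_norm p (distr_deriv \<alpha> (distr_of u)) \<le> ennreal ((A2 * l) ^ multi_order \<alpha>) * mixed_norm p u"
    by (rule band_limited_derivatives[OF r2]) blast
  obtain A3 where A3: "A3 > 0" "\<And>l (p :: 'n \<Rightarrow> ennreal) u k. 0 < l \<Longrightarrow> (\<And>i. 1 \<le> p i) \<Longrightarrow>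
    u \<in> mixed_Lebesgue p \<Longrightarrow> spectrum u \<subseteq> {\<xi>. l * r1 \<le> norm \<xi> \<and> norm \<xi> \<le> l * r2} \<Longrightarrow>
    mixed_norm p u \<le> ennreal ((A3 / l) ^ k) * (SUP \<alpha>\<in>{\<alpha>. multi_order \<alpha> = k}. distr_mixed_norm p (distr_deriv \<alpha> (distr_of u)))"
    by (rule annulus_recovery_iterated[OF assms(2,3)]) blast
  \<comment> \<open>A bound for all four constants suffices: \<open>k\<close> steps and one more factor give \<open>C\<^bsup>k + 1\<^esup>\<close>.\<close>
  define C where "C = 2 + A0 + A1 + A2 + A3"
  have C: "1 < C" "A0 \<le> C" "A1 \<le> C" "A2 \<le> C" "A3 \<le> C" using A0(1) A1(1) A2(1) A3(1) by (auto simp: C_def)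
  have pow: "A ^ k * B \<le> C ^ (k + 1)" if "0 < A" "A \<le> C" "0 < B" "B \<le> C" for A B k
  proof -
    have "A ^ k * B \<le> C ^ k * C" using that C by (intro mult_mono power_mono) auto
    then show ?thesis by (simp add: mult.commute)
  qed
  show ?thesis
  proof (intro exI[of _ C] conjI[OF C(1)] allI impI)
    fix k :: nat and p q :: "'n \<Rightarrow> ennreal" and l :: real and u :: "real^'n::_ \<Rightarrow> complex"
    assume "(\<forall>i. 1 \<le> p i \<and> p i \<le> q i) \<and> 0 < l \<and> u \<in> mixed_Lebesgue p"
    then have p: "\<And>i. 1 \<le> p i" and pq: "\<And>i. p i \<le> q i" and l: "0 < l" and u: "u \<in> mixed_Lebesgue p" by auto
    have q: "1 \<le> q i" for i using p[of i] pq[of i] by simp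
    let ?s = "\<Sum>i\<in>UNIV. recip (p i) - recip (q i)"
    let ?S = "SUP \<alpha>\<in>{\<alpha>. multi_order \<alpha> = k}. distr_mixed_norm p (distr_deriv \<alpha> (distr_of u))"
    have ball: "(SUP \<alpha>\<in>{\<alpha>. multi_order \<alpha> = k}. distr_mixed_norm q (distr_deriv \<alpha> (distr_of u)))
        \<le> ennreal (C ^ (k + 1) * l powr (real k + ?s)) * mixed_norm p u"
      if sp: "spectrum u \<subseteq> {\<xi>. norm \<xi> \<le> l * R}"
    proof (rule SUP_least)
      fix \<alpha> :: "'n \<Rightarrow> nat" assume "\<alpha> \<in> {\<alpha>. multi_order \<alpha> = k}"
      then have \<alpha>: "multi_order \<alpha> = k" by simp
      have e: "mixed_norm q u \<le> ennreal (A0 * l powr ?s) * mixed_norm p u" by (rule A0(2)[OF l p pq u sp])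
      also have "\<dots> < \<infinity>" using u by (simp add: mixed_Lebesgue_def ennreal_mult_less_top)
      finally have uq: "u \<in> mixed_Lebesgue q" using u by (simp add: mixed_Lebesgue_def)
      have "distr_mixed_norm q (distr_deriv \<alpha> (distr_of u)) \<le> ennreal ((A1 * l) ^ k) * mixed_norm q u"
        using A1(2)[OF l q uq sp, of \<alpha>] \<alpha> by simp
      also have "\<dots> \<le> ennreal ((A1 * l) ^ k) * (ennreal (A0 * l powr ?s) * mixed_norm p u)"
        by (intro mult_left_mono e) auto
      also have "\<dots> = ennreal ((A1 ^ k * A0) * (l ^ k * l powr ?s)) * mixed_norm p u"
      proof -
        have "ennreal ((A1 * l) ^ k) * ennreal (A0 * l powr ?s) = ennreal ((A1 * l) ^ k * (A0 * l powr ?s))"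
          using A0(1) A1(1) l by (intro ennreal_mult[symmetric]) auto
        also have "(A1 * l) ^ k * (A0 * l powr ?s) = (A1 ^ k * A0) * (l ^ k * l powr ?s)"
          by (simp add: power_mult_distrib)
        finally show ?thesis by (simp only: mult.assoc[symmetric])
      qed
      also have "\<dots> \<le> ennreal (C ^ (k + 1) * (l ^ k * l powr ?s)) * mixed_norm p u"
        using pow[OF A1(1) C(3) A0(1) C(2)] l by (intro mult_right_mono ennreal_leI) auto
      also have "l ^ k * l powr ?s = l powr (real k + ?s)" using l by (simp add: powr_add powr_realpow)
      finally show "distr_mixed_norm q (distr_deriv \<alpha> (distr_of u)) \<le> ennreal (C ^ (k + 1) * l powr (real k + ?s)) * mixed_norm p u" .
    qed
    have low: "ennreal (inverse (C ^ (k + 1)) * l ^ k) * mixed_norm p u \<le> ?S"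
      if sp: "spectrum u \<subseteq> {\<xi>. l * r1 \<le> norm \<xi> \<and> norm \<xi> \<le> l * r2}"
    proof -
      have "ennreal (inverse (C ^ (k + 1)) * l ^ k) * mixed_norm p u
          \<le> ennreal (inverse (C ^ (k + 1)) * l ^ k) * (ennreal ((A3 / l) ^ k) * ?S)"
        by (intro mult_left_mono A3(2)[OF l p u sp]) auto
      also have "\<dots> = ennreal (inverse (C ^ (k + 1)) * A3 ^ k) * ?S"
      proof -
        have "inverse (C ^ (k + 1)) * l ^ k * (A3 / l) ^ k = inverse (C ^ (k + 1)) * A3 ^ k"
          using l by (simp add: power_divide)
        then have "ennreal (inverse (C ^ (k + 1)) * l ^ k) * ennreal ((A3 / l) ^ k) = ennreal (inverse (C ^ (k + 1)) * A3 ^ k)"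
          using l C(1) A3(1) by (subst ennreal_mult[symmetric]) auto
        then show ?thesis by (simp only: mult.assoc[symmetric])
      qed
      also have "\<dots> \<le> 1 * ?S"
      proof (rule mult_right_mono)
        have "A3 ^ k * 1 \<le> C ^ (k + 1)" using C by (intro pow A3(1)) auto
        moreover have "0 < C ^ (k + 1)" using C(1) by simp
        ultimately have "inverse (C ^ (k + 1)) * A3 ^ k \<le> 1" by (simp add: field_simps)
        then show "ennreal (inverse (C ^ (k + 1)) * A3 ^ k) \<le> 1" by (simp add: ennreal_le_1)
      qed simp
      finally show ?thesis by simp
    qed
    have up: "?S \<le> ennreal (C ^ (k + 1) * l ^ k) * mixed_norm p u"
      if sp: "spectrum u \<subseteq> {\<xi>. l * r1 \<le> norm \<xi> \<and> norm \<xi> \<le> l * r2}"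
    proof (rule SUP_least)
      fix \<alpha> :: "'n \<Rightarrow> nat" assume "\<alpha> \<in> {\<alpha>. multi_order \<alpha> = k}"
      then have \<alpha>: "multi_order \<alpha> = k" by simp
      have sp': "spectrum u \<subseteq> {\<xi>. norm \<xi> \<le> l * r2}" using sp by auto
      have "distr_mixed_norm p (distr_deriv \<alpha> (distr_of u)) \<le> ennreal ((A2 * l) ^ k) * mixed_norm p u"
        using A2(2)[OF l p u sp', of \<alpha>] \<alpha> by simp
      also have "\<dots> \<le> ennreal (C ^ (k + 1) * l ^ k) * mixed_norm p u"
      proof (intro mult_right_mono ennreal_leI)
        have "A2 ^ k * 1 \<le> C ^ (k + 1)" using C by (intro pow A2(1)) auto
        then show "(A2 * l) ^ k \<le> C ^ (k + 1) * l ^ k" unfolding power_mult_distrib using l by (intro mult_right_mono) auto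
      qed simp
      finally show "distr_mixed_norm p (distr_deriv \<alpha> (distr_of u)) \<le> ennreal (C ^ (k + 1) * l ^ k) * mixed_norm p u" .
    qed
    from ball low up
    show "(spectrum u \<subseteq> {\<xi>. norm \<xi> \<le> l * R} \<longrightarrow>
          (SUP \<alpha>\<in>{\<alpha>. multi_order \<alpha> = k}. distr_mixed_norm q (distr_deriv \<alpha> (distr_of u)))
            \<le> ennreal (C ^ (k + 1) * l powr (real k + ?s)) * mixed_norm p u) \<and>
        (spectrum u \<subseteq> {\<xi>. l * r1 \<le> norm \<xi> \<and> norm \<xi> \<le> l * r2} \<longrightarrow>
          ennreal (inverse (C ^ (k + 1)) * l ^ k) * mixed_norm p u \<le> ?S \<and>
          ?S \<le> ennreal (C ^ (k + 1) * l ^ k) * mixed_norm p u)"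
      by blast
  qed
qed

end
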